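(* For every Halin graph $G$ with $\Delta(G)\le 5$, with characteristic tree $T$ and adjoint cycle $C=a_1a_2\cdots a_na_1$, the coloring of $V(G)$ by $\{1,1',2_a,2_b,2_c\}$ returned by the PACKING-COLORING algorithm is a $(1^2,2^3)$-packing coloring of $G$: any two distinct vertices both colored $1$, or both colored $1'$, are at distance at least $2$, and any two distinct vertices sharing a color in $\{2_a,2_b,2_c\}$ are at distance at least $3$ in $G$.
   Context: A Halin graph is a plane graph constructed from a (plane) tree $T$ without vertices of degree two (the characteristic tree) by connecting all leaves of $T$ through a cycle $C$ (the adjoint cycle, in the cyclic order of the leaves in the embedding). Write $C=a_1a_2\cdots a_na_1$; each $a_i$ is a leaf of $T$ and $b_i$ denotes its unique neighbor in $T$. The PACKING-COLORING algorithm consists of the following steps. (1) Properly color $T$ with colors $1,1'$ (by BFS from an arbitrary root colored $1$); call the coloring $\varphi$. (2) RECOLORING. If $\varphi(a_1)\neq\varphi(a_n)$, go to CASE-1. If $\varphi(a_1)=\varphi(a_n)$ but not all $\varphi(a_i)$ are equal, take the least $i\ge 2$ with $\varphi(a_i)\ne\varphi(a_{i-1})$, relabel cyclically $(a_1,\dots,a_n):=(a_i,\dots,a_n,a_1,\dots,a_{i-1})$ (and the $b_j$ accordingly), and go to CASE-1. If all $\varphi(a_i)$ are equal, go to CASE-2. Let $1_k$ denote the color in $\{1,1'\}$ different from $\varphi(b_k)$, and $m=4\lfloor n/4\rfloor$. In both cases, for $1\le k\le m$ recolor $a_k$ with $1_k$ if $k$ is odd, $2_a$ if $k\equiv2\pmod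 4$, and $2_b$ if $k\equiv 0\pmod 4$. CASE-1, remaining vertices: if $n-m=1$, $\varphi(a_n)=1_n$; if $n-m=2$, $\varphi(a_{n-1})=2_a$, $\varphi(a_n)=1_n$; if $n-m=3$, $\varphi(a_{n-2})=1_{n-2}$, $\varphi(a_{n-1})=2_a$, $\varphi(a_n)=1_n$. CASE-2, remaining vertices: if $n-m=1$, $\varphi(a_n)=2_c$; if $n-m=2$, $\varphi(a_{n-1})=1_{n-1}$, $\varphi(a_n)=2_c$; if $n-m=3$, $\varphi(a_{n-2})=2_a$, $\varphi(a_{n-1})=1_{n-1}$, $\varphi(a_n)=2_b$. In CASE-2, two further modifications follow in order: (i) if $\varphi(a_n)=2_c$ and there is $i\in\{1,\dots,n-2\}$ with $\varphi(a_{n-1})=\varphi(a_i)=2_b$ and $b_n=b_{n-1}=b_i$, set $\varphi(a_2)=2_c$, $\varphi(a_{n-1})=2_c$, $\varphi(a_n)=2_a$; (ii) then, if $\varphi(a_n)=2_c$, no $i\in\{1,\dots,n-1\}$ satisfies both $\varphi(a_i)\in\{2_a,2_b\}$ and $b_i=b_n$, and some $i\in\{4,\dots,n-1\}$ satisfies $\varphi(a_i)=2_a$ and $b_i=b_2$, set $\varphi(a_2)=2_c$, $\varphi(a_n)=2_a$. (3) CONFLICTS-RESOLVING. For each $b\in\{b_1,\dots,b_n\}$ let $\mathcal N[b]$ be the set of vertices $a_j$ adjacent to $b$ whose color (after RECOLORING) is not in $\{1,1'\}$. Put $a_0:=a_n$. For $i=1,\dots,n$ in increasing order, when $i$ is even: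 if there is $j\neq i$ with $a_j\in\mathcal N[b_i]$, $\varphi(a_j)=\varphi(a_i)$ and $\varphi(a_i)\ne 2_c$ (current colors), then for the first such $j$ recolor $a_i$ with $2_c$ if $\varphi(a_{i-2})\neq 2_c$, and recolor $a_j$ with $2_c$ if $\varphi(a_{i-2})=2_c$. Here $\mathcal N[b_i]$ is considered only for $b_i$ and indices $i$ with $a_i$ itself colored outside $\{1,1'\}$ (automatic for conflicts). The final $\varphi$ is returned. *)

theory Defs
  imports "Graph_Theory.Graph_Theory" "HOL-Combinatorics.Orbits"
begin

text \<open>A finite simple graph is a symmetric, loop-free, finite digraph without parallel arcs
  (locale \<^locale>\<open>pair_graph\<close>); the degree of a vertex is its out-degree.\<close>

text \<open>The constant \<^const>\<open>tree\<close> of the library is unusable for symmetric digraphs, since it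
  counts a pair of opposite arcs as a cycle.  Undirected cycles are those of length at least 3.\<close>

definition is_tree :: "'v pair_pre_digraph \<Rightarrow> bool" where
  "is_tree T \<longleftrightarrow> pair_graph T \<and> connected (with_proj T) \<and>
     \<not> (\<exists>p. pre_digraph.cycle (with_proj T) p \<and> 3 \<le> length p)"

definition leaves :: "'v pair_pre_digraph \<Rightarrow> 'v set" where
  "leaves T = {v \<in> pverts T. out_degree (with_proj T) v = 1}"

definition max_degree :: "'v pair_pre_digraph \<Rightarrow> nat" where
  "max_degree G = Max (out_degree (with_proj G) ` pverts G)"

definition gdist :: "'v pair_pre_digraph \<Rightarrow> 'v \<Rightarrow> 'v \<Rightarrow> ereal" where
  "gdist G u v = wf_digraph.\<mu> (with_proj G) (\<lambda>_. 1) u v"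


section \<open>Plane trees and Halin graphs\<close>

text \<open>A plane embedding of a tree is given by its rotation system: \<open>rot v\<close> maps each neighbour
  of \<open>v\<close> to the next one in the cyclic order around \<open>v\<close>.  Every rotation system of a tree is
  planar, with a single face, whose boundary walk is traced by \<open>face_step rot\<close>.\<close>

definition rotation_system :: "'v pair_pre_digraph \<Rightarrow> ('v \<Rightarrow> 'v \<Rightarrow> 'v) \<Rightarrow> bool" where
  "rotation_system T rot \<longleftrightarrow> (\<forall>v \<in> pverts T. cyclic_on (rot v) {w. (v, w) \<in> parcs T})"

definition face_step :: "('v \<Rightarrow> 'v \<Rightarrow> 'v) \<Rightarrow> 'v \<times> 'v \<Rightarrow> 'v \<times> 'v" where
  "face_step rot = (\<lambda>(u, v). (v, rot v u))"

text \<open>\<open>w\<close> is the first leaf met by the boundary walk after it has left the leaf \<open>u\<close>.\<close>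

definition next_leaf ::
    "'v pair_pre_digraph \<Rightarrow> ('v \<Rightarrow> 'v \<Rightarrow> 'v) \<Rightarrow> 'v \<Rightarrow> 'v \<Rightarrow> bool" where
  "next_leaf T rot u w \<longleftrightarrow> u \<in> leaves T \<and> w \<in> leaves T \<and>
     (\<exists>b k. (u, b) \<in> parcs T \<and> snd ((face_step rot ^^ k) (u, b)) = w \<and>
        (\<forall>j < k. snd ((face_step rot ^^ j) (u, b)) \<notin> leaves T))"

definition cycle_edges :: "'v list \<Rightarrow> 'v rel" where
  "cycle_edges C = {(C ! i, C ! (Suc i mod length C)) |i. i < length C}"

text \<open>\<open>halin_graph G T rot C\<close>: \<open>G\<close> is the Halin graph with characteristic tree \<open>T\<close>, embedded
  by \<open>rot\<close>, and adjoint cycle \<open>C = [a\<^sub>1, \<dots>, a\<^sub>n]\<close>.  The first vertex \<open>a\<^sub>1\<close> is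
  an arbitrary leaf.\<close>

definition halin_graph ::
    "'v pair_pre_digraph \<Rightarrow> 'v pair_pre_digraph \<Rightarrow> ('v \<Rightarrow> 'v \<Rightarrow> 'v) \<Rightarrow> 'v list \<Rightarrow> bool" where
  "halin_graph G T rot C \<longleftrightarrow>
     is_tree T \<and> (\<forall>v \<in> pverts T. out_degree (with_proj T) v \<noteq> 2) \<and>
     rotation_system T rot \<and>
     distinct C \<and> set C = leaves T \<and> 3 \<le> length C \<and>
     (\<forall>i < length C. next_leaf T rot (C ! i) (C ! (Suc i mod length C))) \<and>
     G = \<lparr>pverts = pverts T, parcs = parcs T \<union> cycle_edges C \<union> (cycle_edges C)\<inverse>\<rparr>"


section \<open>Packing colorings\<close>

text \<open>In an \<open>s\<close>-packing coloring, distinct vertices of color \<open>c\<close> are at distance greater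
  than \<open>s c\<close>.\<close>

definition packing_coloring ::
    "'v pair_pre_digraph \<Rightarrow> ('c \<Rightarrow> nat) \<Rightarrow> ('v \<Rightarrow> 'c) \<Rightarrow> bool" where
  "packing_coloring G s \<phi> \<longleftrightarrow>
     (\<forall>u \<in> pverts G. \<forall>v \<in> pverts G. u \<noteq> v \<and> \<phi> u = \<phi> v \<longrightarrow>
        ereal (real (s (\<phi> u) + 1)) \<le> gdist G u v)"

datatype color = One | One' | TwoA | TwoB | TwoC

fun radius :: "color \<Rightarrow> nat" where
  "radius One = 1"
| "radius One' = 1"
| "radius TwoA = 2"
| "radius TwoB = 2"
| "radius TwoC = 2"


section \<open>The PACKING-COLORING algorithm\<close>

subsection \<open>Coloring the tree\<close>

text \<open>Pair of the visited vertices and the current layer of a breadth-first search.\<close>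

primrec bfs :: "'v pair_pre_digraph \<Rightarrow> 'v \<Rightarrow> nat \<Rightarrow> 'v set \<times> 'v set" where
  "bfs T r 0 = ({r}, {r})"
| "bfs T r (Suc k) =
     (let (V, L) = bfs T r k; L' = {w. \<exists>v \<in> L. (v, w) \<in> parcs T} - V in (V \<union> L', L'))"

definition bfs_coloring :: "'v pair_pre_digraph \<Rightarrow> 'v \<Rightarrow> 'v \<Rightarrow> color" where
  "bfs_coloring T r v = (if \<exists>k. even k \<and> v \<in> snd (bfs T r k) then One else One')"

subsection \<open>RECOLORING\<close>

text \<open>1-based and cyclic access to the adjoint cycle; in particular \<open>vtx C 0 = vtx C n\<close>.\<close>

definition vtx :: "'v list \<Rightarrow> nat \<Rightarrow> 'v" where
  "vtx C k = C ! ((k + length C - 1) mod length C)"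

text \<open>The vertex \<open>b\<^sub>k\<close>.\<close>

definition nbr :: "'v pair_pre_digraph \<Rightarrow> 'v list \<Rightarrow> nat \<Rightarrow> 'v" where
  "nbr T C k = (THE w. (vtx C k, w) \<in> parcs T)"

text \<open>The color \<open>1\<^sub>k\<close>.  The algorithm never recolors the inner vertices \<open>b\<^sub>k\<close>, so \<open>\<phi>\<close>
  can be taken to be the initial coloring of \<open>T\<close>.\<close>

definition one_at :: "'v pair_pre_digraph \<Rightarrow> 'v list \<Rightarrow> ('v \<Rightarrow> color) \<Rightarrow> nat \<Rightarrow> color" where
  "one_at T C \<phi> k = (if \<phi> (nbr T C k) = One then One' else One)"

definition monochromatic :: "'v list \<Rightarrow> ('v \<Rightarrow> color) \<Rightarrow> bool" where
  "monochromatic C \<phi> \<longleftrightarrow> (\<forall>u \<in> set C. \<forall>v \<in> set C. \<phi> u = \<phi> v)"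

definition relabel :: "'v list \<Rightarrow> ('v \<Rightarrow> color) \<Rightarrow> 'v list" where
  "relabel C \<phi> =
     (if \<phi> (vtx C 1) \<noteq> \<phi> (vtx C (length C)) \<or> monochromatic C \<phi> then C
      else rotate ((LEAST i. 2 \<le> i \<and> i \<le> length C \<and> \<phi> (vtx C i) \<noteq> \<phi> (vtx C (i - 1))) - 1) C)"

text \<open>In the following, \<open>\<phi>\<^sub>0\<close> is the initial coloring of \<open>T\<close> and \<open>\<phi>\<close> the current one.\<close>

definition recolor_main ::
    "'v pair_pre_digraph \<Rightarrow> 'v list \<Rightarrow> ('v \<Rightarrow> color) \<Rightarrow> ('v \<Rightarrow> color) \<Rightarrow> 'v \<Rightarrow> color" where
  "recolor_main T C \<phi>\<^sub>0 \<phi> =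
     fold (\<lambda>k \<phi>. \<phi>(vtx C k :=
              (if odd k then one_at T C \<phi>\<^sub>0 k else if k mod 4 = 2 then TwoA else TwoB)))
       [1..<4 * (length C div 4) + 1] \<phi>"

definition recolor_rest1 ::
    "'v pair_pre_digraph \<Rightarrow> 'v list \<Rightarrow> ('v \<Rightarrow> color) \<Rightarrow> ('v \<Rightarrow> color) \<Rightarrow> 'v \<Rightarrow> color" where
  "recolor_rest1 T C \<phi>\<^sub>0 \<phi> =
     (let n = length C; m = 4 * (n div 4); a = vtx C; one = one_at T C \<phi>\<^sub>0 in
      if n - m = 1 then \<phi>(a n := one n)
      else if n - m = 2 then \<phi>(a (n - 1) := TwoA, a n := one n)
      else if n - m = 3 then \<phi>(a (n - 2) := one (n - 2), a (n - 1) := TwoA, a n := one n)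
      else \<phi>)"

definition recolor_rest2 ::
    "'v pair_pre_digraph \<Rightarrow> 'v list \<Rightarrow> ('v \<Rightarrow> color) \<Rightarrow> ('v \<Rightarrow> color) \<Rightarrow> 'v \<Rightarrow> color" where
  "recolor_rest2 T C \<phi>\<^sub>0 \<phi> =
     (let n = length C; m = 4 * (n div 4); a = vtx C; one = one_at T C \<phi>\<^sub>0 in
      if n - m = 1 then \<phi>(a n := TwoC)
      else if n - m = 2 then \<phi>(a (n - 1) := one (n - 1), a n := TwoC)
      else if n - m = 3 then \<phi>(a (n - 2) := TwoA, a (n - 1) := one (n - 1), a n := TwoB)
      else \<phi>)"

definition modification_i ::
    "'v pair_pre_digraph \<Rightarrow> 'v list \<Rightarrow> ('v \<Rightarrow> color) \<Rightarrow> 'v \<Rightarrow> color" where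
  "modification_i T C \<phi> =
     (let n = length C; a = vtx C; b = nbr T C in
      if \<phi> (a n) = TwoC \<and>
         (\<exists>i \<in> {1..n - 2}. \<phi> (a (n - 1)) = TwoB \<and> \<phi> (a i) = TwoB \<and>
            b n = b (n - 1) \<and> b (n - 1) = b i)
      then \<phi>(a 2 := TwoC, a (n - 1) := TwoC, a n := TwoA)
      else \<phi>)"

definition modification_ii ::
    "'v pair_pre_digraph \<Rightarrow> 'v list \<Rightarrow> ('v \<Rightarrow> color) \<Rightarrow> 'v \<Rightarrow> color" where
  "modification_ii T C \<phi> =
     (let n = length C; a = vtx C; b = nbr T C in
      if \<phi> (a n) = TwoC \<and>
         \<not> (\<exists>i \<in> {1..n - 1}. \<phi> (a i) \<in> {TwoA, TwoB} \<and> b i = b n) \<and>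
         (\<exists>i \<in> {4..n - 1}. \<phi> (a i) = TwoA \<and> b i = b 2)
      then \<phi>(a 2 := TwoC, a n := TwoA)
      else \<phi>)"

text \<open>To be applied to the relabeled cycle, which is monochromatic in CASE-2 only.\<close>

definition recoloring ::
    "'v pair_pre_digraph \<Rightarrow> 'v list \<Rightarrow> ('v \<Rightarrow> color) \<Rightarrow> 'v \<Rightarrow> color" where
  "recoloring T C \<phi>\<^sub>0 =
     (let \<phi> = recolor_main T C \<phi>\<^sub>0 \<phi>\<^sub>0 in
      if monochromatic C \<phi>\<^sub>0
      then modification_ii T C (modification_i T C (recolor_rest2 T C \<phi>\<^sub>0 \<phi>))
      else recolor_rest1 T C \<phi>\<^sub>0 \<phi>)"

subsection \<open>CONFLICTS-RESOLVING\<close>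

text \<open>\<open>two_leaves T C \<phi> b\<close> is the set \<open>\<N>[b]\<close>, where \<open>\<phi>\<close> is the coloring after RECOLORING.\<close>

definition two_leaves ::
    "'v pair_pre_digraph \<Rightarrow> 'v list \<Rightarrow> ('v \<Rightarrow> color) \<Rightarrow> 'v \<Rightarrow> 'v set" where
  "two_leaves T C \<phi> b = {v \<in> set C. (b, v) \<in> parcs T \<and> \<phi> v \<notin> {One, One'}}"

definition conflict ::
    "'v pair_pre_digraph \<Rightarrow> 'v list \<Rightarrow> ('v \<Rightarrow> 'v set) \<Rightarrow> ('v \<Rightarrow> color) \<Rightarrow> nat \<Rightarrow> nat \<Rightarrow> bool" where
  "conflict T C N \<phi> i j \<longleftrightarrow>
     j \<in> {1..length C} \<and> j \<noteq> i \<and> vtx C j \<in> N (nbr T C i) \<and>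
     \<phi> (vtx C j) = \<phi> (vtx C i) \<and> \<phi> (vtx C i) \<noteq> TwoC"

definition resolve_step ::
    "'v pair_pre_digraph \<Rightarrow> 'v list \<Rightarrow> ('v \<Rightarrow> 'v set) \<Rightarrow> nat \<Rightarrow> ('v \<Rightarrow> color) \<Rightarrow> 'v \<Rightarrow> color" where
  "resolve_step T C N i \<phi> =
     (if even i \<and> (\<exists>j. conflict T C N \<phi> i j)
      then let j = (LEAST j. conflict T C N \<phi> i j) in
        if \<phi> (vtx C (i - 2)) \<noteq> TwoC then \<phi>(vtx C i := TwoC) else \<phi>(vtx C j := TwoC)
      else \<phi>)"

definition resolve_conflicts ::
    "'v pair_pre_digraph \<Rightarrow> 'v list \<Rightarrow> ('v \<Rightarrow> color) \<Rightarrow> 'v \<Rightarrow> color" where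
  "resolve_conflicts T C \<phi> =
     fold (resolve_step T C (two_leaves T C \<phi>)) [1..<length C + 1] \<phi>"

definition packing_coloring_algorithm ::
    "'v pair_pre_digraph \<Rightarrow> 'v list \<Rightarrow> 'v \<Rightarrow> 'v \<Rightarrow> color" where
  "packing_coloring_algorithm T C r =
     (let \<phi>\<^sub>0 = bfs_coloring T r; C' = relabel C \<phi>\<^sub>0
      in resolve_conflicts T C' (recoloring T C' \<phi>\<^sub>0))"

end

theory Submission
  imports Defs
begin

text \<open>
  Only leaves receive colors of radius 2, and two leaves are at distance at most 2 in the Halin graph
  exactly if they are at most two steps apart on the adjoint cycle or hang on the same inner vertex.
  The theorem is therefore a statement about the cyclic sequence of the leaves and its partition into
  blocks, a block being the set of leaves \<open>a\<^sub>k\<close> with the same neighbour \<open>b\<^sub>k\<close>.  The colors of radius 1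
  cause no trouble: breadth-first search colors a tree properly because an arc inside a layer would
  close a cycle (\<open>layer_no_internal_arc\<close>), the color \<open>1\<^sub>k\<close> is the color that \<open>a\<^sub>k\<close> already has, and
  RECOLORING leaves two consecutive leaves with colors of radius 1 only at \<open>a\<^sub>n\<close>, \<open>a\<^sub>1\<close> in CASE-1,
  where the relabelling made their colors different.

  Planarity and the degree bound enter through two properties of the blocks, both read off from the
  boundary walk of the tree, whose sections between consecutive leaves are arc-disjoint.  Blocks do not
  cross (\<open>blocks_noncrossing\<close>): if \<open>x\<close> and \<open>y\<close> are inner vertices, a single arc leads from \<open>x\<close> into the
  component of \<open>T - x\<close> that contains \<open>y\<close>, so only one section enters this component, while crossing
  blocks would need two.  And a block does not contain three pairwise non-consecutive leaves
  (\<open>no_three_apart_in_block\<close>): the rotation takes each of them to a neighbour of the common inner vertex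
  that is none of the three, which makes six neighbours.

  After RECOLORING, equal colors of radius 2 are at least three steps apart and at most one couple of
  consecutive leaves \<open>a\<^sub>e\<close>, \<open>a\<^bsub>e+1\<^esub>\<close> has two colors of radius 2.  Three leaves of one block with such colors must
  contain this couple; hence a block contains at most one conflicting pair (\<open>pair_unique\<close>), and
  CONFLICTS-RESOLVING recolors exactly one member of each pair with \<open>2\<^sub>c\<close>.  What has to be shown is that no
  two leaves that end up with \<open>2\<^sub>c\<close> are close.  The second member \<open>x\<close> of a pair \<open>(w, x)\<close> is recolored only if
  \<open>w - 2\<close> already has color \<open>2\<^sub>c\<close>.  If \<open>q < x\<close> is an even position that does not get \<open>2\<^sub>c\<close>, and no
  conflicting pair leads out of the positions from \<open>q + 1\<close> to \<open>x\<close>, then the same reason applies to \<open>w - 2\<close>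
  in place of \<open>x\<close>, and the descent ends at \<open>q\<close>; thus \<open>x\<close> does not get \<open>2\<^sub>c\<close> (\<open>not_in_Z_beyond\<close>).  Since
  pairs do not cross, such a \<open>q\<close> exists wherever it is needed: it is the first member of a pair around
  \<open>x\<close> (\<open>between_second\<close>), or \<open>0\<close>, or, when CASE-2 puts \<open>2\<^sub>c\<close> at the end of the cycle, a separator.  The
  modifications of CASE-2 serve this purpose: if neither applies, or if (i) puts \<open>2\<^sub>c\<close> at \<open>a\<^bsub>n-1\<^esub>\<close>, then there
  is a separator; and the \<open>2\<^sub>c\<close> that (i) and (ii) put at \<open>a\<^sub>2\<close> is harmless, as the position \<open>n\<close> before it is then
  in no pair (\<open>TwoC_last_resolvable\<close>).
\<close>

section \<open>Trees\<close>

lemma tree_sym: "is_tree T \<Longrightarrow> (u, v) \<in> parcs T \<Longrightarrow> (v, u) \<in> parcs T"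
  unfolding is_tree_def
  by (meson pair_graph.axioms(2) pair_pseudo_graph.axioms(2) pair_sym_digraph.arcs_symmetric)

lemma tree_arc_verts:
  assumes "is_tree T" "(u, v) \<in> parcs T"
  shows "u \<in> pverts T" "v \<in> pverts T" "u \<noteq> v"
proof -
  interpret pair_graph T using assms(1) by (simp add: is_tree_def)
  show "u \<in> pverts T" "v \<in> pverts T" "u \<noteq> v"
    using assms(2) in_arcsD1 in_arcsD2 no_loops' by blast+
qed

lemma tree_finite_arcs:
  assumes "is_tree T" shows "finite (parcs T)"
proof -
  interpret pair_graph T using assms by (simp add: is_tree_def)
  show ?thesis by (rule pair_finite_arcs)
qed

lemma tree_connected:
  assumes T: "is_tree T" and "u \<in> pverts T" "v \<in> pverts T"
  shows "(u, v) \<in> (parcs T)\<^sup>*"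
proof -
  interpret pair_graph T using T by (simp add: is_tree_def)
  have "u \<rightarrow>\<^sup>*\<^bsub>mk_symmetric (with_proj T)\<^esub> v"
    using T assms(2,3) unfolding is_tree_def connected_def strongly_connected_def by simp
  hence "u \<rightarrow>\<^sup>*\<^bsub>with_proj T\<^esub> v" using reachable_mk_symmetric_eq by auto
  thus ?thesis unfolding reachable_def using rtrancl_on_rtranclI by auto
qed

text \<open>A path from \<open>v\<close> back to \<open>u\<close> that avoids the edge between them has length at least 2 and is closed by
  this edge to an undirected cycle.  All uses of acyclicity go through this lemma.\<close>

lemma tree_edge_is_bridge:
  assumes T: "is_tree T" and e: "(u, v) \<in> parcs T"
  shows "(v, u) \<notin> (parcs T - {(u, v), (v, u)})\<^sup>*"
proof
  interpret pair_graph T using T by (simp add: is_tree_def)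
  let ?H = "\<lparr>pverts = pverts T, parcs = parcs T - {(u, v), (v, u)}\<rparr>"
  assume path: "(v, u) \<in> (parcs T - {(u, v), (v, u)})\<^sup>*"
  interpret H: pair_wf_digraph ?H
    by unfold_locales (use wellformed' in auto)
  have uv: "u \<in> pverts T" "v \<in> pverts T" "u \<noteq> v" using tree_arc_verts[OF T e] by auto
  \<comment> \<open>The arc set gets a name because it mentions the end point \<open>u\<close>, over which the induction generalizes.\<close>
  define A where "A = parcs ?H"
  have "(v, w) \<in> A\<^sup>* \<Longrightarrow> \<exists>p. H.awalk v p w" for w
  proof (induction rule: rtrancl_induct)
    case base show ?case using uv by (intro exI[of _ "[]"]) (simp add: H.awalk_Nil_iff)
  next
    case (step y z)
    then obtain p where "H.awalk v p y" by auto
    hence "H.awalk v (p @ [(y, z)]) z"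
      using step(2) by (auto simp: A_def H.awalk_simps in_arcsD2)
    thus ?case by blast
  qed
  hence "\<exists>p. H.awalk v p u" using path by (simp add: A_def)
  then obtain p where p: "H.apath v p u" using H.apath_awalk_to_apath by blast
  hence wp: "H.awalk v p u" and dp: "distinct (pawalk_verts v p)"
    by (auto simp: H.apath_def)
  have "awalk v p u" using wp by (auto simp: awalk_def H.awalk_def)
  hence cyc: "awalk u ((u, v) # p) u" using e uv by (simp add: awalk_Cons_iff)
  have "cycle ((u, v) # p)" unfolding cycle_def using cyc dp by auto
  moreover have "3 \<le> length ((u, v) # p)"
  proof (rule ccontr)
    assume "\<not> 3 \<le> length ((u, v) # p)"
    then consider "p = []" | a where "p = [a]" by (cases p; cases "tl p") auto
    thus False using wp uv by cases (auto simp: H.awalk_simps)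
  qed
  ultimately show False using T by (auto simp: is_tree_def)
qed

text \<open>Otherwise the edge from \<open>x\<close> to \<open>u\<close> could be bypassed through \<open>v\<close>.\<close>

lemma neighbours_separated:
  assumes T: "is_tree T" and "(x, u) \<in> parcs T" "(x, v) \<in> parcs T"
    and uv: "(u, v) \<in> {(y, z) \<in> parcs T. y \<noteq> x \<and> z \<noteq> x}\<^sup>*"
  shows "u = v"
proof (rule ccontr)
  assume "u \<noteq> v"
  let ?A = "parcs T - {(x, u), (u, x)}"
  have "(u, v) \<in> ?A\<^sup>*" by (rule rtrancl_mono[THEN subsetD, OF _ uv]) auto
  moreover have "(v, x) \<in> ?A" using tree_sym[OF T assms(3)] \<open>u \<noteq> v\<close> tree_arc_verts[OF T assms(3)] by auto
  ultimately have "(u, x) \<in> ?A\<^sup>*" by (rule rtrancl_into_rtrancl)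
  thus False using tree_edge_is_bridge[OF T assms(2)] by simp
qed

section \<open>Breadth-first layers\<close>

abbreviation layer :: "'v pair_pre_digraph \<Rightarrow> 'v \<Rightarrow> nat \<Rightarrow> 'v set" where
  "layer T r k \<equiv> snd (bfs T r k)"

lemma bfs_visited: "fst (bfs T r k) = (\<Union>j\<le>k. layer T r j)"
proof (induction k)
  case (Suc k)
  have "fst (bfs T r (Suc k)) = fst (bfs T r k) \<union> layer T r (Suc k)"
    by (simp add: Let_def split: prod.splits)
  thus ?case unfolding Suc.IH atMost_Suc by blast
qed simp

lemma layer_Suc:
  "layer T r (Suc k) = {w. \<exists>v \<in> layer T r k. (v, w) \<in> parcs T} - (\<Union>j\<le>k. layer T r j)"
  using bfs_visited[of T r k] by (auto simp: Let_def split: prod.splits)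

lemma layer_disjoint: "v \<in> layer T r j \<Longrightarrow> v \<in> layer T r k \<Longrightarrow> j = k"
proof -
  have "v \<in> layer T r j \<Longrightarrow> v \<in> layer T r k \<Longrightarrow> j < k \<Longrightarrow> False" for j k
    by (cases k) (auto simp: layer_Suc simp del: bfs.simps)
  thus "v \<in> layer T r j \<Longrightarrow> v \<in> layer T r k \<Longrightarrow> j = k" by (metis nat_neq_iff)
qed

lemma layer_neighbour:
  assumes "u \<in> layer T r k" "(u, v) \<in> parcs T"
  obtains j where "j \<le> Suc k" "v \<in> layer T r j"
proof (cases "v \<in> (\<Union>j\<le>k. layer T r j)")
  case True
  then obtain j where "j \<le> k" "v \<in> layer T r j" by blast
  thus ?thesis using that by (meson le_SucI)
next
  case False
  hence "v \<in> layer T r (Suc k)" using assms by (auto simp: layer_Suc simp del: bfs.simps)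
  thus ?thesis using that by blast
qed

lemma layer_exists:
  assumes "(r, v) \<in> (parcs T)\<^sup>*" obtains k where "v \<in> layer T r k"
proof -
  have "\<exists>k. v \<in> layer T r k" using assms
  proof (induction rule: rtrancl_induct)
    case base thus ?case by (intro exI[of _ 0]) simp
  next
    case (step y z) thus ?case by (metis layer_neighbour)
  qed
  thus ?thesis using that by blast
qed

text \<open>A vertex of layer \<open>k\<close> is reached by arcs that ascend from layer to layer.  Such a path contains no arc
  inside layer \<open>k\<close>, which is what the bridge argument below needs.\<close>

lemma layer_descent:
  assumes "v \<in> layer T r k"
  shows "(r, v) \<in> {(y, z) \<in> parcs T. \<exists>j < k. y \<in> layer T r j \<and> z \<in> layer T r (Suc j)}\<^sup>*"
  using assms
proof (induction k arbitrary: v)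
  case 0 thus ?case by simp
next
  case (Suc k)
  then obtain u where u: "u \<in> layer T r k" "(u, v) \<in> parcs T" by (auto simp: layer_Suc simp del: bfs.simps)
  let ?R = "\<lambda>k. {(y, z) \<in> parcs T. \<exists>j < k. y \<in> layer T r j \<and> z \<in> layer T r (Suc j)}"
  have "(r, u) \<in> (?R (Suc k))\<^sup>*"
    by (rule rtrancl_mono[THEN subsetD, OF _ Suc.IH[OF u(1)]]) (use less_SucI in blast)
  moreover have "(u, v) \<in> ?R (Suc k)" using u Suc.prems by (auto simp del: bfs.simps)
  ultimately show ?case by (rule rtrancl_into_rtrancl)
qed

text \<open>Both ends of such an arc would be reachable from the root without using the arc, which is a bridge.\<close>

lemma layer_no_internal_arc:
  assumes T: "is_tree T" and e: "(u, v) \<in> parcs T" and u: "u \<in> layer T r k"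
  shows "v \<notin> layer T r k"
proof
  assume v: "v \<in> layer T r k"
  let ?A = "parcs T - {(u, v), (v, u)}"
  let ?R = "{(y, z) \<in> parcs T. \<exists>j < k. y \<in> layer T r j \<and> z \<in> layer T r (Suc j)}"
  have "?R \<subseteq> ?A" using u v by (fastforce dest: layer_disjoint simp del: bfs.simps)
  hence ru: "(r, u) \<in> ?A\<^sup>*" and rv: "(r, v) \<in> ?A\<^sup>*"
    using layer_descent[OF u] layer_descent[OF v] rtrancl_mono[of ?R ?A] by blast+
  have "?A\<inverse> = ?A" using tree_sym[OF T] by auto
  hence "(v, r) \<in> ?A\<^sup>*" using rv by (metis rtrancl_converseI)
  thus False using tree_edge_is_bridge[OF T e] ru by (meson rtrancl_trans)
qed

text \<open>Layers of adjacent vertices differ by at most one, and they are not equal.\<close>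

lemma bfs_coloring_proper:
  assumes T: "is_tree T" and r: "r \<in> pverts T" and e: "(u, v) \<in> parcs T"
  shows "bfs_coloring T r u \<noteq> bfs_coloring T r v"
proof -
  obtain j where j: "u \<in> layer T r j"
    using layer_exists tree_connected[OF T r tree_arc_verts(1)[OF T e]] by metis
  obtain k where k: "v \<in> layer T r k"
    using layer_exists tree_connected[OF T r tree_arc_verts(2)[OF T e]] by metis
  have "k \<le> Suc j" "j \<le> Suc k" "j \<noteq> k"
    using layer_neighbour[OF j e] layer_neighbour[OF k tree_sym[OF T e]]
      layer_no_internal_arc[OF T e j] j k layer_disjoint by metis+
  hence "even j \<noteq> even k" by (metis Suc_leI antisym even_Suc linorder_neqE_nat)
  thus ?thesis using j k layer_disjoint unfolding bfs_coloring_def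
    by (smt (verit) color.distinct(1))
qed

lemma bfs_coloring_range: "bfs_coloring T r v \<in> {One, One'}"
  by (simp add: bfs_coloring_def)

section \<open>The boundary walk of a plane tree\<close>

text \<open>The part of \<^const>\<open>halin_graph\<close> that does not mention the Halin graph itself; it is invariant under
  rotation of the list of leaves.\<close>

locale plane_tree =
  fixes T :: "'v pair_pre_digraph" and rot :: "'v \<Rightarrow> 'v \<Rightarrow> 'v" and C :: "'v list"
  assumes tree: "is_tree T"
    and rotation: "rotation_system T rot"
    and distinct_C: "distinct C"
    and set_C: "set C = leaves T"
    and length_C: "3 \<le> length C"
    and next_leaf: "i < length C \<Longrightarrow> next_leaf T rot (C ! i) (C ! (Suc i mod length C))"
begin

lemma next_index: "k mod length C + 1 \<in> {1..length C}"
proof -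
  have "k mod length C < length C" using length_C by (intro mod_less_divisor) linarith
  thus ?thesis by simp
qed

lemma vtx_nth: "k \<in> {1..length C} \<Longrightarrow> vtx C k = C ! (k - 1)"
  by (cases "k = length C + 1 - 1") (auto simp: vtx_def mod_if)

lemma vtx_inj: "k \<in> {1..length C} \<Longrightarrow> l \<in> {1..length C} \<Longrightarrow> vtx C k = vtx C l \<longleftrightarrow> k = l"
  using distinct_C by (auto simp: vtx_nth nth_eq_iff_index_eq)

lemma vtx_leaf: "vtx C k \<in> leaves T"
proof -
  have "(k + length C - 1) mod length C < length C" using length_C by (intro mod_less_divisor) linarith
  thus ?thesis unfolding vtx_def set_C[symmetric] by (rule nth_mem)
qed

lemma leaf_in_vtx:
  assumes "u \<in> leaves T" obtains k where "k \<in> {1..length C}" "u = vtx C k"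
proof -
  obtain i where i: "i < length C" "u = C ! i" using assms set_C by (metis in_set_conv_nth)
  hence "u = vtx C (i + 1)" by (subst vtx_nth) auto
  thus ?thesis using that[of "i + 1"] i by simp
qed

lemma leaf_neighbour:
  assumes "u \<in> leaves T" "(u, v) \<in> parcs T" "(u, w) \<in> parcs T" shows "v = w"
proof -
  have "card (out_arcs (with_proj T) u) = 1"
    using assms(1) by (simp add: leaves_def out_degree_def)
  then obtain e where "out_arcs (with_proj T) u = {e}" by (auto simp: card_1_singleton_iff)
  moreover have "(u, v) \<in> out_arcs (with_proj T) u" "(u, w) \<in> out_arcs (with_proj T) u"
    using assms by auto
  ultimately show ?thesis by auto
qed

lemma nbr_iff: "(vtx C k, w) \<in> parcs T \<longleftrightarrow> w = nbr T C k"
proof -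
  have "card (out_arcs (with_proj T) (vtx C k)) = 1"
    using vtx_leaf[of k] by (simp add: leaves_def out_degree_def)
  then obtain e where "out_arcs (with_proj T) (vtx C k) = {e}" by (auto simp: card_1_singleton_iff)
  hence "e \<in> out_arcs (with_proj T) (vtx C k)" by auto
  hence "(vtx C k, snd e) \<in> parcs T" by (cases e) auto
  hence "\<exists>!w. (vtx C k, w) \<in> parcs T" using leaf_neighbour[OF vtx_leaf] by blast
  thus ?thesis unfolding nbr_def by (metis theI')
qed

lemma nbr_arcs: "(vtx C k, nbr T C k) \<in> parcs T" "(nbr T C k, vtx C k) \<in> parcs T"
  using nbr_iff tree_sym[OF tree] by blast+

text \<open>Two adjacent leaves would be the whole tree, but there are at least three leaves.\<close>

lemma leaf_neighbour_inner:
  assumes u: "u \<in> leaves T" and ub: "(u, b) \<in> parcs T" shows "b \<notin> leaves T"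
proof
  assume b: "b \<in> leaves T"
  have "v \<in> {u, b}" if "(u, v) \<in> (parcs T)\<^sup>*" for v using that
  proof (induction rule: rtrancl_induct)
    case (step y z)
    thus ?case using leaf_neighbour[OF u ub] leaf_neighbour[OF b tree_sym[OF tree ub]] by blast
  qed simp
  hence "pverts T \<subseteq> {u, b}" using tree_connected[OF tree] tree_arc_verts[OF tree ub] by blast
  hence "set C \<subseteq> {u, b}" using set_C by (auto simp: leaves_def)
  hence "length C \<le> 2"
    using distinct_card[OF distinct_C] card_mono[of "{u, b}" "set C"] card_length[of "[u, b]"] by simp
  thus False using length_C by simp
qed

lemma nbr_inner: "nbr T C k \<notin> leaves T"
  using leaf_neighbour_inner[OF vtx_leaf nbr_arcs(1)] .

text \<open>On its finite orbit the rotation is onto, hence also injective.\<close>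

lemma rot_bij:
  assumes "v \<in> pverts T" shows "bij_betw (rot v) {w. (v, w) \<in> parcs T} {w. (v, w) \<in> parcs T}"
proof -
  let ?N = "{w. (v, w) \<in> parcs T}"
  have c: "cyclic_on (rot v) ?N" using rotation assms by (auto simp: rotation_system_def)
  have "?N \<subseteq> rot v ` ?N"
  proof
    fix w assume w: "w \<in> ?N"
    have N: "?N = orbit (rot v) w" using c w unfolding cyclic_on_alldef by blast
    hence "w \<in> orbit (rot v) w" using w by simp
    thus "w \<in> rot v ` ?N"
    proof cases
      case base thus ?thesis using w by blast
    next
      case (step y) thus ?thesis using N by blast
    qed
  qed
  hence "rot v ` ?N = ?N" using cyclic_on_inI[OF c] by auto
  thus ?thesis using finite_cyclic_on[OF c] by (simp add: bij_betw_def finite_surj_inj)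
qed

abbreviation (input) "step \<equiv> face_step rot"

lemma face_step_arc: "e \<in> parcs T \<Longrightarrow> step e \<in> parcs T"
proof -
  assume e: "e \<in> parcs T"
  obtain u v where uv: "e = (u, v)" by (cases e)
  have "u \<in> {w. (v, w) \<in> parcs T}" using e uv tree_sym[OF tree] by simp
  hence "rot v u \<in> {w. (v, w) \<in> parcs T}"
    using rot_bij[OF tree_arc_verts(2)[OF tree]] e uv bij_betwE by blast
  thus ?thesis by (simp add: face_step_def uv)
qed

lemma face_walk_arc: "e \<in> parcs T \<Longrightarrow> (step ^^ k) e \<in> parcs T"
  by (induction k) (auto simp: face_step_arc)

lemma face_step_inj: "inj_on step (parcs T)"
proof (rule inj_onI, clarsimp simp: face_step_def)
  fix u u' v assume *: "(u, v) \<in> parcs T" "(u', v) \<in> parcs T" "rot v u = rot v u'"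
  have "inj_on (rot v) {w. (v, w) \<in> parcs T}"
    using rot_bij tree_arc_verts(2)[OF tree *(1)] by (auto simp: bij_betw_def)
  thus "u = u'" using * tree_sym[OF tree] by (auto dest: inj_onD)
qed

lemma face_walk_inj: "inj_on (step ^^ k) (parcs T)"
proof (induction k)
  case (Suc k)
  have "inj_on step ((step ^^ k) ` parcs T)"
    by (rule inj_on_subset[OF face_step_inj]) (auto simp: face_walk_arc)
  thus ?case using comp_inj_on[OF Suc] by (simp add: comp_def)
qed simp

lemma fst_face_walk: "fst ((step ^^ Suc k) e) = snd ((step ^^ k) e)"
  by (simp add: face_step_def split: prod.splits)

lemma next_leaf_walk:
  assumes "k \<in> {1..length C}"
  obtains m where "snd ((step ^^ m) (vtx C k, nbr T C k)) = vtx C (k mod length C + 1)"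
    and "\<forall>j < m. snd ((step ^^ j) (vtx C k, nbr T C k)) \<notin> leaves T"
proof -
  have "C ! (Suc (k - 1) mod length C) = vtx C (k mod length C + 1)"
    using assms by (subst vtx_nth[OF next_index]) simp
  hence "next_leaf T rot (vtx C k) (vtx C (k mod length C + 1))"
    using next_leaf[of "k - 1"] assms vtx_nth[OF assms] by auto
  thus ?thesis unfolding next_leaf_def nbr_iff using that by blast
qed

text \<open>If the rotation around \<open>b\<^sub>k\<close> goes from \<open>a\<^sub>k\<close> to a leaf, the boundary walk meets this leaf immediately, so it
  is the next vertex on the cycle.  Therefore the rotation takes the last leaf of a run of consecutive
  leaves of a block to an inner vertex.\<close>

lemma next_leaf_in_block:
  assumes "k \<in> {1..length C}" and leaf: "rot (nbr T C k) (vtx C k) \<in> leaves T"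
  shows "rot (nbr T C k) (vtx C k) = vtx C (k mod length C + 1)"
proof -
  obtain m where m: "snd ((step ^^ m) (vtx C k, nbr T C k)) = vtx C (k mod length C + 1)"
    "\<forall>j < m. snd ((step ^^ j) (vtx C k, nbr T C k)) \<notin> leaves T"
    using next_leaf_walk[OF assms(1)] .
  have "m \<noteq> 0"
  proof
    assume "m = 0"
    hence "nbr T C k = vtx C (k mod length C + 1)" using m(1) by simp
    thus False using nbr_inner vtx_leaf by metis
  qed
  moreover have "\<not> 1 < m" using m(2) leaf by (auto simp: face_step_def)
  ultimately have "m = 1" by simp
  thus ?thesis using m(1) by (simp add: face_step_def)
qed

text \<open>The boundary walks from a leaf to the next are arc-disjoint: tracing a common arc
  backwards, one would pass through the starting leaf of one walk in the interior of the other.\<close>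

lemma leaf_walks_disjoint:
  assumes "k \<in> {1..length C}" "l \<in> {1..length C}"
    and k: "\<forall>j < m. snd ((step ^^ j) (vtx C k, nbr T C k)) \<notin> leaves T" "s \<le> m"
    and l: "\<forall>j < m'. snd ((step ^^ j) (vtx C l, nbr T C l)) \<notin> leaves T" "s' \<le> m'"
    and eq: "(step ^^ s) (vtx C k, nbr T C k) = (step ^^ s') (vtx C l, nbr T C l)"
  shows "k = l"
proof -
  have *: "k = l" if "k \<in> {1..length C}" "l \<in> {1..length C}" "s \<le> s'"
    and l: "\<forall>j < m'. snd ((step ^^ j) (vtx C l, nbr T C l)) \<notin> leaves T" "s' \<le> m'"
    and eq: "(step ^^ s) (vtx C k, nbr T C k) = (step ^^ s') (vtx C l, nbr T C l)" for k l s s' m'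
  proof -
    have "s' = s + (s' - s)" using \<open>s \<le> s'\<close> by simp
    hence "(step ^^ s) (vtx C k, nbr T C k) = (step ^^ s) ((step ^^ (s' - s)) (vtx C l, nbr T C l))"
      using eq funpow_add[of s "s' - s" step] by (metis comp_apply)
    hence x: "(vtx C k, nbr T C k) = (step ^^ (s' - s)) (vtx C l, nbr T C l)"
      using face_walk_inj nbr_arcs(1) face_walk_arc by (metis inj_onD)
    show "k = l"
    proof (cases "s' - s")
      case 0 thus ?thesis using x vtx_inj that by simp
    next
      case (Suc d)
      hence "vtx C k = snd ((step ^^ d) (vtx C l, nbr T C l))" using x fst_face_walk by (metis fst_conv)
      moreover have "d < m'" using Suc l(2) by simp
      ultimately show ?thesis using l(1) vtx_leaf by metis
    qed
  qed
  show ?thesis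
  proof (cases "s \<le> s'")
    case True thus ?thesis using *[OF assms(1,2) _ l eq] by simp
  next
    case False thus ?thesis using *[OF assms(2,1) _ k eq[symmetric]] by simp
  qed
qed

text \<open>If a single arc leads into \<open>D\<close>, then at most one of the walks enters \<open>D\<close>.\<close>

lemma single_entrance:
  assumes arc: "\<And>u v. (u, v) \<in> parcs T \<Longrightarrow> u \<notin> D \<Longrightarrow> v \<in> D \<Longrightarrow> (u, v) = e"
    and k: "k \<in> {1..length C}" "vtx C k \<notin> D" "vtx C (k mod length C + 1) \<in> D"
    and l: "l \<in> {1..length C}" "vtx C l \<notin> D" "vtx C (l mod length C + 1) \<in> D"
  shows "k = l"
proof -
  have entry: "\<exists>s\<le>m. (step ^^ s) x = e" if "x \<in> parcs T" "fst x \<notin> D" "snd ((step ^^ m) x) \<in> D" for m x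
    using that(3)
  proof (induction m)
    case 0 thus ?case using arc[of "fst x" "snd x"] that by auto
  next
    case (Suc m)
    show ?case
    proof (cases "snd ((step ^^ m) x) \<in> D")
      case True thus ?thesis using Suc.IH le_SucI by blast
    next
      case False
      hence "fst ((step ^^ Suc m) x) \<notin> D" using fst_face_walk by metis
      thus ?thesis using arc[of "fst ((step ^^ Suc m) x)" "snd ((step ^^ Suc m) x)"] Suc.prems
          face_walk_arc[OF that(1), of "Suc m"] by auto
    qed
  qed
  obtain m where m: "snd ((step ^^ m) (vtx C k, nbr T C k)) = vtx C (k mod length C + 1)"
    "\<forall>j < m. snd ((step ^^ j) (vtx C k, nbr T C k)) \<notin> leaves T" using next_leaf_walk[OF k(1)] .
  obtain m' where m': "snd ((step ^^ m') (vtx C l, nbr T C l)) = vtx C (l mod length C + 1)"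
    "\<forall>j < m'. snd ((step ^^ j) (vtx C l, nbr T C l)) \<notin> leaves T" using next_leaf_walk[OF l(1)] .
  obtain s where s: "s \<le> m" "(step ^^ s) (vtx C k, nbr T C k) = e"
    using entry[OF nbr_arcs(1), of k m] m(1) k by auto
  obtain s' where s': "s' \<le> m'" "(step ^^ s') (vtx C l, nbr T C l) = e"
    using entry[OF nbr_arcs(1), of l m'] m'(1) l by auto
  show ?thesis
    by (rule leaf_walks_disjoint[OF k(1) l(1) m(2) s(1) m'(2) s'(1)]) (simp only: s(2) s'(2))
qed

text \<open>Let \<open>x\<close> and \<open>y\<close> be the inner vertices of two crossing blocks.  The component \<open>D\<close> of \<open>y\<close> in the tree
  without \<open>x\<close> contains the leaves at \<open>y\<close> but not those at \<open>x\<close>, and only one arc leads into \<open>D\<close>.  Going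
  round the cycle, \<open>D\<close> would be entered between \<open>i\<close> and \<open>j\<close> and again between \<open>k\<close> and \<open>l\<close>.\<close>

lemma blocks_noncrossing:
  assumes "1 \<le> i" "i < j" "j < k" "k < l" "l \<le> length C"
    and ik: "nbr T C i = nbr T C k" and jl: "nbr T C j = nbr T C l"
  shows "nbr T C i = nbr T C j"
proof (rule ccontr)
  define x y where "x = nbr T C i" and "y = nbr T C j"
  assume "nbr T C i \<noteq> nbr T C j"
  hence "y \<noteq> x" by (simp add: x_def y_def)
  define R where "R = {(u, v) \<in> parcs T. u \<noteq> x \<and> v \<noteq> x}"
  define D where "D = {v. (y, v) \<in> R\<^sup>*}"
  have symR: "R\<inverse> = R" using tree_sym[OF tree] by (auto simp: R_def)
  have "x \<notin> D"
  proof
    assume "x \<in> D"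
    hence "(y, x) \<in> R\<^sup>*" by (simp add: D_def)
    thus False using \<open>y \<noteq> x\<close> by (cases rule: rtranclE) (auto simp: R_def)
  qed
  have source: "u = x" if "(u, v) \<in> parcs T" "u \<notin> D" "v \<in> D" for u v
  proof (rule ccontr)
    assume "u \<noteq> x"
    hence "(v, u) \<in> R" using that \<open>x \<notin> D\<close> tree_sym[OF tree] by (auto simp: R_def)
    thus False using that(2,3) unfolding D_def by (meson mem_Collect_eq rtrancl_into_rtrancl)
  qed
  have target: "v = w" if "(x, v) \<in> parcs T" "(x, w) \<in> parcs T" "v \<in> D" "w \<in> D" for v w
  proof (rule neighbours_separated[OF tree that(1,2)])
    have "(v, y) \<in> R\<^sup>*" using that(3) symR by (metis D_def mem_Collect_eq rtrancl_converseI)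
    thus "(v, w) \<in> {(y, z) \<in> parcs T. y \<noteq> x \<and> z \<noteq> x}\<^sup>*"
      using that(4) unfolding D_def R_def by (auto intro: rtrancl_trans)
  qed
  have out: "vtx C h \<notin> D" if "nbr T C h = x" for h
  proof
    assume "vtx C h \<in> D"
    hence "(y, vtx C h) \<in> R\<^sup>*" by (simp add: D_def)
    thus False
    proof (cases rule: rtranclE)
      case base thus False using nbr_inner[of j] vtx_leaf[of h] by (simp add: y_def)
    next
      case (step z)
      hence "(vtx C h, z) \<in> parcs T" "z \<noteq> x" using tree_sym[OF tree] by (auto simp: R_def)
      thus False using nbr_iff that by simp
    qed
  qed
  have ins: "vtx C h \<in> D" if "nbr T C h = y" for h
  proof -
    have "vtx C h \<noteq> x" using vtx_leaf[of h] nbr_inner[of i] by (auto simp: x_def)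
    hence "(y, vtx C h) \<in> R" using nbr_arcs(2)[of h] that \<open>y \<noteq> x\<close> by (simp add: R_def)
    thus ?thesis by (auto simp: D_def)
  qed
  have entry: "\<exists>h \<ge> p. h < q \<and> vtx C h \<notin> D \<and> vtx C (h + 1) \<in> D"
    if "p < q" "vtx C p \<notin> D" "vtx C q \<in> D" for p q
    using that(1,3)
  proof (induction q)
    case (Suc q)
    show ?case
    proof (cases "vtx C q \<in> D")
      case True
      hence "p < q" using Suc.prems that(2) by (cases "p = q") auto
      thus ?thesis using Suc.IH True less_SucI by blast
    next
      case False thus ?thesis using Suc.prems by (intro exI[of _ q]) auto
    qed
  qed simp
  obtain g where g: "i \<le> g" "g < j" "vtx C g \<notin> D" "vtx C (g + 1) \<in> D"
    using entry[OF \<open>i < j\<close> out ins] x_def y_def by auto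
  obtain h where h: "k \<le> h" "h < l" "vtx C h \<notin> D" "vtx C (h + 1) \<in> D"
    using entry[OF \<open>k < l\<close> out ins] x_def y_def ik jl by auto
  obtain d where d: "\<And>u v. (u, v) \<in> parcs T \<Longrightarrow> u \<notin> D \<Longrightarrow> v \<in> D \<Longrightarrow> (u, v) = (x, d)"
    using source target by metis
  have "g \<in> {1..length C}" "g mod length C = g" "h \<in> {1..length C}" "h mod length C = h"
    using g(1,2) h(1,2) assms(1-5) by auto
  hence "g = h" using single_entrance[of D "(x, d)" g h, OF d] g h by simp
  thus False using g(2) h(1) \<open>j < k\<close> by simp
qed

text \<open>The three leaves and their images under the rotation are six distinct neighbours of one vertex: an image
  that is a leaf is the next leaf on the cycle, which is none of the three.\<close>

lemma no_three_apart_in_block: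
  assumes deg: "out_degree (with_proj T) (nbr T C p) \<le> 5"
    and pqr: "1 \<le> p" "p + 1 < q" "q + 1 < r" "r \<le> length C" "\<not> (p = 1 \<and> r = length C)"
    and same: "nbr T C q = nbr T C p" "nbr T C r = nbr T C p"
  shows False
proof -
  define x where "x = nbr T C p"
  let ?N = "{w. (x, w) \<in> parcs T}"
  let ?L = "{vtx C p, vtx C q, vtx C r}"
  have xL: "nbr T C h = x" if "h \<in> {p, q, r}" for h using that same x_def by auto
  have L: "?L \<subseteq> ?N"
    using nbr_arcs(2)[of p] nbr_arcs(2)[of q] nbr_arcs(2)[of r] xL[of p] xL[of q] xL[of r] by simp
  have "x \<in> pverts T" unfolding x_def by (rule tree_arc_verts(2)[OF tree nbr_arcs(1)])
  note b = rot_bij[OF this]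
  have fin: "finite ?N" using tree_finite_arcs[OF tree] by (rule finite_surj[where f = snd]) (auto intro: rev_image_eqI)
  have cL: "card ?L = 3" using vtx_inj[of p q] vtx_inj[of p r] vtx_inj[of q r] pqr by auto
  have "card (rot x ` ?L) = 3" 
    using cL card_image[OF inj_on_subset[OF bij_betw_imp_inj_on[OF b] L]] by simp
  moreover have "?L \<inter> rot x ` ?L = {}"
  proof -
    have "rot x (vtx C h) \<noteq> vtx C h'" if "h \<in> {p, q, r}" "h' \<in> {p, q, r}" for h h'
    proof
      assume e: "rot x (vtx C h) = vtx C h'"
      have h: "h = p \<or> h = q \<or> h = r" and h': "h' = p \<or> h' = q \<or> h' = r" using that by blast+
      have hh: "h \<in> {1..length C}" "h' \<in> {1..length C}" using h h' pqr(1-4) by auto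
      have "rot x (vtx C h) \<in> leaves T" using e vtx_leaf by simp
      hence "vtx C h' = vtx C (h mod length C + 1)"
        using next_leaf_in_block[OF hh(1)] unfolding xL[OF that(1)] e by blast
      hence "h' = h mod length C + 1" by (rule vtx_inj[OF hh(2) next_index, THEN iffD1])
      moreover have "h mod length C + 1 = (if h = length C then 1 else h + 1)" using hh(1) by auto
      ultimately show False using h h' pqr by (auto split: if_splits)
    qed
    moreover have "\<exists>h \<in> {p, q, r}. w = vtx C h" if "w \<in> ?L" for w using that by blast
    moreover have "\<exists>h \<in> {p, q, r}. w = rot x (vtx C h)" if "w \<in> rot x ` ?L" for w using that by blast
    ultimately show ?thesis unfolding disjoint_iff by metis
  qed
  ultimately have "card (?L \<union> rot x ` ?L) = 6" using cL by (subst card_Un_disjoint) auto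
  moreover have "?L \<union> rot x ` ?L \<subseteq> ?N" using L image_mono[OF L, of "rot x"] bij_betw_imp_surj_on[OF b] by simp
  ultimately have "6 \<le> card ?N" using card_mono[OF fin] by metis
  also have "card ?N = out_degree (with_proj T) x"
    unfolding out_degree_def by (rule bij_betw_same_card[of "Pair x"]) (rule bij_betwI[where g = snd], auto)
  finally show False using deg by (simp add: x_def)
qed

end

section \<open>Resolving conflicts on a cycle of leaves\<close>

abbreviation ones :: "color set" where "ones \<equiv> {One, One'}"

text \<open>Positions on a cycle of length \<open>n\<close> that are one or two steps apart.\<close>

definition close :: "nat \<Rightarrow> nat \<Rightarrow> nat \<Rightarrow> bool" where
  "close n k l \<longleftrightarrow> k \<noteq> l \<and> (k \<le> l + 2 \<and> l \<le> k + 2 \<or> n + k \<le> l + 2 \<or> n + l \<le> k + 2)"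

definition conflict_pair :: "nat \<Rightarrow> (nat \<Rightarrow> 'b) \<Rightarrow> (nat \<Rightarrow> color) \<Rightarrow> nat \<Rightarrow> nat \<Rightarrow> bool" where
  "conflict_pair n b c i l \<longleftrightarrow>
     1 \<le> i \<and> i < l \<and> l \<le> n \<and> b i = b l \<and> c i = c l \<and> c i \<in> {TwoA, TwoB}"

text \<open>A separator is not recolored, and no conflicting pair has positions on both sides of it.\<close>

definition separator :: "nat \<Rightarrow> (nat \<Rightarrow> 'b) \<Rightarrow> (nat \<Rightarrow> color) \<Rightarrow> nat \<Rightarrow> bool" where
  "separator n b c q \<longleftrightarrow> even q \<and> 2 \<le> q \<and> c q \<in> {TwoA, TwoB} \<and>
     (\<forall>i l. conflict_pair n b c i l \<longrightarrow> i \<noteq> q \<and> l \<noteq> q \<and> \<not> (i < q \<and> q < l))"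

text \<open>The properties of the coloring \<open>c\<close> of the positions after RECOLORING on which the correctness of
  CONFLICTS-RESOLVING rests, \<open>b\<close> being the map to the blocks.  The last one lists the possible places of
  \<open>2\<^sub>c\<close>: none; only \<open>n\<close>, if CASE-2 makes no modification; only \<open>2\<close>, after modification (ii); \<open>2\<close> and
  \<open>n - 1\<close>, after modification (i).\<close>

locale resolvable =
  fixes n :: nat and b :: "nat \<Rightarrow> 'b" and c :: "nat \<Rightarrow> color"
  assumes noncrossing: "\<lbrakk>1 \<le> i; i < j; j < k; k < l; l \<le> n; b i = b k; b j = b l\<rbrakk> \<Longrightarrow> b i = b j"
    and close_distinct:
      "\<lbrakk>k \<in> {1..n}; l \<in> {1..n}; close n k l; c k \<notin> ones; c l \<notin> ones\<rbrakk> \<Longrightarrow> c k \<noteq> c l"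
    and pair_unique: "\<lbrakk>conflict_pair n b c i l; conflict_pair n b c i' l'; b i = b i'\<rbrakk> \<Longrightarrow> i = i' \<and> l = l'"
    and TwoC_no_pair: "\<lbrakk>conflict_pair n b c i l; z \<in> {1..n}; c z = TwoC\<rbrakk> \<Longrightarrow> b z \<noteq> b i"
    and TwoC_block: "\<lbrakk>y \<in> {1..n}; z \<in> {1..n}; c y = TwoC; c z = TwoC; b y = b z\<rbrakk> \<Longrightarrow> y = z"
    and pair_even: "conflict_pair n b c i l \<Longrightarrow> even i"
    and pair_pred: "conflict_pair n b c i l \<Longrightarrow> c (i - 1) \<in> ones"
    and no_three: "\<lbrakk>1 \<le> k; k + 2 \<le> n\<rbrakk> \<Longrightarrow> c k \<in> ones \<or> c (k + 1) \<in> ones \<or> c (k + 2) \<in> ones"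
    and initial_TwoC:
      "{k \<in> {1..n}. c k = TwoC} = {} \<or>
       {k \<in> {1..n}. c k = TwoC} = {n} \<and> (\<exists>q<n. separator n b c q) \<or>
       {k \<in> {1..n}. c k = TwoC} = {2} \<and> (\<forall>i. \<not> conflict_pair n b c i n) \<or>
       {k \<in> {1..n}. c k = TwoC} = {2, n - 1} \<and> (\<forall>i. \<not> conflict_pair n b c i n) \<and>
         c (n - 2) \<in> ones \<and> (\<exists>q>2. q < n - 1 \<and> separator n b c q)"
begin

abbreviation (input) "pair \<equiv> conflict_pair n b c"

definition initial :: "nat set" where "initial = {k \<in> {1..n}. c k = TwoC}"

text \<open>The positions with color \<open>2\<^sub>c\<close> after \<open>t\<close> steps.  For \<open>i = 2\<close> the algorithm looks at \<open>a\<^sub>0 = a\<^sub>n\<close> in place of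
  \<open>a\<^bsub>i-2\<^esub>\<close>.\<close>

primrec resolved :: "nat \<Rightarrow> nat set" where
  "resolved 0 = initial"
| "resolved (Suc t) = resolved t \<union>
     {k. \<exists>l. pair (Suc t) l \<and>
        k = (if (if Suc t = 2 then n else Suc t - 2) \<in> resolved t then l else Suc t)}"

definition Z :: "nat set" where "Z = resolved n"

lemma pairD:
  assumes "pair i l"
  shows "2 \<le> i" "i < l" "l \<le> n" "b i = b l" "c i = c l" "c i \<noteq> TwoC" "c i \<notin> ones" "even i"
proof -
  have "1 \<le> i" "even i" using assms pair_even by (auto simp: conflict_pair_def)
  thus "2 \<le> i" by (cases "i = 1") auto
qed (use assms pair_even in \<open>auto simp: conflict_pair_def\<close>)

lemma no_pair_at_1: "\<not> pair 1 l" "\<not> pair i 1"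
  using pairD(1)[of 1 l] pairD(1,2)[of i 1] by auto

lemma resolved_cases:
  assumes "k \<in> resolved t"
  shows "k \<in> initial \<or> (\<exists>i l. pair i l \<and> i \<le> t \<and> (k = i \<or> k = l))"
  using assms by (induction t) (auto split: if_splits intro: le_SucI)

lemma resolved_mono: "s \<le> t \<Longrightarrow> resolved s \<subseteq> resolved t"
  by (rule lift_Suc_mono_le[of resolved]) auto

text \<open>Step \<open>i\<close> adds a member of a pair whose smaller member is \<open>i\<close>, hence no position below \<open>i\<close>.\<close>

lemma resolved_low:
  assumes "k \<in> resolved t" "k \<le> s" shows "k \<in> resolved s"
  using assms(1)
proof (induction t)
  case 0 thus ?case using resolved_mono[of 0 s] by auto
next
  case (Suc t)
  show ?case
  proof (cases "k \<in> resolved t")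
    case False
    then obtain l where "pair (Suc t) l" "k = l \<or> k = Suc t" using Suc.prems by (auto split: if_splits)
    hence "Suc t \<le> s" using pairD(2) assms(2) by fastforce
    thus ?thesis using resolved_mono Suc.prems by blast
  qed (use Suc.IH in simp)
qed

text \<open>The decision at \<open>i\<close> depends on \<open>i - 2\<close> only through the final set, since later steps
  do not touch positions below \<open>i\<close>.\<close>

definition blocked :: "nat \<Rightarrow> bool" where
  "blocked i \<longleftrightarrow> (if i = 2 then n \<in> initial else i - 2 \<in> Z)"

lemma blocked_iff:
  assumes "pair (Suc t) l"
  shows "(if Suc t = 2 then n else Suc t - 2) \<in> resolved t \<longleftrightarrow> blocked (Suc t)"
proof (cases "Suc t = 2")
  case True
  have "resolved 1 = initial" using no_pair_at_1 by simp
  thus ?thesis using True by (simp add: blocked_def)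
next
  case False
  have "t - 1 \<in> resolved t \<longleftrightarrow> t - 1 \<in> Z"
    using resolved_mono[of t n] resolved_low[of "t - 1" n t] pairD(2,3)[OF assms] by (auto simp: Z_def)
  thus ?thesis using False by (simp add: blocked_def)
qed

lemma Z_cases:
  assumes "k \<in> Z"
  obtains "k \<in> initial" | l where "pair k l" "\<not> blocked k" | i where "pair i k" "blocked i"
proof -
  have "k \<in> initial \<or> (\<exists>l. pair k l \<and> \<not> blocked k) \<or> (\<exists>i. pair i k \<and> blocked i)" if "k \<in> resolved t" for t
    using that
  proof (induction t)
    case (Suc t)
    show ?case
    proof (cases "k \<in> resolved t")
      case False
      then obtain l where "pair (Suc t) l"
        "k = (if (if Suc t = 2 then n else Suc t - 2) \<in> resolved t then l else Suc t)"
        using Suc.prems by auto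
      thus ?thesis using blocked_iff by (metis (full_types))
    qed (use Suc.IH in simp)
  qed simp
  thus ?thesis using assms that unfolding Z_def by blast
qed

lemma pair_in_Z:
  assumes "pair i l" shows "if blocked i then l \<in> Z else i \<in> Z"
proof -
  obtain t where t: "i = Suc t" using pairD(1)[OF assms] by (cases i) auto
  have "(if blocked i then l else i) \<in> resolved (Suc t)"
    using assms blocked_iff[of t l] t by auto
  moreover have "Suc t \<le> n" using t pairD[OF assms] by simp
  ultimately show ?thesis using resolved_mono[of "Suc t" n] unfolding Z_def by (auto split: if_splits)
qed

lemma initial_iff: "k \<in> initial \<longleftrightarrow> k \<in> {1..n} \<and> c k = TwoC"
  by (simp add: initial_def)

lemma pair_range: "pair i l \<Longrightarrow> i \<in> {1..n} \<and> l \<in> {1..n} \<and> c i \<notin> ones \<and> c l \<notin> ones"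
  by (auto simp: conflict_pair_def)

lemma Z_range: "k \<in> Z \<Longrightarrow> k \<in> {1..n}"
  by (erule Z_cases) (use pair_range in \<open>auto simp: initial_iff\<close>)

lemma Z_two: "k \<in> Z \<Longrightarrow> c k \<notin> ones"
  by (erule Z_cases) (use pair_range in \<open>auto simp: initial_iff\<close>)

lemma one_of_pair:
  assumes "pair i l" "i \<in> Z" shows "l \<notin> Z"
proof
  have no: "i \<notin> initial" "l \<notin> initial" using pairD[OF assms(1)] by (auto simp: initial_iff)
  have no': "\<not> pair j i" "\<not> pair l j" for j
    using pair_unique[OF assms(1), of j i] pair_unique[OF assms(1), of l j] pairD[OF assms(1)] pairD(4)[of j i] by fastforce+
  assume "l \<in> Z"
  hence "blocked i"
  proof (cases rule: Z_cases)
    case (3 j)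
    hence "j = i" using pair_unique[OF assms(1), of j l] pairD(4)[of j l] pairD(4)[OF assms(1)] by simp
    thus ?thesis using 3 by simp
  qed (use no no' in auto)
  moreover have "\<not> blocked i" using assms(2) by (cases rule: Z_cases) (use no no' in auto)
  ultimately show False by simp
qed

text \<open>The descent that drives the proof.  If \<open>x\<close> is recolored, it is the second member of a pair \<open>(w, x)\<close>, as a
  first member would have its partner beyond \<open>x\<close>; so \<open>w - 2\<close> was recolored before.  It is not \<open>q\<close>, and a
  pair with a member in \<open>{q<..w - 2}\<close> stays in this interval, since it does not cross \<open>(w, x)\<close> and
  \<open>w - 1\<close> has a color of radius 1.  So the argument repeats for \<open>w - 2\<close>.  For \<open>q = 0\<close> the role of the position before \<open>2\<close> is played by \<open>n\<close>.\<close>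

lemma not_in_Z_beyond:
  assumes q: "even q" "if q = 0 then n \<notin> initial else q \<notin> Z"
    and "q < x"
    and closed: "\<And>i l. pair i l \<Longrightarrow> q < i \<and> i \<le> x \<or> q < l \<and> l \<le> x \<Longrightarrow> q < i \<and> l \<le> x"
    and init: "\<And>z. z \<in> initial \<Longrightarrow> q < z \<Longrightarrow> z \<le> x \<Longrightarrow> False"
  shows "x \<notin> Z"
  using assms(3-)
proof (induction x rule: less_induct)
  case (less x)
  show ?case
  proof
    assume "x \<in> Z"
    thus False
    proof (cases rule: Z_cases)
      case 1 thus False using less.prems(3)[OF 1 less.prems(1)] by simp
    next
      case (2 l) thus False using less.prems(2)[of x l] less.prems(1) pairD(2)[of x l] by simp
    next
      case (3 w)
      note w = pairD[OF 3(1)]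
      have "q < w" using less.prems(2)[OF 3(1)] less.prems(1) by simp
      show False
      proof (cases "w = 2")
        case True
        hence "q = 0" using \<open>q < w\<close> q(1) by (cases "q = 1") auto
        thus False using True 3(2) q(2) by (simp add: blocked_def)
      next
        case False
        hence wZ: "w - 2 \<in> Z" using 3(2) by (simp add: blocked_def)
        have w4: "4 \<le> w" using False w(1,8) by (cases "w = 3") auto
        have "q \<le> w - 2" using \<open>q < w\<close> q(1) w(8) w4 by (cases "q = w - 1") auto
        moreover have "q \<noteq> w - 2" using wZ q(2) w4 by auto
        ultimately have qw: "q < w - 2" by simp
        have "w - 2 \<notin> Z"
        proof (rule less.IH)
          show "w - 2 < x" using w by simp
          show "q < w - 2" by (rule qw)
          show "False" if "z \<in> initial" "q < z" "z \<le> w - 2" for z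
          proof -
            have "z \<le> x" using that(3) w(2) by simp
            thus False using less.prems(3) that by blast
          qed
          fix i l assume il: "pair i l" and *: "q < i \<and> i \<le> w - 2 \<or> q < l \<and> l \<le> w - 2"
          note i = pairD[OF il]
          have iw: "i \<le> w - 2" using * i(2) by linarith
          have "q < i \<and> i \<le> x \<or> q < l \<and> l \<le> x" using * w(1,2) by linarith
          hence il': "q < i" "l \<le> x" "i \<le> w - 2" using less.prems(2)[OF il] iw by blast+
          have "l \<le> w - 2"
          proof (rule ccontr)
            assume "\<not> l \<le> w - 2"
            then consider "l = w - 1" | "l = w" | "w < l" "l < x" | "l = x" using il'(2) by linarith
            thus False
            proof cases
              case 1 thus False using pair_pred[OF 3(1)] i(5,7) by simp
            next
              case 2
              have "b i = b w" using i(4) unfolding 2 .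
              from pair_unique[OF il 3(1) this] show False using i(2) 2 by simp
            next
              case between: 3
              have "b i = b w" by (rule noncrossing[of i w l x]) (use between i(1,4) w(2,3,4) il'(3) w4 in auto)
              from pair_unique[OF il 3(1) this] show False using il'(3) w4 by simp
            next
              case 4
              have "b i = b w" using i(4) w(4) unfolding 4 by simp
              from pair_unique[OF il 3(1) this] show False using il'(3) w4 by simp
            qed
          qed
          thus "q < i \<and> l \<le> w - 2" using il' by simp
        qed
        thus False using wZ by simp
      qed
    qed
  qed
qed

text \<open>If the second member \<open>y\<close> of a pair \<open>(i, y)\<close> is recolored, the first is not and stops the descent from the
  last position before \<open>y\<close>.\<close>

lemma between_second:
  assumes "pair i y" "y \<in> Z" "i < x" "x < y"
    and gap: "\<And>z. x < z \<Longrightarrow> z < y \<Longrightarrow> c z \<in> ones"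
    and init: "\<And>z. z \<in> initial \<Longrightarrow> i < z \<Longrightarrow> z \<le> x \<Longrightarrow> False"
  shows "x \<notin> Z"
proof (rule not_in_Z_beyond[of i])
  note i = pairD[OF assms(1)]
  show "even i" by (rule i)
  show "if i = 0 then n \<notin> initial else i \<notin> Z" using i(1) one_of_pair[OF assms(1)] assms(2) by auto
  show "i < x" by fact
  show "False" if "z \<in> initial" "i < z" "z \<le> x" for z using init that .
  fix j l assume jl: "pair j l" and *: "i < j \<and> j \<le> x \<or> i < l \<and> l \<le> x"
  note j = pairD[OF jl]
  have ne: "b j \<noteq> b i"
    using pair_unique[OF jl assms(1)] * assms(4) by auto
  have "j \<noteq> i" "l \<noteq> y" "l \<noteq> i" using ne i j by auto
  have "i < j"
  proof (rule ccontr)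
    assume "\<not> i < j"
    hence "j < i" "i < l" "l < y" using * assms(3,4) \<open>j \<noteq> i\<close> j by auto
    thus False using noncrossing[of j i l y] i j ne by simp
  qed
  moreover have "l < y"
  proof (rule ccontr)
    assume "\<not> l < y"
    hence "j < y" "y < l" using * assms(4) \<open>l \<noteq> y\<close> by auto
    thus False using noncrossing[of i j y l] \<open>i < j\<close> i j ne by simp
  qed
  moreover have "\<not> x < l" using gap[of l] \<open>l < y\<close> j(5,7) by auto
  ultimately show "i < j \<and> l \<le> x" by simp
qed

lemma separator_not_in_Z:
  assumes "separator n b c q" shows "q \<notin> Z"
proof
  assume "q \<in> Z"
  thus False using assms unfolding separator_def by (cases rule: Z_cases) (auto simp: initial_iff)
qed

text \<open>The separator stops the descent from the last position that can belong to a pair.\<close>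

lemma before_initial:
  assumes q: "separator n b c q" "q \<le> x"
    and gap: "\<And>z l. x < z \<Longrightarrow> pair z l \<Longrightarrow> False" "\<And>z i. x < z \<Longrightarrow> pair i z \<Longrightarrow> False"
    and init: "\<And>z. z \<in> initial \<Longrightarrow> q < z \<Longrightarrow> z \<le> x \<Longrightarrow> False"
  shows "x \<notin> Z"
proof (cases "q = x")
  case True thus ?thesis using separator_not_in_Z q by simp
next
  case False
  have q': "even q" "2 \<le> q" "\<And>i l. pair i l \<Longrightarrow> i \<noteq> q \<and> l \<noteq> q \<and> \<not> (i < q \<and> q < l)"
    using q(1) by (auto simp: separator_def)
  show ?thesis
  proof (rule not_in_Z_beyond[of q])
    show "if q = 0 then n \<notin> initial else q \<notin> Z" using q' separator_not_in_Z[OF q(1)] by simp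
    fix i l assume il: "pair i l" and *: "q < i \<and> i \<le> x \<or> q < l \<and> l \<le> x"
    have "q < i" using * q'(3)[OF il] by auto
    moreover have "l \<le> x" using gap(2)[OF _ il] by force
    ultimately show "q < i \<and> l \<le> x" by simp
  qed (use q' q False init in auto)
qed

lemma first_step_free:
  assumes "2 \<in> Z" "c 2 \<noteq> TwoC" shows "n \<notin> initial"
  using assms(1)
proof (cases rule: Z_cases)
  case (3 i) thus ?thesis using pairD(1,2)[of i 2] by simp
qed (use assms(2) in \<open>auto simp: initial_iff blocked_def\<close>)

text \<open>Either there is no \<open>2\<^sub>c\<close> at the beginning and the descent runs down to \<open>0\<close>, or \<open>n\<close> belongs to no pair.\<close>

lemma last_not_in_Z:
  assumes "n \<notin> initial" shows "n \<notin> Z"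
proof -
  consider "initial = {}" | "\<And>i. \<not> pair i n"
    using initial_TwoC assms unfolding initial_def[symmetric] by blast
  thus ?thesis
  proof cases
    case 1
    show ?thesis
    proof (cases "n = 0")
      case True thus ?thesis using Z_range by force
    next
      case False
      show ?thesis
        by (rule not_in_Z_beyond[of 0]) (use 1 assms False in \<open>auto dest: pairD\<close>)
    qed
  next
    case 2
    show ?thesis
    proof
      assume "n \<in> Z"
      thus False
      proof (cases rule: Z_cases)
        case (2 l) thus False using pairD(2,3)[OF 2(1)] by simp
      qed (use assms 2 in auto)
    qed
  qed
qed

text \<open>The case of two positions that are close without passing from \<open>n\<close> to \<open>1\<close>.  If \<open>y\<close> is a first member, it
  would have been spared because \<open>y - 2 = x\<close> is recolored.  If it is a second member, the pair protects \<open>x\<close>,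
  and if it has \<open>2\<^sub>c\<close> from the beginning, a separator does.\<close>

lemma Z_not_close_aux:
  assumes x: "x \<in> Z" and y: "y \<in> Z" and "x < y" "y \<le> x + 2"
  shows False
  using y
proof (cases rule: Z_cases)
  have xy: "x \<in> {1..n}" "y \<in> {1..n}" "c x \<notin> ones" "c y \<notin> ones" using x y Z_range Z_two by blast+
  have gap: "c z \<in> ones" if "x < z" "z < y" for z
  proof -
    have "z = x + 1" "y = x + 2" using that assms(4) by auto
    thus ?thesis using no_three[of x] xy by auto
  qed
  {
    case (2 l)
    hence "y \<noteq> x + 1" using pair_pred[OF 2(1)] xy by auto
    hence "y = x + 2" using assms(3,4) by simp
    thus False using 2(2) x xy by (simp add: blocked_def)
  next
    case (3 i)
    note i = pairD[OF 3(1)]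
    have "i \<noteq> x" using close_distinct[of x y] xy assms(3,4) i(5) by (auto simp: close_def)
    moreover have "\<not> x < i" using gap[of i] i(2,7) by auto
    ultimately have "i < x" by simp
    moreover have "False" if z: "z \<in> initial" "i < z" "z \<le> x" for z
    proof -
      have *: "z \<noteq> 2" "z \<noteq> n" using z i(1) xy assms(3) by auto
      from initial_TwoC have "z = n - 1" "\<And>i. \<not> pair i n"
        using z(1) * unfolding initial_def[symmetric] by auto
      thus False using 3(1) z assms(3) xy by (cases "y = n") auto
    qed
    ultimately show False using between_second[OF 3(1) y _ assms(3) gap] x by blast
  next
    case 1
    from initial_TwoC consider
        q where "y = n" "separator n b c q" "q < n" "initial = {n}"
      | "y = 2"
      | q where "y = n - 1" "separator n b c q" "q < n - 1" "2 < q" "initial = {2, n - 1}" "c (n - 2) \<in> ones"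
          "\<And>i. \<not> pair i n"
      using 1 unfolding initial_def[symmetric] by blast
    thus False
    proof cases
      case 1
      have "q \<le> x" using gap[of q] 1 by (force simp: separator_def)
      moreover have "\<not> pair i z" "\<not> pair z i" if "x < z" for i z
      proof -
        have "z = n \<or> n < z \<or> c z \<in> ones" using gap[of z] that 1(1) by linarith
        thus "\<not> pair i z" "\<not> pair z i" using pairD[of i z] pairD[of z i] \<open>y \<in> initial\<close> 1(1)
          by (auto simp: initial_iff)
      qed
      ultimately show False
        using before_initial[OF 1(2), of x] x 1(1,4) assms(3) by (metis leD singletonD)
    next
      case 2
      hence "x = 1" using assms(3) xy by simp
      from x show False
      proof (cases rule: Z_cases)
        case 1
        thus False using initial_TwoC \<open>y \<in> initial\<close> \<open>y = 2\<close> \<open>x = 1\<close> unfolding initial_def[symmetric] 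
          by (auto simp: separator_def)
      qed (use \<open>x = 1\<close> no_pair_at_1 in auto)
    next
      case 3
      have "q \<le> x" using gap[of q] 3 by (force simp: separator_def)
      moreover have "\<not> pair i z" "\<not> pair z i" if "x < z" for i z
      proof -
        have "z = n - 1 \<or> z = n \<or> n < z \<or> c z \<in> ones" using gap[of z] that 3(1) by linarith
        thus "\<not> pair i z" "\<not> pair z i" using pairD[of i z] pairD[of z i] \<open>y \<in> initial\<close> 3(1,7)
          by (auto simp: initial_iff)
      qed
      moreover have "False" if "z \<in> initial" "q < z" "z \<le> x" for z
        using that 3(1,4,5) assms(3) by auto
      ultimately show False using before_initial[OF 3(2), of x] x by blast
    qed
  }
qed

lemma Z_not_close:
  assumes x: "x \<in> Z" and y: "y \<in> Z" and "close n x y" shows False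
proof -
  have *: False if x: "x \<in> Z" and y: "y \<in> Z" and "x < y" "close n x y" for x y
  proof -
    have xy: "x \<in> {1..n}" "y \<in> {1..n}" using x y Z_range by blast+
    have x1: "x \<noteq> 1"
    proof
      assume "x = 1"
      from x show False
      proof (cases rule: Z_cases)
        case 1
        hence "n = 1 \<or> n - 1 = 1" using initial_TwoC \<open>x = 1\<close> unfolding initial_def[symmetric] by auto
        hence "y \<le> x + 2" using xy by auto
        thus False using Z_not_close_aux[OF x y] \<open>x < y\<close> by simp
      qed (use \<open>x = 1\<close> no_pair_at_1 in auto)
    qed
    show False
    proof (cases "y \<le> x + 2")
      case True thus False using Z_not_close_aux x y \<open>x < y\<close> by blast
    next
      case False
      hence "n + x \<le> y + 2" using that(3,4) xy by (auto simp: close_def)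
      hence "x = 2" "y = n" using x1 xy by auto
      show False
      proof (cases "n \<in> initial")
        case False thus False using last_not_in_Z y \<open>y = n\<close> by simp
      next
        case True
        have "2 \<notin> initial"
          using initial_TwoC True \<open>x = 2\<close> \<open>y = n\<close> \<open>x < y\<close> unfolding initial_def[symmetric] by auto
        thus False using first_step_free x \<open>x = 2\<close> xy True by (auto simp: initial_iff)
      qed
    qed
  qed
  have "x \<noteq> y" "close n y x" using assms(3) by (auto simp: close_def)
  thus False using * x y assms(3) by (metis nat_neq_iff)
qed

text \<open>A block contains at most one pair, of which one member is recolored, and no pair if it has \<open>2\<^sub>c\<close> already.\<close>

lemma Z_block:
  assumes x: "x \<in> Z" and y: "y \<in> Z" and "b x = b y" shows "x = y"
proof -
  have *: "z \<in> initial \<or> (\<exists>i l. pair i l \<and> b z = b i \<and> (z = i \<or> z = l))" if "z \<in> Z" for z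
    using that
  proof (cases rule: Z_cases)
    case (3 i) thus ?thesis using pairD(4)[OF 3(1), symmetric] 3(1) by blast
  qed blast+
  consider "x \<in> initial" "y \<in> initial"
    | i l where "x \<in> initial" "pair i l" "b y = b i"
    | i l where "y \<in> initial" "pair i l" "b x = b i"
    | i l i' l' where "pair i l" "pair i' l'" "b x = b i" "b y = b i'" "x = i \<or> x = l" "y = i' \<or> y = l'"
    using *[OF x] *[OF y] by blast
  thus ?thesis
  proof cases
    case 1 thus ?thesis using TwoC_block[of x y] assms(3) by (simp add: initial_iff)
  next
    case 2 thus ?thesis using TwoC_no_pair[OF 2(2), of x] assms(3) by (simp add: initial_iff)
  next
    case 3 thus ?thesis using TwoC_no_pair[OF 3(2), of y] assms(3) by (simp add: initial_iff)
  next
    case 4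
    have "b i = b i'" using 4(3,4) assms(3) by simp
    hence "i = i'" "l = l'" using pair_unique[OF 4(1,2)] by blast+
    thus ?thesis using 4(5,6) one_of_pair[OF 4(1)] x y by blast
  qed
qed

definition final :: "nat \<Rightarrow> color" where
  "final k = (if k \<in> Z then TwoC else c k)"

lemma initial_in_Z: "initial \<subseteq> Z"
  using resolved_mono[of 0 n] by (simp add: Z_def)

text \<open>Equal colors \<open>2\<^sub>a\<close> or \<open>2\<^sub>b\<close> in one block form a pair, one of whose members is recolored; equal colors \<open>2\<^sub>c\<close>
  are covered by \<open>Z_not_close\<close> and \<open>Z_block\<close>.\<close>

lemma final_separated:
  assumes kl: "k \<in> {1..n}" "l \<in> {1..n}" "k \<noteq> l" "final k = final l" "final k \<notin> ones"
  shows "\<not> close n k l" "b k \<noteq> b l"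
proof -
  have in_Z: "k \<in> Z \<longleftrightarrow> final k = TwoC" if "k \<in> {1..n}" for k
    using initial_in_Z that by (auto simp: final_def initial_iff)
  show "\<not> close n k l"
  proof (cases "final k = TwoC")
    case True thus ?thesis using in_Z kl Z_not_close by metis
  next
    case False thus ?thesis using in_Z[of k] in_Z[of l] kl close_distinct[of k l] by (auto simp: final_def)
  qed
  show "b k \<noteq> b l"
  proof (cases "final k = TwoC")
    case True thus ?thesis using in_Z kl Z_block by metis
  next
    case False
    show ?thesis
    proof
      assume "b k = b l"
      have no: "k \<notin> Z" "l \<notin> Z" using in_Z[of k] in_Z[of l] False kl by auto
      hence "c k = c l" "c k \<in> {TwoA, TwoB}"
        using kl(4,5) False by (cases "c k"; simp add: final_def)+
      hence "pair (min k l) (max k l)" using kl \<open>b k = b l\<close> by (auto simp: conflict_pair_def min_def max_def)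
      thus False using pair_in_Z no by (metis max_def min_def)
    qed
  qed
qed

end

section \<open>The conflict resolution of the algorithm\<close>

lemma vtx_0: "vtx C 0 = vtx C (length C)"
proof (cases "length C")
  case (Suc m)
  have "(Suc m + m) mod Suc m = m" by (subst mod_add_self1) simp
  thus ?thesis using Suc by (simp add: vtx_def)
qed (simp add: vtx_def)

locale recolored_tree = plane_tree T rot C + resolvable "length C" "nbr T C" "\<lambda>k. \<phi> (vtx C k)"
  for T :: "'v pair_pre_digraph" and rot :: "'v \<Rightarrow> 'v \<Rightarrow> 'v" and C :: "'v list" and \<phi> :: "'v \<Rightarrow> color"
begin

lemma two_leaves_iff:
  "vtx C j \<in> two_leaves T C \<phi> (nbr T C i) \<longleftrightarrow> nbr T C j = nbr T C i \<and> \<phi> (vtx C j) \<notin> ones"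
proof -
  have "(nbr T C i, vtx C j) \<in> parcs T \<longleftrightarrow> nbr T C j = nbr T C i"
    using nbr_iff[of j "nbr T C i"] tree_sym[OF tree] by metis
  thus ?thesis using vtx_leaf[of j] set_C by (simp add: two_leaves_def)
qed

text \<open>When step \<open>i\<close> is reached, the pairs with a smaller first member are resolved; so the conflicts at \<open>i\<close> are
  those of the initial pairs with first member \<open>i\<close>, and such a pair is still untouched.\<close>

lemma conflict_iff:
  assumes inv: "\<And>k. k \<in> {1..length C} \<Longrightarrow> \<psi> (vtx C k) = (if k \<in> resolved t then TwoC else \<phi> (vtx C k))"
    and t: "Suc t \<le> length C"
  shows "conflict T C (two_leaves T C \<phi>) \<psi> (Suc t) j \<longleftrightarrow>
    conflict_pair (length C) (nbr T C) (\<lambda>k. \<phi> (vtx C k)) (Suc t) j"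
    (is "_ \<longleftrightarrow> ?pair (Suc t) j")
proof
  assume "conflict T C (two_leaves T C \<phi>) \<psi> (Suc t) j"
  hence j: "j \<in> {1..length C}" "j \<noteq> Suc t" "nbr T C j = nbr T C (Suc t)" "\<phi> (vtx C j) \<notin> ones"
    "\<psi> (vtx C j) = \<psi> (vtx C (Suc t))" "\<psi> (vtx C (Suc t)) \<noteq> TwoC"
    by (auto simp: conflict_def two_leaves_iff)
  have i: "Suc t \<in> {1..length C}" using t by simp
  have no: "j \<notin> resolved t" "Suc t \<notin> resolved t" using j(5,6) inv[OF j(1)] inv[OF i] by auto
  hence "\<phi> (vtx C j) = \<phi> (vtx C (Suc t))" "\<phi> (vtx C j) \<in> {TwoA, TwoB}"
    using j(4,5,6) inv[OF j(1)] inv[OF i] by (cases "\<phi> (vtx C j)"; simp)+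
  hence "?pair (Suc t) j \<or> ?pair j (Suc t)" using j(1,2,3) i by (auto simp: conflict_pair_def)
  moreover have False if p: "?pair j (Suc t)"
  proof -
    obtain s where s: "j = Suc s" using j(1) by (cases j) auto
    have "Suc s \<le> t" using pairD(2)[OF p] s by simp
    moreover have "j \<in> resolved (Suc s) \<or> Suc t \<in> resolved (Suc s)" using p s by auto
    ultimately show False using resolved_mono no by blast
  qed
  ultimately show "?pair (Suc t) j" by blast
next
  assume p: "?pair (Suc t) j"
  note i = pairD[OF p]
  have "k \<notin> resolved t" if k: "k = Suc t \<or> k = j" for k
  proof
    assume "k \<in> resolved t"
    then consider "k \<in> initial" | i l where "?pair i l" "i \<le> t" "k = i \<or> k = l" using resolved_cases by blast
    thus False
    proof cases
      case 1 thus False using k i(5,6) by (auto simp: initial_iff)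
    next
      case (2 i' l')
      have "nbr T C (Suc t) = nbr T C k" using k i(4) by auto
      also have "\<dots> = nbr T C i'" using 2(3) pairD(4)[OF 2(1)] by auto
      finally have "Suc t = i'" using pair_unique[OF p 2(1)] by blast
      thus False using 2(2) by simp
    qed
  qed
  hence "\<psi> (vtx C (Suc t)) = \<phi> (vtx C (Suc t))" "\<psi> (vtx C j) = \<phi> (vtx C j)"
    using inv[of "Suc t"] inv[of j] t i(2,3) by auto
  thus "conflict T C (two_leaves T C \<phi>) \<psi> (Suc t) j"
    unfolding conflict_def two_leaves_iff using i by auto
qed

lemma resolve_steps:
  assumes "t \<le> length C" "k \<in> {1..length C}"
  shows "fold (resolve_step T C (two_leaves T C \<phi>)) [1..<t + 1] \<phi> (vtx C k) =
    (if k \<in> resolved t then TwoC else \<phi> (vtx C k))"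
  using assms
proof (induction t arbitrary: k)
  case 0 thus ?case by (simp add: initial_iff)
next
  case (Suc t)
  let ?pair = "conflict_pair (length C) (nbr T C) (\<lambda>k. \<phi> (vtx C k))"
  define N where "N = two_leaves T C \<phi>"
  define \<psi> where "\<psi> = fold (resolve_step T C N) [1..<t + 1] \<phi>"
  have IH: "\<psi> (vtx C k) = (if k \<in> resolved t then TwoC else \<phi> (vtx C k))" if "k \<in> {1..length C}" for k
    using Suc that by (simp add: \<psi>_def N_def)
  have conf: "conflict T C N \<psi> (Suc t) j \<longleftrightarrow> ?pair (Suc t) j" for j
    unfolding N_def by (rule conflict_iff[OF IH Suc.prems(1)])
  have eq: "fold (resolve_step T C N) [1..<Suc t + 1] \<phi> = resolve_step T C N (Suc t) \<psi>"
    by (simp add: \<psi>_def)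
  show ?case
  proof (cases "\<exists>l. ?pair (Suc t) l")
    case False
    have "resolve_step T C N (Suc t) \<psi> = \<psi>" unfolding resolve_step_def conf using False by simp
    moreover have "resolved (Suc t) = resolved t" using False by auto
    ultimately show ?thesis unfolding N_def[symmetric] eq using IH[OF Suc.prems(2)] by simp
  next
    case True
    then obtain l where l: "?pair (Suc t) l" by blast
    have uniq: "?pair (Suc t) j \<longleftrightarrow> j = l" for j using pair_unique[OF l, of "Suc t" j] l by blast
    have confl: "conflict T C N \<psi> (Suc t) = (\<lambda>j. j = l)" using conf uniq by blast
    define p where "p = (if Suc t = 2 then length C else Suc t - 2)"
    note i = pairD[OF l]
    have "Suc t \<noteq> 3" using i(8) by auto
    hence p: "p \<in> {1..length C}" "vtx C (Suc t - 2) = vtx C p"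
      using i(1-3) vtx_0[of C] length_C by (auto simp: p_def)
    have "\<psi> (vtx C p) = TwoC \<longleftrightarrow> p \<in> resolved t"
      using IH[OF p(1)] p(1) resolved_mono[of 0 t] by (auto simp: initial_iff)
    moreover have "(LEAST j. j = l) = l" by (rule Least_equality) auto
    ultimately have step: "resolve_step T C N (Suc t) \<psi> = \<psi>(vtx C (if p \<in> resolved t then l else Suc t) := TwoC)"
      unfolding resolve_step_def confl Let_def p(2) using i(8) by simp
    have res: "resolved (Suc t) = insert (if p \<in> resolved t then l else Suc t) (resolved t)"
      by (auto simp: uniq p_def)
    have "(if p \<in> resolved t then l else Suc t) \<in> {1..length C}" using i(1-3) by auto
    thus ?thesis unfolding N_def[symmetric] eq step res
      using IH[OF Suc.prems(2)] vtx_inj[OF Suc.prems(2)] by simp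
  qed
qed

lemma resolve_conflicts_final:
  "k \<in> {1..length C} \<Longrightarrow> resolve_conflicts T C \<phi> (vtx C k) = final k"
  unfolding resolve_conflicts_def final_def Z_def using resolve_steps[of "length C" k] by simp

lemma resolve_conflicts_inner:
  assumes "v \<notin> leaves T" shows "resolve_conflicts T C \<phi> v = \<phi> v"
proof -
  have "fold (resolve_step T C N) is \<psi> v = \<psi> v" for N "is" \<psi>
  proof (induction "is" arbitrary: \<psi>)
    case (Cons i "is")
    have "resolve_step T C N i \<psi> v = \<psi> v"
      using assms vtx_leaf by (auto simp: resolve_step_def Let_def)
    thus ?case using Cons by simp
  qed simp
  thus ?thesis by (simp add: resolve_conflicts_def)
qed

end

section \<open>The coloring of the cycle after RECOLORING\<close>

text \<open>The colors of radius 2 are spread out: equal ones are not close, and only the positions \<open>e\<close> and \<open>e + 1\<close> can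
  be consecutive positions with colors of radius 2 (if there are none, any even \<open>e\<close> outside the range of
  positions serves).  This makes \<open>no_three_apart\<close> effective.\<close>

locale spaced =
  fixes n :: nat and b :: "nat \<Rightarrow> 'b" and c :: "nat \<Rightarrow> color" and e :: nat
  assumes noncrossing: "\<lbrakk>1 \<le> i; i < j; j < k; k < l; l \<le> n; b i = b k; b j = b l\<rbrakk> \<Longrightarrow> b i = b j"
    and no_three_apart: "\<lbrakk>1 \<le> p; p + 1 < q; q + 1 < r; r \<le> n; \<not> (p = 1 \<and> r = n); b q = b p; b r = b p\<rbrakk> \<Longrightarrow> False"
    and close_distinct:
      "\<lbrakk>k \<in> {1..n}; l \<in> {1..n}; close n k l; c k \<notin> ones; c l \<notin> ones\<rbrakk> \<Longrightarrow> c k \<noteq> c l"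
    and adjacent: "\<lbrakk>1 \<le> k; k < n; c k \<notin> ones; c (k + 1) \<notin> ones\<rbrakk> \<Longrightarrow> k = e"
    and even_e: "even e"
    and one_1: "c 1 \<in> ones"
    and odd_last: "\<lbrakk>odd i; 1 \<le> i; i < l; l \<le> n; c i \<notin> ones\<rbrakk> \<Longrightarrow> c l \<noteq> c i"
begin

abbreviation (input) "pair \<equiv> conflict_pair n b c"

text \<open>Without the exceptional couple the three positions would be pairwise non-consecutive; position \<open>1\<close> has a color
  of radius 1, so \<open>n\<close> and \<open>1\<close> are no obstacle.\<close>

lemma three_sorted:
  assumes "1 \<le> x" "x < y" "y < z" "z \<le> n" "c x \<notin> ones" "c y \<notin> ones" "c z \<notin> ones" "b y = b x" "b z = b x"
  shows "x = e \<and> y = e + 1 \<or> y = e \<and> z = e + 1"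
proof (cases "x + 1 = y")
  case True thus ?thesis using adjacent[of x] assms by simp
next
  case xy: False
  show ?thesis
  proof (cases "y + 1 = z")
    case True thus ?thesis using adjacent[of y] assms by simp
  next
    case False
    moreover have "x \<noteq> 1" using one_1 assms(5) by auto
    ultimately show ?thesis using no_three_apart[of x y z] xy assms by simp
  qed
qed

lemma three_in_block:
  assumes "x \<in> {1..n}" "y \<in> {1..n}" "z \<in> {1..n}" "x \<noteq> y" "y \<noteq> z" "x \<noteq> z"
    and "c x \<notin> ones" "c y \<notin> ones" "c z \<notin> ones" and b: "b y = b x" "b z = b x"
  shows "e \<in> {x, y, z} \<and> e + 1 \<in> {x, y, z}"
proof -
  consider "x < y" "y < z" | "x < z" "z < y" | "y < x" "x < z" | "y < z" "z < x" | "z < x" "x < y" | "z < y" "y < x"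
    using assms(4-6) by linarith
  thus ?thesis
  proof cases
    case 1
    have "x = e \<and> y = e + 1 \<or> y = e \<and> z = e + 1"
      by (rule three_sorted) (use 1 assms in simp_all)
    thus ?thesis by blast
  next
    case 2
    have "x = e \<and> z = e + 1 \<or> z = e \<and> y = e + 1"
      by (rule three_sorted) (use 2 assms in simp_all)
    thus ?thesis by blast
  next
    case 3
    have "y = e \<and> x = e + 1 \<or> x = e \<and> z = e + 1"
      by (rule three_sorted) (use 3 assms in simp_all)
    thus ?thesis by blast
  next
    case 4
    have "y = e \<and> z = e + 1 \<or> z = e \<and> x = e + 1"
      by (rule three_sorted) (use 4 assms in simp_all)
    thus ?thesis by blast
  next
    case 5
    have "z = e \<and> x = e + 1 \<or> x = e \<and> y = e + 1"
      by (rule three_sorted) (use 5 assms in simp_all)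
    thus ?thesis by blast
  next
    case 6
    have "z = e \<and> y = e + 1 \<or> y = e \<and> x = e + 1"
      by (rule three_sorted) (use 6 assms in simp_all)
    thus ?thesis by blast
  qed
qed

lemma three_of_block:
  assumes U: "\<And>u. u \<in> U \<Longrightarrow> u \<in> {1..n} \<and> c u \<notin> ones \<and> b u = \<beta>"
    and xyz: "{x, y, z} \<subseteq> U" "x \<noteq> y" "y \<noteq> z" "x \<noteq> z"
  shows "e \<in> {x, y, z}" "e + 1 \<in> {x, y, z}"
proof -
  have "x \<in> U" "y \<in> U" "z \<in> U" using xyz(1) by blast+
  note * = U[OF this(1)] U[OF this(2)] U[OF this(3)]
  have "e \<in> {x, y, z} \<and> e + 1 \<in> {x, y, z}" by (rule three_in_block) (use * xyz(2-) in simp_all)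
  thus "e \<in> {x, y, z}" "e + 1 \<in> {x, y, z}" by blast+
qed

lemma pair_facts:
  assumes "pair i l"
  shows "i \<in> {1..n}" "l \<in> {1..n}" "i < l" "i \<noteq> l" "b l = b i" "c l = c i" "c i \<in> {TwoA, TwoB}" "c i \<notin> ones" "c l \<notin> ones"
  using assms by (auto simp: conflict_pair_def)

lemma couple_colors_differ: "\<lbrakk>e \<in> {1..n}; e + 1 \<in> {1..n}; c e \<notin> ones\<rbrakk> \<Longrightarrow> c e \<noteq> c (e + 1)"
  using close_distinct[of e "e + 1"] by (auto simp: close_def)

lemma no_three_alike:
  assumes U: "\<And>u. u \<in> U \<Longrightarrow> u \<in> {1..n} \<and> c u \<notin> ones \<and> b u = \<beta> \<and> c u = \<gamma>"
    and xyz: "{x, y, z} \<subseteq> U" "x \<noteq> y" "y \<noteq> z" "x \<noteq> z"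
  shows False
proof -
  have "e \<in> U" "e + 1 \<in> U" using three_of_block[of U \<beta> x y z] U xyz by blast+
  thus False using U couple_colors_differ by metis
qed

text \<open>Two pairs of one color give three positions of that color that include \<open>e\<close> and \<open>e + 1\<close>, which are close.  Two
  pairs of different colors give four positions, and any three of them would have to include \<open>e\<close>.\<close>

lemma pair_unique:
  assumes p: "pair i l" "pair i' l'" and "b i = b i'"
  shows "i = i' \<and> l = l'"
proof (rule ccontr)
  note f = pair_facts[OF p(1)] and f' = pair_facts[OF p(2)]
  have b: "b i' = b i" "b l' = b i" using f'(5) assms(3) by simp_all
  let ?U = "{i, l, i', l'}"
  have U: "u \<in> {1..n} \<and> c u \<notin> ones \<and> b u = b i" if "u \<in> ?U" for u
    using that f(1,2,5,8,9) f'(1,2,8,9) b by blast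
  assume neq: "\<not> (i = i' \<and> l = l')"
  show False
  proof (cases "c i' = c i")
    case True
    have "c u = c i" if "u \<in> ?U" for u using that f(6) f'(6) True by auto
    hence U': "u \<in> {1..n} \<and> c u \<notin> ones \<and> b u = b i \<and> c u = c i" if "u \<in> ?U" for u using that U by blast
    have "i' \<noteq> i \<and> i' \<noteq> l \<or> l' \<noteq> i \<and> l' \<noteq> l" using neq f(3) f'(3) by auto
    thus False using no_three_alike[OF U', where x = i and y = l and z = i'] no_three_alike[OF U', where x = i and y = l and z = l'] f(4) by blast
  next
    case False
    have d: "i \<noteq> i'" "i \<noteq> l'" "l \<noteq> i'" "l \<noteq> l'" using False f(6) f'(6) by auto
    have "e \<in> {x, y, z}" if "{x, y, z} \<subseteq> ?U" "x \<noteq> y" "y \<noteq> z" "x \<noteq> z" for x y z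
      by (rule three_of_block[OF U that])
    note this[of i l i'] this[of i l l'] this[of i i' l'] this[of l i' l']
    thus False using d f(4) f'(4) by blast
  qed
qed

lemma pair_even: assumes "pair i l" shows "even i"
  using odd_last[of i l] pair_facts(1,2,3,6,8)[OF assms] by auto

lemma pair_pred: assumes "pair i l" shows "c (i - 1) \<in> ones"
proof (rule ccontr)
  assume "c (i - 1) \<notin> ones"
  moreover have "even i" "1 \<le> i" "i \<le> n" using pair_even[OF assms] assms by (auto simp: conflict_pair_def)
  moreover from this have "2 \<le> i" by (cases "i = 1") auto
  moreover have "c i \<notin> ones" by (rule pair_facts(8)[OF assms])
  ultimately have "i - 1 = e" using adjacent[of "i - 1"] by simp
  thus False using even_e \<open>even i\<close> \<open>2 \<le> i\<close> by auto
qed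

lemma no_three:
  assumes "1 \<le> k" "k + 2 \<le> n" shows "c k \<in> ones \<or> c (k + 1) \<in> ones \<or> c (k + 2) \<in> ones"
proof (rule ccontr)
  assume "\<not> ?thesis"
  hence "k = e" "k + 1 = e" using adjacent[of k] adjacent[of "k + 1"] assms by simp_all
  thus False by simp
qed

text \<open>A position with color \<open>2\<^sub>c\<close> in the block of a pair belongs to the exceptional couple, together with one member of
  the pair.\<close>

lemma TwoC_with_pair:
  assumes p: "pair i l" and z: "z \<in> {1..n}" "c z = TwoC" "b z = b i"
  shows "z = e \<and> (i = e + 1 \<or> l = e + 1) \<or> z = e + 1 \<and> (i = e \<or> l = e)"
proof -
  note f = pair_facts[OF p]
  have d: "z \<noteq> i" "z \<noteq> l" using f(6,7) z(2) by auto
  have U: "u \<in> {1..n} \<and> c u \<notin> ones \<and> b u = b i" if "u \<in> {i, l, z}" for u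
    using that f(1,2,5,8,9) z by auto
  have "e \<in> {i, l, z}" "e + 1 \<in> {i, l, z}"
    using three_of_block[of "{i, l, z}" "b i" i l z] U d f(4) by blast+
  moreover have "\<not> (e \<in> {i, l} \<and> e + 1 \<in> {i, l})"
  proof
    assume "e \<in> {i, l} \<and> e + 1 \<in> {i, l}"
    hence "c e = c i" "c (e + 1) = c i" using f(6) by auto
    thus False using couple_colors_differ U \<open>e \<in> {i, l, z}\<close> \<open>e + 1 \<in> {i, l, z}\<close> by metis
  qed
  ultimately show ?thesis by auto
qed

lemma resolvableI:
  assumes "\<And>i l z. \<lbrakk>pair i l; z \<in> {1..n}; c z = TwoC; b z = b i\<rbrakk> \<Longrightarrow> False"
    and "\<And>y z. \<lbrakk>y \<in> {1..n}; z \<in> {1..n}; c y = TwoC; c z = TwoC; b y = b z\<rbrakk> \<Longrightarrow> y = z"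
    and "{k \<in> {1..n}. c k = TwoC} = {} \<or>
       {k \<in> {1..n}. c k = TwoC} = {n} \<and> (\<exists>q<n. separator n b c q) \<or>
       {k \<in> {1..n}. c k = TwoC} = {2} \<and> (\<forall>i. \<not> conflict_pair n b c i n) \<or>
       {k \<in> {1..n}. c k = TwoC} = {2, n - 1} \<and> (\<forall>i. \<not> conflict_pair n b c i n) \<and>
         c (n - 2) \<in> ones \<and> (\<exists>q>2. q < n - 1 \<and> separator n b c q)"
  shows "resolvable n b c"
proof
  show "\<And>k l. \<lbrakk>k \<in> {1..n}; l \<in> {1..n}; close n k l; c k \<notin> ones; c l \<notin> ones\<rbrakk> \<Longrightarrow> c k \<noteq> c l"
    by (rule close_distinct)
  show "\<And>i l i' l'. \<lbrakk>pair i l; pair i' l'; b i = b i'\<rbrakk> \<Longrightarrow> i = i' \<and> l = l'" by (rule pair_unique)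
qed (use noncrossing pair_even pair_pred no_three assms in blast)+

lemma resolvable_without_TwoC:
  assumes "\<And>k. k \<in> {1..n} \<Longrightarrow> c k \<noteq> TwoC" shows "resolvable n b c"
  by (rule resolvableI) (use assms in auto)

text \<open>A position \<open>q\<close> in the block of a later position \<open>z\<close> is a separator if this block has no pair and all pairs lie
  before \<open>z\<close>: a pair around \<open>q\<close> would cross \<open>(q, z)\<close>.\<close>

lemma separatorI:
  assumes "even q" "2 \<le> q" "q < z" "z \<le> n" "c q \<in> {TwoA, TwoB}" "b q = b z"
    and unpaired: "\<And>i l. pair i l \<Longrightarrow> b z = b i \<Longrightarrow> False"
    and below: "\<And>i l. pair i l \<Longrightarrow> l < z"
  shows "separator n b c q"
  unfolding separator_def
proof (intro conjI allI impI)
  fix i l assume p: "pair i l"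
  note f = pair_facts[OF p]
  have ne: "b i \<noteq> b q" using unpaired[OF p] assms(6) by auto
  thus "i \<noteq> q" "l \<noteq> q" using f(5) by auto
  show "\<not> (i < q \<and> q < l)"
  proof
    assume "i < q \<and> q < l"
    hence "b i = b q" using noncrossing[of i q l z] below[OF p] f(1,5) assms(4,6) by simp
    thus False using ne by simp
  qed
qed (use assms in auto)

end

text \<open>The colors of the positions \<open>1, \<dots>, n\<close> after RECOLORING, \<open>p\<close> being the initial coloring.  The positions beyond
  \<open>4 \<lfloor>n / 4\<rfloor>\<close> are treated by the two cases.\<close>

definition base_color :: "nat \<Rightarrow> (nat \<Rightarrow> color) \<Rightarrow> nat \<Rightarrow> color" where
  "base_color n p k =
     (if odd k \<or> 4 * (n div 4) < k then p k else if k mod 4 = 2 then TwoA else TwoB)"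

definition case1_color :: "nat \<Rightarrow> (nat \<Rightarrow> color) \<Rightarrow> nat \<Rightarrow> color" where
  "case1_color n p = (if n mod 4 \<in> {2, 3} then (base_color n p)(n - 1 := TwoA) else base_color n p)"

definition case2_color :: "nat \<Rightarrow> (nat \<Rightarrow> color) \<Rightarrow> nat \<Rightarrow> color" where
  "case2_color n p =
     (if n mod 4 \<in> {1, 2} then (base_color n p)(n := TwoC)
      else if n mod 4 = 3 then (base_color n p)(n - 2 := TwoA, n := TwoB)
      else base_color n p)"

lemma base_color_iff:
  assumes "p k \<in> ones"
  shows "base_color n p k = TwoA \<longleftrightarrow> k mod 4 = 2 \<and> k \<le> 4 * (n div 4)"
    "base_color n p k = TwoB \<longleftrightarrow> k mod 4 = 0 \<and> k \<le> 4 * (n div 4)"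
    "base_color n p k \<noteq> TwoC"
    "base_color n p k = One \<or> base_color n p k = One' \<longleftrightarrow> odd k \<or> 4 * (n div 4) < k"
proof -
  have "p k \<noteq> TwoA" "p k \<noteq> TwoB" "p k \<noteq> TwoC" using assms by auto
  moreover have "even k \<Longrightarrow> k mod 4 = 0 \<or> k mod 4 = 2" "odd k \<Longrightarrow> k mod 4 \<noteq> 0 \<and> k mod 4 \<noteq> 2" by presburger+
  ultimately show "base_color n p k = TwoA \<longleftrightarrow> k mod 4 = 2 \<and> k \<le> 4 * (n div 4)"
    "base_color n p k = TwoB \<longleftrightarrow> k mod 4 = 0 \<and> k \<le> 4 * (n div 4)" "base_color n p k \<noteq> TwoC"
    "base_color n p k = One \<or> base_color n p k = One' \<longleftrightarrow> odd k \<or> 4 * (n div 4) < k"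
    using assms by (auto simp: base_color_def)
qed

text \<open>The assumptions of \<^locale>\<open>spaced\<close> that do not involve the blocks.\<close>

definition spread :: "nat \<Rightarrow> (nat \<Rightarrow> color) \<Rightarrow> nat \<Rightarrow> bool" where
  "spread n c e \<longleftrightarrow>
     (\<forall>k \<in> {1..n}. \<forall>l \<in> {1..n}. close n k l \<longrightarrow> c k \<notin> ones \<longrightarrow> c l \<notin> ones \<longrightarrow> c k \<noteq> c l) \<and>
     (\<forall>k. 1 \<le> k \<longrightarrow> k < n \<longrightarrow> c k \<notin> ones \<longrightarrow> c (k + 1) \<notin> ones \<longrightarrow> k = e) \<and> even e \<and> c 1 \<in> ones \<and>
     (\<forall>i l. odd i \<longrightarrow> 1 \<le> i \<longrightarrow> i < l \<longrightarrow> l \<le> n \<longrightarrow> c i \<notin> ones \<longrightarrow> c l \<noteq> c i)"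

text \<open>The conditions in terms of the sets of positions with the colors \<open>2\<^sub>a\<close>, \<open>2\<^sub>b\<close>, \<open>2\<^sub>c\<close>.\<close>

lemma spreadI:
  fixes A B D :: "nat \<Rightarrow> bool"
  assumes col: "\<And>k. k \<in> {1..n} \<Longrightarrow> (c k = TwoA \<longleftrightarrow> A k) \<and> (c k = TwoB \<longleftrightarrow> B k) \<and> (c k = TwoC \<longleftrightarrow> D k)"
    and far: "\<And>k l. \<lbrakk>1 \<le> k; k < l; l \<le> n; A k \<and> A l \<or> B k \<and> B l \<or> D k \<and> D l\<rbrakk> \<Longrightarrow> k + 2 < l \<and> l + 2 < n + k \<and> even k"
    and adj: "\<And>k. \<lbrakk>1 \<le> k; k < n; A k \<or> B k \<or> D k; A (k + 1) \<or> B (k + 1) \<or> D (k + 1)\<rbrakk> \<Longrightarrow> k = e"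
    and e: "even e" and one: "\<not> A 1" "\<not> B 1" "\<not> D 1" and n: "1 \<le> n"
  shows "spread n c e"
proof -
  have ones: "c k \<notin> ones \<longleftrightarrow> A k \<or> B k \<or> D k" if "k \<in> {1..n}" for k
    using col[OF that] by (cases "c k") auto
  have eq: "A k \<and> A l \<or> B k \<and> B l \<or> D k \<and> D l" if "k \<in> {1..n}" "l \<in> {1..n}" "c k = c l" "c k \<notin> ones" for k l
    using col[OF that(1)] col[OF that(2)] that(3,4) by (cases "c k") auto
  have far': "k + 2 < l \<and> l + 2 < n + k \<and> even k" if "1 \<le> k" "k < l" "l \<le> n" "c k = c l" "c k \<notin> ones" for k l
    using far[OF that(1-3) eq] that by simp
  have cl: "c k \<noteq> c l" if kl: "k \<in> {1..n}" "l \<in> {1..n}" "close n k l" "c k \<notin> ones" for k l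
  proof
    assume "c k = c l"
    have "k \<noteq> l" using kl(3) by (simp add: close_def)
    then consider "k < l" | "l < k" by linarith
    thus False
    proof cases
      case 1 thus False using far'[of k l] kl \<open>c k = c l\<close> by (auto simp: close_def)
    next
      case 2
      hence "l + 2 < k \<and> k + 2 < n + l" using far'[of l k] kl(1,2,4) \<open>c k = c l\<close> by simp
      thus False using kl(3) 2 by (auto simp: close_def)
    qed
  qed
  have adj': "k = e" if "1 \<le> k" "k < n" "c k \<notin> ones" "c (k + 1) \<notin> ones" for k
    using adj[OF that(1,2)] ones[of k] ones[of "k + 1"] that by simp
  have odd: "c l \<noteq> c i" if "odd i" "1 \<le> i" "i < l" "l \<le> n" "c i \<notin> ones" for i l
    using far'[of i l] that by force
  have "c 1 \<in> ones" using ones[of 1] one n by auto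
  thus ?thesis unfolding spread_def using cl adj' odd e by blast
qed

locale leaf_blocks =
  fixes n :: nat and b :: "nat \<Rightarrow> 'b"
  assumes noncrossing: "\<lbrakk>1 \<le> i; i < j; j < k; k < l; l \<le> n; b i = b k; b j = b l\<rbrakk> \<Longrightarrow> b i = b j"
    and no_three_apart: "\<lbrakk>1 \<le> p; p + 1 < q; q + 1 < r; r \<le> n; \<not> (p = 1 \<and> r = n); b q = b p; b r = b p\<rbrakk> \<Longrightarrow> False"
begin

lemma spacedI: "spread n c e \<Longrightarrow> spaced n b c e"
  unfolding spread_def by unfold_locales (use noncrossing no_three_apart in blast)+

end

text \<open>The positions to which RECOLORING gives the colors \<open>2\<^sub>a\<close> and \<open>2\<^sub>b\<close> periodically, for \<open>n = 4 q + r\<close>.  They are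
  kept behind constants so that only the bounds and gaps below, and no residues, reach the arithmetic.\<close>

definition posA :: "nat \<Rightarrow> nat \<Rightarrow> bool" where "posA q k \<longleftrightarrow> k mod 4 = 2 \<and> k \<le> 4 * q"
definition posB :: "nat \<Rightarrow> nat \<Rightarrow> bool" where "posB q k \<longleftrightarrow> k mod 4 = 0 \<and> 1 \<le> k \<and> k \<le> 4 * q"

lemma posA_bounds: "posA q k \<Longrightarrow> 2 \<le> k \<and> k + 2 \<le> 4 * q \<and> even k"
  unfolding posA_def by presburger

lemma posB_bounds: "posB q k \<Longrightarrow> 4 \<le> k \<and> k \<le> 4 * q \<and> even k"
  unfolding posB_def by presburger

lemma posA_gap: "posA q k \<Longrightarrow> posA q l \<Longrightarrow> k < l \<Longrightarrow> k + 4 \<le> l"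
  unfolding posA_def by presburger

lemma posB_gap: "posB q k \<Longrightarrow> posB q l \<Longrightarrow> k < l \<Longrightarrow> k + 4 \<le> l"
  unfolding posB_def by presburger

lemma posB_last: "1 \<le> q \<Longrightarrow> posB q (4 * q)"
  by (simp add: posB_def)

lemma posA_2: "1 \<le> q \<Longrightarrow> posA q 2"
  by (simp add: posA_def)

lemma base_color_cases:
  assumes "\<And>k. k \<in> {1..n} \<Longrightarrow> p k \<in> ones" "n = 4 * q + r" "r < 4" "k \<in> {1..n}"
  shows "(base_color n p k = TwoA \<longleftrightarrow> posA q k) \<and> (base_color n p k = TwoB \<longleftrightarrow> posB q k) \<and>
    base_color n p k \<noteq> TwoC"
  using base_color_iff[where p = p and k = k and n = n, OF assms(1)[OF assms(4)]] assms(2-4)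
  by (auto simp: posA_def posB_def)

lemma posA_odd: "odd k \<or> 4 * q < k \<Longrightarrow> \<not> posA q k"
  using posA_bounds[of q k] by auto

lemma posB_odd: "odd k \<or> 4 * q < k \<Longrightarrow> \<not> posB q k"
  using posB_bounds[of q k] by auto

text \<open>Case distinction by \<open>n mod 4\<close>.  The only exceptional couple is \<open>n - 2\<close>, \<open>n - 1\<close>, for remainder 2.\<close>

lemma spread_case1:
  assumes p: "\<And>k. k \<in> {1..n} \<Longrightarrow> p k \<in> ones" and n: "3 \<le> n"
  shows "\<exists>e. spread n (case1_color n p) e"
proof -
  obtain q r where qr: "n = 4 * q + r" "r < 4" by (metis mod_less_divisor mult_div_mod_eq zero_less_numeral)
  have r: "n mod 4 = r" using qr by simp
  have base: "(base_color n p k = TwoA \<longleftrightarrow> posA q k) \<and> (base_color n p k = TwoB \<longleftrightarrow> posB q k) \<and>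
    base_color n p k \<noteq> TwoC" if "k \<in> {1..n}" for k
    using base_color_cases[where p = p and n = n, OF p qr that] by simp
  consider "r = 0" | "r = 1" | "r = 2" | "r = 3" using qr(2) by linarith
  thus ?thesis
  proof cases
    case 1
    have shape: "case1_color n p = base_color n p" using r 1 by (simp add: case1_color_def)
    show ?thesis unfolding shape
    proof (rule exI[of _ "0"], rule spreadI[where A = "\<lambda>k. posA q k" and B = "\<lambda>k. posB q k" and D = "\<lambda>k. False"])
      fix k assume "k \<in> {1..n}"
      thus "((base_color n p) k = TwoA \<longleftrightarrow> posA q k) \<and> ((base_color n p) k = TwoB \<longleftrightarrow> posB q k) \<and> ((base_color n p) k = TwoC \<longleftrightarrow> False)"
        using base[of k] posA_odd[of k q] posB_odd[of k q] by (auto simp: qr(1) 1)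
    next
      fix k l assume "1 \<le> k" "k < l" "l \<le> n" "(posA q k) \<and> (posA q l) \<or> (posB q k) \<and> (posB q l) \<or> (False) \<and> (False)"
      thus "k + 2 < l \<and> l + 2 < n + k \<and> even k"
        using posA_bounds[of q k] posA_bounds[of q l] posB_bounds[of q k] posB_bounds[of q l]
          posA_gap[of q k l] posB_gap[of q k l] qr(1) 1 n by auto
    next
      fix k assume "1 \<le> k" "k < n" "(posA q k) \<or> (posB q k) \<or> (False)" "(posA q (k + 1)) \<or> (posB q (k + 1)) \<or> (False)"
      thus "k = 0"
        using posA_bounds[of q k] posA_bounds[of q "k + 1"] posB_bounds[of q k] posB_bounds[of q "k + 1"] qr(1) 1 n by auto
    qed (use posA_bounds[of q 1] posB_bounds[of q 1] qr 1 n in auto)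
  next
    case 2
    have shape: "case1_color n p = base_color n p" using r 2 by (simp add: case1_color_def)
    show ?thesis unfolding shape
    proof (rule exI[of _ "0"], rule spreadI[where A = "\<lambda>k. posA q k" and B = "\<lambda>k. posB q k" and D = "\<lambda>k. False"])
      fix k assume "k \<in> {1..n}"
      thus "((base_color n p) k = TwoA \<longleftrightarrow> posA q k) \<and> ((base_color n p) k = TwoB \<longleftrightarrow> posB q k) \<and> ((base_color n p) k = TwoC \<longleftrightarrow> False)"
        using base[of k] posA_odd[of k q] posB_odd[of k q] by (auto simp: qr(1) 2)
    next
      fix k l assume "1 \<le> k" "k < l" "l \<le> n" "(posA q k) \<and> (posA q l) \<or> (posB q k) \<and> (posB q l) \<or> (False) \<and> (False)"
      thus "k + 2 < l \<and> l + 2 < n + k \<and> even k"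
        using posA_bounds[of q k] posA_bounds[of q l] posB_bounds[of q k] posB_bounds[of q l]
          posA_gap[of q k l] posB_gap[of q k l] qr(1) 2 n by auto
    next
      fix k assume "1 \<le> k" "k < n" "(posA q k) \<or> (posB q k) \<or> (False)" "(posA q (k + 1)) \<or> (posB q (k + 1)) \<or> (False)"
      thus "k = 0"
        using posA_bounds[of q k] posA_bounds[of q "k + 1"] posB_bounds[of q k] posB_bounds[of q "k + 1"] qr(1) 2 n by auto
    qed (use posA_bounds[of q 1] posB_bounds[of q 1] qr 2 n in auto)
  next
    case 3
    have shape: "case1_color n p = (base_color n p)(n - 1 := TwoA)" using r 3 by (simp add: case1_color_def)
    show ?thesis unfolding shape
    proof (rule exI[of _ "4 * q"], rule spreadI[where A = "\<lambda>k. posA q k \<or> k = 4 * q + 1" and B = "\<lambda>k. posB q k" and D = "\<lambda>k. False"])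
      fix k assume "k \<in> {1..n}"
      thus "(((base_color n p)(n - 1 := TwoA)) k = TwoA \<longleftrightarrow> posA q k \<or> k = 4 * q + 1) \<and> (((base_color n p)(n - 1 := TwoA)) k = TwoB \<longleftrightarrow> posB q k) \<and> (((base_color n p)(n - 1 := TwoA)) k = TwoC \<longleftrightarrow> False)"
        using base[of k] posA_odd[of k q] posB_odd[of k q] by (auto simp: qr(1) 3)
    next
      fix k l assume "1 \<le> k" "k < l" "l \<le> n" "(posA q k \<or> k = 4 * q + 1) \<and> (posA q l \<or> l = 4 * q + 1) \<or> (posB q k) \<and> (posB q l) \<or> (False) \<and> (False)"
      thus "k + 2 < l \<and> l + 2 < n + k \<and> even k"
        using posA_bounds[of q k] posA_bounds[of q l] posB_bounds[of q k] posB_bounds[of q l]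
          posA_gap[of q k l] posB_gap[of q k l] qr(1) 3 n by auto
    next
      fix k assume "1 \<le> k" "k < n" "(posA q k \<or> k = 4 * q + 1) \<or> (posB q k) \<or> (False)" "(posA q (k + 1) \<or> (k + 1) = 4 * q + 1) \<or> (posB q (k + 1)) \<or> (False)"
      thus "k = 4 * q"
        using posA_bounds[of q k] posA_bounds[of q "k + 1"] posB_bounds[of q k] posB_bounds[of q "k + 1"] qr(1) 3 n by auto
    qed (use posA_bounds[of q 1] posB_bounds[of q 1] qr 3 n in auto)
  next
    case 4
    have shape: "case1_color n p = (base_color n p)(n - 1 := TwoA)" using r 4 by (simp add: case1_color_def)
    show ?thesis unfolding shape
    proof (rule exI[of _ "0"], rule spreadI[where A = "\<lambda>k. posA q k \<or> k = 4 * q + 2" and B = "\<lambda>k. posB q k" and D = "\<lambda>k. False"])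
      fix k assume "k \<in> {1..n}"
      thus "(((base_color n p)(n - 1 := TwoA)) k = TwoA \<longleftrightarrow> posA q k \<or> k = 4 * q + 2) \<and> (((base_color n p)(n - 1 := TwoA)) k = TwoB \<longleftrightarrow> posB q k) \<and> (((base_color n p)(n - 1 := TwoA)) k = TwoC \<longleftrightarrow> False)"
        using base[of k] posA_odd[of k q] posB_odd[of k q] by (auto simp: qr(1) 4)
    next
      fix k l assume "1 \<le> k" "k < l" "l \<le> n" "(posA q k \<or> k = 4 * q + 2) \<and> (posA q l \<or> l = 4 * q + 2) \<or> (posB q k) \<and> (posB q l) \<or> (False) \<and> (False)"
      thus "k + 2 < l \<and> l + 2 < n + k \<and> even k"
        using posA_bounds[of q k] posA_bounds[of q l] posB_bounds[of q k] posB_bounds[of q l]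
          posA_gap[of q k l] posB_gap[of q k l] qr(1) 4 n by auto
    next
      fix k assume "1 \<le> k" "k < n" "(posA q k \<or> k = 4 * q + 2) \<or> (posB q k) \<or> (False)" "(posA q (k + 1) \<or> (k + 1) = 4 * q + 2) \<or> (posB q (k + 1)) \<or> (False)"
      thus "k = 0"
        using posA_bounds[of q k] posA_bounds[of q "k + 1"] posB_bounds[of q k] posB_bounds[of q "k + 1"] qr(1) 4 n by auto
    qed (use posA_bounds[of q 1] posB_bounds[of q 1] qr 4 n in auto)
  qed
qed

text \<open>The exceptional couples are \<open>n - 1\<close>, \<open>n\<close> for remainder 1 and \<open>n - 3\<close>, \<open>n - 2\<close> for remainder 3.\<close>

lemma spread_case2:
  assumes p: "\<And>k. k \<in> {1..n} \<Longrightarrow> p k \<in> ones" and n: "4 \<le> n"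
  shows "\<exists>e. spread n (case2_color n p) e"
proof -
  obtain q r where qr: "n = 4 * q + r" "r < 4" by (metis mod_less_divisor mult_div_mod_eq zero_less_numeral)
  have r: "n mod 4 = r" using qr by simp
  have base: "(base_color n p k = TwoA \<longleftrightarrow> posA q k) \<and> (base_color n p k = TwoB \<longleftrightarrow> posB q k) \<and>
    base_color n p k \<noteq> TwoC" if "k \<in> {1..n}" for k
    using base_color_cases[where p = p and n = n, OF p qr that] by simp
  consider "r = 0" | "r = 1" | "r = 2" | "r = 3" using qr(2) by linarith
  thus ?thesis
  proof cases
    case 1
    have shape: "case2_color n p = base_color n p" using r 1 by (simp add: case2_color_def)
    show ?thesis unfolding shape
    proof (rule exI[of _ "0"], rule spreadI[where A = "\<lambda>k. posA q k" and B = "\<lambda>k. posB q k" and D = "\<lambda>k. False"])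
      fix k assume "k \<in> {1..n}"
      thus "((base_color n p) k = TwoA \<longleftrightarrow> posA q k) \<and> ((base_color n p) k = TwoB \<longleftrightarrow> posB q k) \<and> ((base_color n p) k = TwoC \<longleftrightarrow> False)"
        using base[of k] posA_odd[of k q] posB_odd[of k q] by (auto simp: qr(1) 1)
    next
      fix k l assume "1 \<le> k" "k < l" "l \<le> n" "(posA q k) \<and> (posA q l) \<or> (posB q k) \<and> (posB q l) \<or> (False) \<and> (False)"
      thus "k + 2 < l \<and> l + 2 < n + k \<and> even k"
        using posA_bounds[of q k] posA_bounds[of q l] posB_bounds[of q k] posB_bounds[of q l]
          posA_gap[of q k l] posB_gap[of q k l] qr(1) 1 n by auto
    next
      fix k assume "1 \<le> k" "k < n" "(posA q k) \<or> (posB q k) \<or> (False)" "(posA q (k + 1)) \<or> (posB q (k + 1)) \<or> (False)"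
      thus "k = 0"
        using posA_bounds[of q k] posA_bounds[of q "k + 1"] posB_bounds[of q k] posB_bounds[of q "k + 1"] qr(1) 1 n by auto
    qed (use posA_bounds[of q 1] posB_bounds[of q 1] qr 1 n in auto)
  next
    case 2
    have shape: "case2_color n p = (base_color n p)(n := TwoC)" using r 2 by (simp add: case2_color_def)
    show ?thesis unfolding shape
    proof (rule exI[of _ "4 * q"], rule spreadI[where A = "\<lambda>k. posA q k" and B = "\<lambda>k. posB q k" and D = "\<lambda>k. k = 4 * q + 1"])
      fix k assume "k \<in> {1..n}"
      thus "(((base_color n p)(n := TwoC)) k = TwoA \<longleftrightarrow> posA q k) \<and> (((base_color n p)(n := TwoC)) k = TwoB \<longleftrightarrow> posB q k) \<and> (((base_color n p)(n := TwoC)) k = TwoC \<longleftrightarrow> k = 4 * q + 1)"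
        using base[of k] posA_odd[of k q] posB_odd[of k q] by (auto simp: qr(1) 2)
    next
      fix k l assume "1 \<le> k" "k < l" "l \<le> n" "(posA q k) \<and> (posA q l) \<or> (posB q k) \<and> (posB q l) \<or> (k = 4 * q + 1) \<and> (l = 4 * q + 1)"
      thus "k + 2 < l \<and> l + 2 < n + k \<and> even k"
        using posA_bounds[of q k] posA_bounds[of q l] posB_bounds[of q k] posB_bounds[of q l]
          posA_gap[of q k l] posB_gap[of q k l] qr(1) 2 n by auto
    next
      fix k assume "1 \<le> k" "k < n" "(posA q k) \<or> (posB q k) \<or> (k = 4 * q + 1)" "(posA q (k + 1)) \<or> (posB q (k + 1)) \<or> ((k + 1) = 4 * q + 1)"
      thus "k = 4 * q"
        using posA_bounds[of q k] posA_bounds[of q "k + 1"] posB_bounds[of q k] posB_bounds[of q "k + 1"] qr(1) 2 n by auto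
    qed (use posA_bounds[of q 1] posB_bounds[of q 1] qr 2 n in auto)
  next
    case 3
    have shape: "case2_color n p = (base_color n p)(n := TwoC)" using r 3 by (simp add: case2_color_def)
    show ?thesis unfolding shape
    proof (rule exI[of _ "0"], rule spreadI[where A = "\<lambda>k. posA q k" and B = "\<lambda>k. posB q k" and D = "\<lambda>k. k = 4 * q + 2"])
      fix k assume "k \<in> {1..n}"
      thus "(((base_color n p)(n := TwoC)) k = TwoA \<longleftrightarrow> posA q k) \<and> (((base_color n p)(n := TwoC)) k = TwoB \<longleftrightarrow> posB q k) \<and> (((base_color n p)(n := TwoC)) k = TwoC \<longleftrightarrow> k = 4 * q + 2)"
        using base[of k] posA_odd[of k q] posB_odd[of k q] by (auto simp: qr(1) 3)
    next
      fix k l assume "1 \<le> k" "k < l" "l \<le> n" "(posA q k) \<and> (posA q l) \<or> (posB q k) \<and> (posB q l) \<or> (k = 4 * q + 2) \<and> (l = 4 * q + 2)"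
      thus "k + 2 < l \<and> l + 2 < n + k \<and> even k"
        using posA_bounds[of q k] posA_bounds[of q l] posB_bounds[of q k] posB_bounds[of q l]
          posA_gap[of q k l] posB_gap[of q k l] qr(1) 3 n by auto
    next
      fix k assume "1 \<le> k" "k < n" "(posA q k) \<or> (posB q k) \<or> (k = 4 * q + 2)" "(posA q (k + 1)) \<or> (posB q (k + 1)) \<or> ((k + 1) = 4 * q + 2)"
      thus "k = 0"
        using posA_bounds[of q k] posA_bounds[of q "k + 1"] posB_bounds[of q k] posB_bounds[of q "k + 1"] qr(1) 3 n by auto
    qed (use posA_bounds[of q 1] posB_bounds[of q 1] qr 3 n in auto)
  next
    case 4
    have shape: "case2_color n p = (base_color n p)(n - 2 := TwoA, n := TwoB)" using r 4 by (simp add: case2_color_def)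
    show ?thesis unfolding shape
    proof (rule exI[of _ "4 * q"], rule spreadI[where A = "\<lambda>k. posA q k \<or> k = 4 * q + 1" and B = "\<lambda>k. posB q k \<or> k = 4 * q + 3" and D = "\<lambda>k. False"])
      fix k assume "k \<in> {1..n}"
      thus "(((base_color n p)(n - 2 := TwoA, n := TwoB)) k = TwoA \<longleftrightarrow> posA q k \<or> k = 4 * q + 1) \<and> (((base_color n p)(n - 2 := TwoA, n := TwoB)) k = TwoB \<longleftrightarrow> posB q k \<or> k = 4 * q + 3) \<and> (((base_color n p)(n - 2 := TwoA, n := TwoB)) k = TwoC \<longleftrightarrow> False)"
        using base[of k] posA_odd[of k q] posB_odd[of k q] by (auto simp: qr(1) 4)
    next
      fix k l assume "1 \<le> k" "k < l" "l \<le> n" "(posA q k \<or> k = 4 * q + 1) \<and> (posA q l \<or> l = 4 * q + 1) \<or> (posB q k \<or> k = 4 * q + 3) \<and> (posB q l \<or> l = 4 * q + 3) \<or> (False) \<and> (False)"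
      thus "k + 2 < l \<and> l + 2 < n + k \<and> even k"
        using posA_bounds[of q k] posA_bounds[of q l] posB_bounds[of q k] posB_bounds[of q l]
          posA_gap[of q k l] posB_gap[of q k l] qr(1) 4 n by auto
    next
      fix k assume "1 \<le> k" "k < n" "(posA q k \<or> k = 4 * q + 1) \<or> (posB q k \<or> k = 4 * q + 3) \<or> (False)" "(posA q (k + 1) \<or> (k + 1) = 4 * q + 1) \<or> (posB q (k + 1) \<or> (k + 1) = 4 * q + 3) \<or> (False)"
      thus "k = 4 * q"
        using posA_bounds[of q k] posA_bounds[of q "k + 1"] posB_bounds[of q k] posB_bounds[of q "k + 1"] qr(1) 4 n by auto
    qed (use posA_bounds[of q 1] posB_bounds[of q 1] qr 4 n in auto)
  qed
qed

text \<open>The modifications (i) and (ii) of CASE-2 on positions.\<close>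

definition swap_i :: "nat \<Rightarrow> (nat \<Rightarrow> 'b) \<Rightarrow> (nat \<Rightarrow> color) \<Rightarrow> nat \<Rightarrow> color" where
  "swap_i n b c =
     (if c n = TwoC \<and>
         (\<exists>i \<in> {1..n - 2}. c (n - 1) = TwoB \<and> c i = TwoB \<and> b n = b (n - 1) \<and> b (n - 1) = b i)
      then c(2 := TwoC, n - 1 := TwoC, n := TwoA) else c)"

definition swap_ii :: "nat \<Rightarrow> (nat \<Rightarrow> 'b) \<Rightarrow> (nat \<Rightarrow> color) \<Rightarrow> nat \<Rightarrow> color" where
  "swap_ii n b c =
     (if c n = TwoC \<and> \<not> (\<exists>i \<in> {1..n - 1}. c i \<in> {TwoA, TwoB} \<and> b i = b n) \<and>
         (\<exists>i \<in> {4..n - 1}. c i = TwoA \<and> b i = b 2)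
      then c(2 := TwoC, n := TwoA) else c)"

text \<open>Modification (i) occurs for remainder 1 only, and not for \<open>n = 5\<close>, where the colors \<open>2\<^sub>c\<close> at \<open>2\<close> and \<open>n - 1\<close>
  would be close.\<close>

lemma spread_swap_i:
  assumes p: "\<And>k. k \<in> {1..n} \<Longrightarrow> p k \<in> ones" and n: "n = 4 * q + 1" "2 \<le> q"
  shows "spread n ((case2_color n p)(2 := TwoC, n - 1 := TwoC, n := TwoA)) (4 * q)"
proof -
  have base: "(base_color n p k = TwoA \<longleftrightarrow> posA q k) \<and> (base_color n p k = TwoB \<longleftrightarrow> posB q k) \<and>
    base_color n p k \<noteq> TwoC" if "k \<in> {1..n}" for k
    using base_color_cases[where p = p and n = n, OF p n(1) _ that] by simp
  have shape: "case2_color n p = (base_color n p)(n := TwoC)" using n by (simp add: case2_color_def)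
  show ?thesis unfolding shape
  proof (rule spreadI[where A = "\<lambda>k. posA q k \<and> k \<noteq> 2 \<or> k = 4 * q + 1" and B = "\<lambda>k. posB q k \<and> k \<noteq> 4 * q"
        and D = "\<lambda>k. k = 2 \<or> k = 4 * q"])
    fix k assume "k \<in> {1..n}"
    thus "(((base_color n p)(n := TwoC, 2 := TwoC, n - 1 := TwoC, n := TwoA)) k = TwoA \<longleftrightarrow> posA q k \<and> k \<noteq> 2 \<or> k = 4 * q + 1) \<and>
      (((base_color n p)(n := TwoC, 2 := TwoC, n - 1 := TwoC, n := TwoA)) k = TwoB \<longleftrightarrow> posB q k \<and> k \<noteq> 4 * q) \<and>
      (((base_color n p)(n := TwoC, 2 := TwoC, n - 1 := TwoC, n := TwoA)) k = TwoC \<longleftrightarrow> k = 2 \<or> k = 4 * q)"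
      using base[of k] posA_odd[of k q] posB_odd[of k q] posB_bounds[of q 2] posA_bounds[of q "4 * q"] n by auto
  next
    fix k l assume "1 \<le> k" "k < l" "l \<le> n"
      "(posA q k \<and> k \<noteq> 2 \<or> k = 4 * q + 1) \<and> (posA q l \<and> l \<noteq> 2 \<or> l = 4 * q + 1) \<or>
       (posB q k \<and> k \<noteq> 4 * q) \<and> (posB q l \<and> l \<noteq> 4 * q) \<or> (k = 2 \<or> k = 4 * q) \<and> (l = 2 \<or> l = 4 * q)"
    thus "k + 2 < l \<and> l + 2 < n + k \<and> even k"
      using posA_bounds[of q k] posA_bounds[of q l] posB_bounds[of q k] posB_bounds[of q l]
        posA_gap[of q k l] posB_gap[of q k l] n by auto
  next
    fix k assume "1 \<le> k" "k < n"
      "(posA q k \<and> k \<noteq> 2 \<or> k = 4 * q + 1) \<or> (posB q k \<and> k \<noteq> 4 * q) \<or> (k = 2 \<or> k = 4 * q)"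
      "(posA q (k + 1) \<and> (k + 1) \<noteq> 2 \<or> (k + 1) = 4 * q + 1) \<or> (posB q (k + 1) \<and> (k + 1) \<noteq> 4 * q) \<or> ((k + 1) = 2 \<or> (k + 1) = 4 * q)"
    moreover have "k + 1 = 4 * q \<Longrightarrow> odd k" by presburger
    ultimately show "k = 4 * q"
      using posA_bounds[of q k] posA_bounds[of q "k + 1"] posB_bounds[of q k] posB_bounds[of q "k + 1"] n by auto
  qed (use posA_bounds[of q 1] posB_bounds[of q 1] n in auto)
qed

lemma spread_swap_ii:
  assumes p: "\<And>k. k \<in> {1..n} \<Longrightarrow> p k \<in> ones" and n: "n = 4 * q + r" "1 \<le> q" "r = 1 \<or> r = 2"
  shows "spread n ((case2_color n p)(2 := TwoC, n := TwoA)) (if r = 1 then 4 * q else 0)"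
proof -
  have base: "(base_color n p k = TwoA \<longleftrightarrow> posA q k) \<and> (base_color n p k = TwoB \<longleftrightarrow> posB q k) \<and>
    base_color n p k \<noteq> TwoC" if "k \<in> {1..n}" for k
    using base_color_cases[where p = p and n = n, OF p n(1) _ that] n(3) by auto
  have shape: "case2_color n p = (base_color n p)(n := TwoC)" using n by (auto simp: case2_color_def)
  show ?thesis unfolding shape
  proof (rule spreadI[where A = "\<lambda>k. posA q k \<and> k \<noteq> 2 \<or> k = n" and B = "\<lambda>k. posB q k"
        and D = "\<lambda>k. k = 2"])
    fix k assume "k \<in> {1..n}"
    thus "(((base_color n p)(n := TwoC, 2 := TwoC, n := TwoA)) k = TwoA \<longleftrightarrow> posA q k \<and> k \<noteq> 2 \<or> k = n) \<and>
      (((base_color n p)(n := TwoC, 2 := TwoC, n := TwoA)) k = TwoB \<longleftrightarrow> posB q k) \<and>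
      (((base_color n p)(n := TwoC, 2 := TwoC, n := TwoA)) k = TwoC \<longleftrightarrow> k = 2)"
      using base[of k] posA_odd[of k q] posB_odd[of k q] posB_bounds[of q 2] n by auto
  next
    fix k l assume "1 \<le> k" "k < l" "l \<le> n"
      "(posA q k \<and> k \<noteq> 2 \<or> k = n) \<and> (posA q l \<and> l \<noteq> 2 \<or> l = n) \<or> posB q k \<and> posB q l \<or> k = 2 \<and> l = 2"
    thus "k + 2 < l \<and> l + 2 < n + k \<and> even k"
      using posA_bounds[of q k] posA_bounds[of q l] posB_bounds[of q k] posB_bounds[of q l]
        posA_gap[of q k l] posA_gap[of q 2 k] posA_2[of q] posB_gap[of q k l] n by auto
  next
    fix k assume "1 \<le> k" "k < n" "(posA q k \<and> k \<noteq> 2 \<or> k = n) \<or> posB q k \<or> k = 2"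
      "(posA q (k + 1) \<and> (k + 1) \<noteq> 2 \<or> (k + 1) = n) \<or> posB q (k + 1) \<or> (k + 1) = 2"
    thus "k = (if r = 1 then 4 * q else 0)"
      using posA_bounds[of q k] posA_bounds[of q "k + 1"] posB_bounds[of q k] posB_bounds[of q "k + 1"] n by auto
  qed (use posA_bounds[of q 1] posB_bounds[of q 1] n in auto)
qed

context leaf_blocks begin

lemma case1_resolvable:
  assumes p: "\<And>k. k \<in> {1..n} \<Longrightarrow> p k \<in> ones" and n: "3 \<le> n"
  shows "resolvable n b (case1_color n p)"
proof -
  obtain e where "spread n (case1_color n p) e" using spread_case1[of n p] p n by blast
  then interpret spaced n b "case1_color n p" e by (rule spacedI)
  show ?thesis
  proof (rule resolvable_without_TwoC)
    fix k assume "k \<in> {1..n}"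
    hence "base_color n p k \<noteq> TwoC" using base_color_iff(3) p by blast
    thus "case1_color n p k \<noteq> TwoC" by (simp add: case1_color_def)
  qed
qed

lemma case2_resolvable_03:
  assumes p: "\<And>k. k \<in> {1..n} \<Longrightarrow> p k \<in> ones" and n: "4 \<le> n" "n mod 4 \<notin> {1, 2}"
  shows "resolvable n b (case2_color n p)"
proof -
  obtain e where "spread n (case2_color n p) e" using spread_case2[of n p] p n by blast
  then interpret spaced n b "case2_color n p" e by (rule spacedI)
  show ?thesis
  proof (rule resolvable_without_TwoC)
    fix k assume "k \<in> {1..n}"
    hence "base_color n p k \<noteq> TwoC" using base_color_iff(3) p by blast
    thus "case2_color n p k \<noteq> TwoC" using n by (simp add: case2_color_def)
  qed
qed

text \<open>For \<open>n = 3\<close> position \<open>1\<close> has a color of radius 2, but the two such colors differ and there is no pair.\<close>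

lemma case2_resolvable_3:
  assumes p: "\<And>k. k \<in> {1..n} \<Longrightarrow> p k \<in> ones" and n: "n = 3"
  shows "resolvable n b (case2_color n p)"
proof -
  have c: "case2_color n p = (base_color n p)(1 := TwoA, 3 := TwoB)" unfolding n by (simp add: case2_color_def)
  have 2: "case2_color n p 2 \<in> ones" using p[of 2] unfolding c by (simp add: base_color_def n)
  have k: "k = 1 \<or> k = 2 \<or> k = 3" if "k \<in> {1..n}" for k using that n by auto
  have no: "\<not> conflict_pair n b (case2_color n p) i l" for i l
  proof
    assume *: "conflict_pair n b (case2_color n p) i l"
    hence "i < l" "i \<in> {1..n}" "l \<in> {1..n}" "case2_color n p i = case2_color n p l" "case2_color n p i \<in> {TwoA, TwoB}"
      by (auto simp: conflict_pair_def)
    thus False using k[of i] k[of l] 2 by (auto simp: c)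
  qed
  have noC: "case2_color n p k \<noteq> TwoC" if "k \<in> {1..n}" for k using k[OF that] 2 by (auto simp: c)
  show ?thesis
  proof
    show "case2_color n p i \<noteq> case2_color n p l" if "i \<in> {1..n}" "l \<in> {1..n}" "close n i l"
      "case2_color n p i \<notin> ones" "case2_color n p l \<notin> ones" for i l
      using k[OF that(1)] k[OF that(2)] that(3-5) 2 by (auto simp: c close_def)
    show "case2_color n p i \<in> ones \<or> case2_color n p (i + 1) \<in> ones \<or> case2_color n p (i + 2) \<in> ones"
      if "1 \<le> i" "i + 2 \<le> n" for i
    proof -
      have "i + 1 = 2" using that n by simp
      thus ?thesis using 2 by metis
    qed
  qed (use noncrossing no noC in blast)+
qed

text \<open>Here CASE-2 puts \<open>2\<^sub>c\<close> at position \<open>n\<close>.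

  If modification (i) applies, the block of \<open>n\<close> contains \<open>n - 1\<close> and a position \<open>s\<close> with color \<open>2\<^sub>b\<close>.  It cannot
  contain a further color of radius 2, so it has no pair after the modification, and \<open>s\<close> is a separator for the
  new \<open>2\<^sub>c\<close> at \<open>n - 1\<close>.  If modification (ii) applies, the new \<open>2\<^sub>a\<close> at \<open>n\<close> is the only color of radius 2 in its
  block.  If neither applies, the block of \<open>n\<close> has no pair, because the pair would have to contain \<open>n - 1\<close> and
  trigger (i); and either this block has some other \<open>2\<^sub>a\<close> or \<open>2\<^sub>b\<close>, which is a separator, or position \<open>2\<close>
  is in no pair, since otherwise (ii) would apply, and is a separator.\<close>

lemma TwoC_last_resolvable:
  assumes p: "\<And>k. k \<in> {1..n} \<Longrightarrow> p k \<in> ones" and n: "4 \<le> n" "n mod 4 \<in> {1, 2}"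
  shows "resolvable n b (swap_ii n b (swap_i n b (case2_color n p)))"
proof -
  define c where "c = case2_color n p"
  obtain q r where qr: "n = 4 * q + r" "r = 1 \<or> r = 2"
    by (metis n(2) insertE mult_div_mod_eq singletonD)
  have q1: "1 \<le> q" using n(1) qr by auto
  have base: "(base_color n p k = TwoA \<longleftrightarrow> posA q k) \<and> (base_color n p k = TwoB \<longleftrightarrow> posB q k) \<and>
    base_color n p k \<noteq> TwoC" if "k \<in> {1..n}" for k
    using base_color_cases[where p = p and n = n, OF p qr(1) _ that] qr(2) by auto
  have c: "c = (base_color n p)(n := TwoC)" using n by (auto simp: c_def case2_color_def)
  have cn: "c n = TwoC" by (simp add: c)
  have cA: "c k = TwoA \<longleftrightarrow> posA q k" if "k \<in> {1..n}" "k \<noteq> n" for k using base[OF that(1)] that by (simp add: c)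
  have cB: "c k = TwoB \<longleftrightarrow> posB q k" if "k \<in> {1..n}" "k \<noteq> n" for k using base[OF that(1)] that by (simp add: c)
  have cC: "c k = TwoC \<longleftrightarrow> k = n" if "k \<in> {1..n}" for k using base[OF that] by (simp add: c)
  have two: "c 2 = TwoA" using cA[of 2] posA_2[OF q1] qr q1 by auto
  show ?thesis
  proof (cases "\<exists>i \<in> {1..n - 2}. c (n - 1) = TwoB \<and> c i = TwoB \<and> b n = b (n - 1) \<and> b (n - 1) = b i")
    case True
    then obtain s where s: "s \<in> {1..n - 2}" "c (n - 1) = TwoB" "c s = TwoB" "b n = b (n - 1)" "b (n - 1) = b s" by blast
    define d where "d = c(2 := TwoC, n - 1 := TwoC, n := TwoA)"
    have "swap_i n b c = d" using True cn unfolding swap_i_def d_def by auto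
    moreover have "swap_ii n b d = d" by (simp add: swap_ii_def d_def)
    ultimately have eq: "swap_ii n b (swap_i n b (case2_color n p)) = d" by (simp add: c_def)
    have sB: "posB q s" using cB[of s] s(1,3) by auto
    have "posB q (n - 1)" using cB[of "n - 1"] s(2) n(1) by auto
    hence r1: "r = 1" using posB_bounds[of q "n - 1"] qr by auto
    have q2: "2 \<le> q"
    proof (rule ccontr)
      assume "\<not> 2 \<le> q"
      hence "n = 5" using q1 qr r1 by simp
      thus False using posB_bounds[OF sB] s(1) by simp
    qed
    interpret spaced n b d "4 * q"
      unfolding d_def c_def by (rule spacedI, rule spread_swap_i) (use p qr r1 q2 in auto)
    have nn: "n - 1 = 4 * q" "n = 4 * q + 1" "n \<noteq> 2" using qr r1 q2 by auto
    have s': "s \<noteq> 2" "s < n - 1" "2 < s" "even s" using posB_bounds[OF sB] s(1) nn by auto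
    have d: "d 2 = TwoC" "d (n - 1) = TwoC" "d n = TwoA" "d s = TwoB" using s s' nn by (auto simp: d_def)
    have dC: "d k = TwoC \<longleftrightarrow> k = 2 \<or> k = n - 1" if "k \<in> {1..n}" for k
      using cC[OF that] nn by (auto simp: d_def)
    have bs: "b n = b s" "b (n - 1) = b s" using s by auto
    have in_range: "2 \<in> {1..n}" "s \<in> {1..n}" "n - 1 \<in> {1..n}" "n \<in> {1..n}" using s(1) nn q2 by auto
    have U: "u \<in> {1..n} \<and> d u \<notin> ones \<and> b u = b s" if "u \<in> {s, n - 1, n}" for u
      using that d bs in_range by auto
    have no_pair: False if "conflict_pair n b d i l" "z \<in> {1..n}" "d z = TwoC" "b z = b i" for i l z
    proof -
      note f = pair_facts[OF that(1)]
      have z: "z = 4 * q \<and> (i = 4 * q + 1 \<or> l = 4 * q + 1) \<or> z = 4 * q + 1 \<and> (i = 4 * q \<or> l = 4 * q)"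
        by (rule TwoC_with_pair[OF that])
      have "z \<noteq> 4 * q + 1" using that(3) d(3) nn(2) by auto
      hence z: "z = n - 1" "i = n \<or> l = n" using z nn by auto
      hence l: "l = n" using f(2,3) by auto
      have i: "d i = TwoA" using f(6) l d(3) by simp
      have "b i = b s" using that(4) unfolding z(1) bs(2) by (rule sym)
      hence V: "u \<in> {1..n} \<and> d u \<notin> ones \<and> b u = b s" if "u \<in> {i, s, n - 1}" for u
        using that f(1,8) U by blast
      have "i \<noteq> s" "s \<noteq> n - 1" "i \<noteq> n - 1" using i d(2,4) s'(2) by auto
      hence "4 * q + 1 \<in> {i, s, n - 1}"
        using three_of_block(2)[of "{i, s, n - 1}" "b s" i s "n - 1"] V by blast
      thus False using s' nn f(3) l by auto
    qed
    have last: "\<not> conflict_pair n b d i n" for i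
    proof
      assume *: "conflict_pair n b d i n"
      show False using no_pair[OF * in_range(3) d(2)] pair_facts(5)[OF *] s(4) by simp
    qed
    have "resolvable n b d"
    proof (rule resolvableI)
      show False if "conflict_pair n b d i l" "z \<in> {1..n}" "d z = TwoC" "b z = b i" for i l z
        using no_pair that .
      have b2: "b 2 \<noteq> b (n - 1)"
      proof
        assume "b 2 = b (n - 1)"
        hence "2 \<in> {1..n} \<and> d 2 \<notin> ones \<and> b 2 = b s" using d(1) in_range(1) bs(2) by simp
        hence V: "u \<in> {1..n} \<and> d u \<notin> ones \<and> b u = b s" if "u \<in> {2, s, n - 1}" for u
          using that U by blast
        have "2 \<noteq> s" "s \<noteq> n - 1" "2 \<noteq> n - 1" using s' by auto
        hence "4 * q + 1 \<in> {2, s, n - 1}"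
          using three_of_block(2)[of "{2, s, n - 1}" "b s" 2 s "n - 1"] V by blast
        thus False using s' nn by auto
      qed
      show "y = z" if "y \<in> {1..n}" "z \<in> {1..n}" "d y = TwoC" "d z = TwoC" "b y = b z" for y z
        using dC[OF that(1)] dC[OF that(2)] that(3-5) b2 by auto
      have "{k \<in> {1..n}. d k = TwoC} = {2, n - 1}" using dC in_range by auto
      moreover have "d (n - 2) \<in> ones"
      proof (rule ccontr)
        assume "d (n - 2) \<notin> ones"
        moreover have e: "n - 2 + 1 = n - 1" and "1 \<le> n - 2" "n - 2 < n" using nn(2) q2 by auto
        moreover have "d (n - 2 + 1) \<notin> ones" unfolding e d(2) by simp
        ultimately have "n - 2 = 4 * q" by (intro adjacent)
        thus False using nn q2 by simp
      qed
      moreover have "separator n b d s"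
      proof (rule separatorI[of s "n - 1"])
        show "l < n - 1" if "conflict_pair n b d i l" for i l
        proof -
          note f = pair_facts[OF that]
          have "l \<noteq> n" using last that by blast
          moreover have "l \<noteq> n - 1" using f(6,7) d(2) by auto
          ultimately show ?thesis using f(2) by auto
        qed
        show False if "conflict_pair n b d i l" "b (n - 1) = b i" for i l
          by (rule no_pair[OF that(1) in_range(3) d(2) that(2)])
      qed (use s' d(4) bs(2) in auto)
      ultimately show "{k \<in> {1..n}. d k = TwoC} = {} \<or>
         {k \<in> {1..n}. d k = TwoC} = {n} \<and> (\<exists>q<n. separator n b d q) \<or>
         {k \<in> {1..n}. d k = TwoC} = {2} \<and> (\<forall>i. \<not> conflict_pair n b d i n) \<or>
         {k \<in> {1..n}. d k = TwoC} = {2, n - 1} \<and> (\<forall>i. \<not> conflict_pair n b d i n) \<and>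
           d (n - 2) \<in> ones \<and> (\<exists>q>2. q < n - 1 \<and> separator n b d q)"
        using last s' by blast
    qed
    thus ?thesis using eq by simp
  next
    case not_i: False
    hence swap1: "swap_i n b (case2_color n p) = c" by (auto simp: swap_i_def c_def)
    show ?thesis
    proof (cases "\<not> (\<exists>i \<in> {1..n - 1}. c i \<in> {TwoA, TwoB} \<and> b i = b n) \<and> (\<exists>i \<in> {4..n - 1}. c i = TwoA \<and> b i = b 2)")
      case True
      define d where "d = c(2 := TwoC, n := TwoA)"
      have eq: "swap_ii n b (swap_i n b (case2_color n p)) = d"
        unfolding swap1 swap_ii_def d_def using True cn by simp
      interpret spaced n b d "if r = 1 then 4 * q else 0"
        unfolding d_def c_def by (rule spacedI, rule spread_swap_ii) (use p qr q1 in auto)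
      have n5: "5 \<le> n" using qr q1 by auto
      have dC: "d k = TwoC \<longleftrightarrow> k = 2" if "k \<in> {1..n}" for k
        using cC[OF that] n5 by (auto simp: d_def)
      have "resolvable n b d"
      proof (rule resolvableI)
        show False if "conflict_pair n b d i l" "z \<in> {1..n}" "d z = TwoC" "b z = b i" for i l z
        proof -
          have "z = 2" using dC that by simp
          thus False using TwoC_with_pair[OF that] q1 pair_facts(1,2)[OF that(1)] by (auto split: if_splits)
        qed
        show "y = z" if "y \<in> {1..n}" "z \<in> {1..n}" "d y = TwoC" "d z = TwoC" "b y = b z" for y z
          using dC that by simp
        have "\<not> conflict_pair n b d i n" for i
        proof
          assume "conflict_pair n b d i n"
          note f = pair_facts[OF this]
          have di: "d i = TwoA" using f(6) by (simp add: d_def)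
          hence "i \<noteq> 2" using n5 by (auto simp: d_def)
          hence "c i = TwoA" using di f(4) by (simp add: d_def)
          thus False using True f(1,3,5) by auto
        qed
        moreover have "{k \<in> {1..n}. d k = TwoC} = {2}" using dC n5 by auto
        ultimately show "{k \<in> {1..n}. d k = TwoC} = {} \<or>
           {k \<in> {1..n}. d k = TwoC} = {n} \<and> (\<exists>q<n. separator n b d q) \<or>
           {k \<in> {1..n}. d k = TwoC} = {2} \<and> (\<forall>i. \<not> conflict_pair n b d i n) \<or>
           {k \<in> {1..n}. d k = TwoC} = {2, n - 1} \<and> (\<forall>i. \<not> conflict_pair n b d i n) \<and>
             d (n - 2) \<in> ones \<and> (\<exists>q>2. q < n - 1 \<and> separator n b d q)"
          by blast
      qed
      thus ?thesis using eq by simp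
    next
      case not_ii: False
      have eq: "swap_ii n b (swap_i n b (case2_color n p)) = c"
        unfolding swap1 swap_ii_def using not_ii by auto
      obtain e where e: "spread n c e" using spread_case2[of n p] p n unfolding c_def by blast
      interpret spaced n b c e by (rule spacedI[OF e])
      have no_pair: False if "conflict_pair n b c i l" "z \<in> {1..n}" "c z = TwoC" "b z = b i" for i l z
      proof -
        note f = pair_facts[OF that(1)]
        have zn: "z = n" using cC that by blast
        have iln: "i \<noteq> n" "l \<noteq> n" using f(6,7) cn by auto
        have "z = e \<and> (i = e + 1 \<or> l = e + 1) \<or> z = e + 1 \<and> (i = e \<or> l = e)"
          by (rule TwoC_with_pair[OF that])
        hence "i = n - 1 \<or> l = n - 1" using zn f(1,2) by auto
        hence l: "l = n - 1" "i < n - 1" using f(2,3) iln by auto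
        hence A: "odd n \<Longrightarrow> posB q (n - 1)" using qr posB_last[OF q1] by auto
        have "c (n - 1) \<notin> ones" using f(9) l by simp
        hence "posA q (n - 1) \<or> posB q (n - 1)"
          using cA[of "n - 1"] cB[of "n - 1"] cC[of "n - 1"] n(1) by (cases "c (n - 1)") auto
        hence "odd n" using posA_bounds[of q "n - 1"] posB_bounds[of q "n - 1"] n(1) by auto
        hence cl: "c (n - 1) = TwoB" using A cB[of "n - 1"] n(1) by simp
        have "i \<in> {1..n - 2}" using f(1) l(2) by auto
        moreover have "c i = TwoB" using f(6) cl unfolding l(1) by simp
        moreover have "b (n - 1) = b i" using f(5) unfolding l(1) .
        moreover have "b n = b (n - 1)" using that(4) f(5) unfolding l(1) zn by simp
        ultimately show False using not_i cl by blast
      qed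
      have below: "l < n" if "conflict_pair n b c i l" for i l
      proof -
        have "l \<noteq> n" using pair_facts(6,7)[OF that] cn by auto
        thus ?thesis using pair_facts(2)[OF that] by simp
      qed
      have "\<exists>s<n. separator n b c s"
      proof (cases "\<exists>i \<in> {1..n - 1}. c i \<in> {TwoA, TwoB} \<and> b i = b n")
        case True
        then obtain s where s: "s \<in> {1..n - 1}" "c s \<in> {TwoA, TwoB}" "b s = b n" by blast
        have sn: "s \<in> {1..n}" "s \<noteq> n" using s(1) n(1) by auto
        have "posA q s \<or> posB q s" using s(2) cA[OF sn] cB[OF sn] by blast
        hence "even s" "2 \<le> s" using posA_bounds[of q s] posB_bounds[of q s] by auto
        hence "separator n b c s"
          by (intro separatorI[of s n]) (use s below no_pair[of _ _ n] cn n(1) in auto)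
        thus ?thesis using s(1) n(1) by (intro exI[of _ s]) auto
      next
        case False
        hence none: "\<not> (\<exists>i \<in> {4..n - 1}. c i = TwoA \<and> b i = b 2)" using not_ii by blast
        have "separator n b c 2"
          unfolding separator_def
        proof (intro conjI allI impI)
          fix i l assume il: "conflict_pair n b c i l"
          note f = pair_facts[OF il]
          have i2: "2 \<le> i" using f(1) pair_even[OF il] by (cases "i = 1") auto
          thus "l \<noteq> 2" "\<not> (i < 2 \<and> 2 < l)" using f(3) by auto
          show "i \<noteq> 2"
          proof
            assume i: "i = 2"
            have "l \<noteq> 3" using close_distinct[of i l] f i by (auto simp: close_def)
            hence "l \<in> {4..n - 1}" using f(3) i below[OF il] by auto
            thus False using none f(5,6) two i by auto
          qed
        qed (use two in auto)
        thus ?thesis using n(1) by (intro exI[of _ 2]) auto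
      qed
      moreover have "{k \<in> {1..n}. c k = TwoC} = {n}" using cC n(1) by auto
      ultimately have "resolvable n b c"
        by (intro resolvableI) (use no_pair cC in blast)+
      thus ?thesis using eq by simp
    qed
  qed
qed

lemma case2_resolvable:
  assumes p: "\<And>k. k \<in> {1..n} \<Longrightarrow> p k \<in> ones" and n: "3 \<le> n"
  shows "resolvable n b (swap_ii n b (swap_i n b (case2_color n p)))"
proof (cases "n mod 4 \<in> {1, 2}")
  case True
  hence "n \<noteq> 3" by auto
  thus ?thesis using TwoC_last_resolvable[OF p _ True] n by simp
next
  case False
  have "case2_color n p n \<noteq> TwoC"
    using False base_color_iff(3)[of p n n] p[of n] n by (auto simp: case2_color_def)
  hence "swap_ii n b (swap_i n b (case2_color n p)) = case2_color n p" by (simp add: swap_i_def swap_ii_def)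
  thus ?thesis using case2_resolvable_3[OF p] case2_resolvable_03[OF p _ False] n by (cases "n = 3") auto
qed

end

lemma resolvable_cong:
  assumes "resolvable n b c" and eq: "\<And>k. k \<in> {1..n} \<Longrightarrow> c' k = c k"
  shows "resolvable n b c'"
proof -
  interpret r: resolvable n b c by fact
  have pair: "conflict_pair n b c' i l = conflict_pair n b c i l" for i l
  proof -
    have "i \<in> {1..n} \<and> l \<in> {1..n}" if "1 \<le> i \<and> i < l \<and> l \<le> n" using that by auto
    thus ?thesis unfolding conflict_pair_def using eq[of i] eq[of l] by auto
  qed
  have sep: "separator n b c' q = separator n b c q" if "q < n" for q
  proof (cases "2 \<le> q")
    case True
    hence "c' q = c q" using eq[of q] that by auto
    thus ?thesis unfolding separator_def pair by simp
  qed (simp add: separator_def)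
  have set: "{k \<in> {1..n}. c' k = TwoC} = {k \<in> {1..n}. c k = TwoC}" using eq by auto
  show ?thesis
  proof
    show "c' k \<noteq> c' l" if "k \<in> {1..n}" "l \<in> {1..n}" "close n k l" "c' k \<notin> ones" "c' l \<notin> ones" for k l
      using r.close_distinct[of k l] that eq[of k] eq[of l] by auto
    show "i = i' \<and> l = l'" if "conflict_pair n b c' i l" "conflict_pair n b c' i' l'" "b i = b i'" for i l i' l'
      using r.pair_unique that unfolding pair .
    show "b z \<noteq> b i" if "conflict_pair n b c' i l" "z \<in> {1..n}" "c' z = TwoC" for i l z
      using r.TwoC_no_pair[of i l z] that eq[of z] unfolding pair by simp
    show "y = z" if "y \<in> {1..n}" "z \<in> {1..n}" "c' y = TwoC" "c' z = TwoC" "b y = b z" for y z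
      by (rule r.TwoC_block) (use that eq[of y] eq[of z] in simp_all)
    show "even i" if "conflict_pair n b c' i l" for i l using r.pair_even that unfolding pair .
    show "c' (i - 1) \<in> ones" if "conflict_pair n b c' i l" for i l
    proof -
      have il: "conflict_pair n b c i l" using that unfolding pair .
      have "i - 1 \<in> {1..n}" using r.pairD(1-3)[OF il] by auto
      thus ?thesis using r.pair_pred[OF il] eq by metis
    qed
    show "c' k \<in> ones \<or> c' (k + 1) \<in> ones \<or> c' (k + 2) \<in> ones" if "1 \<le> k" "k + 2 \<le> n" for k
      using r.no_three[of k] that eq[of k] eq[of "k + 1"] eq[of "k + 2"] by auto
    from r.initial_TwoC show "{k \<in> {1..n}. c' k = TwoC} = {} \<or>
       {k \<in> {1..n}. c' k = TwoC} = {n} \<and> (\<exists>q<n. separator n b c' q) \<or>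
       {k \<in> {1..n}. c' k = TwoC} = {2} \<and> (\<forall>i. \<not> conflict_pair n b c' i n) \<or>
       {k \<in> {1..n}. c' k = TwoC} = {2, n - 1} \<and> (\<forall>i. \<not> conflict_pair n b c' i n) \<and>
         c' (n - 2) \<in> ones \<and> (\<exists>q>2. q < n - 1 \<and> separator n b c' q)"
      unfolding set pair
    proof (elim disjE, goal_cases)
      case 1 thus ?case by (rule disjI1)
    next
      case 2
      then obtain q where "q < n" "separator n b c q" by (elim conjE exE)
      hence "\<exists>q<n. separator n b c' q" using sep[of q] by (intro exI[of _ q]) simp
      thus ?case using conjunct1[OF 2] by (intro disjI2[OF disjI1] conjI)
    next
      case 3 thus ?case by (intro disjI2[OF disjI2[OF disjI1]])
    next
      case 4
      then obtain q where q: "2 < q" "q < n - 1" "separator n b c q" by (elim conjE exE)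
      have "n - 2 \<in> {1..n}" using q(1,2) by auto
      hence "c' (n - 2) \<in> ones" using eq 4 by metis
      moreover have "\<exists>q>2. q < n - 1 \<and> separator n b c' q" using sep[of q] q by (intro exI[of _ q]) simp
      ultimately show ?case using 4 by (intro disjI2[OF disjI2[OF disjI2]] conjI) (elim conjE, assumption)+
    qed
  qed (use r.noncrossing in blast)
qed

lemma base_color_ones: "base_color n p k \<in> ones \<Longrightarrow> base_color n p k = p k"
  by (auto simp: base_color_def split: if_splits)

lemma case1_color_ones: "case1_color n p k \<in> ones \<Longrightarrow> case1_color n p k = base_color n p k"
  by (auto simp: case1_color_def fun_upd_def split: if_splits)

lemma case2_color_ones: "case2_color n p k \<in> ones \<Longrightarrow> case2_color n p k = base_color n p k"
  by (auto simp: case2_color_def fun_upd_def split: if_splits)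

text \<open>In CASE-1 only \<open>n\<close> and \<open>1\<close> are consecutive positions with colors of radius 1.\<close>

lemma case1_ones:
  assumes p: "\<And>k. k \<in> {1..n} \<Longrightarrow> p k \<in> ones" and n: "3 \<le> n" and k: "k \<in> {1..n}" "case1_color n p k \<in> ones"
  shows "case1_color n p k = p k"
    and "k < n \<Longrightarrow> case1_color n p (k + 1) \<notin> ones"
proof -
  show "case1_color n p k = p k" using case1_color_ones[OF k(2)] base_color_ones k(2) by metis
next
  assume "k < n"
  obtain q r where qr: "n = 4 * q + r" "r < 4" by (metis mod_less_divisor mult_div_mod_eq zero_less_numeral)
  have d: "n div 4 = q" "n mod 4 = r" using qr by simp_all
  have pk: "p k \<in> ones" "p (k + 1) \<in> ones" using p k(1) \<open>k < n\<close> by auto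
  have 1: "odd k \<or> 4 * q < k" and k1: "k \<noteq> n - 1 \<or> r \<notin> {2, 3}"
    using k(2) base_color_iff(4)[of p k n, OF pk(1)] d by (auto simp: case1_color_def split: if_splits)
  show "case1_color n p (k + 1) \<notin> ones"
  proof
    assume "case1_color n p (k + 1) \<in> ones"
    hence 2: "odd (k + 1) \<or> 4 * q < k + 1" and "k + 1 \<noteq> n - 1 \<or> r \<notin> {2, 3}"
      using base_color_iff(4)[of p "k + 1" n, OF pk(2)] d by (auto simp: case1_color_def split: if_splits)
    moreover have "4 * q + 1 \<le> k"
    proof (rule ccontr)
      assume "\<not> 4 * q + 1 \<le> k"
      hence "odd k" "k \<noteq> 4 * q" using 1 by auto
      thus False using 2 \<open>\<not> 4 * q + 1 \<le> k\<close> by auto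
    qed
    moreover have "r = 2 \<or> r = 3" using calculation(3) qr \<open>k < n\<close> by auto
    ultimately show False using k1 qr \<open>k < n\<close> by auto
  qed
qed

text \<open>In CASE-2 there are no consecutive positions with colors of radius 1, as position \<open>n\<close> always gets a color of
  radius 2.\<close>

lemma case2_ones:
  assumes p: "\<And>k. k \<in> {1..n} \<Longrightarrow> p k \<in> ones" and n: "3 \<le> n" and k: "k \<in> {1..n}" "case2_color n p k \<in> ones"
  shows "case2_color n p k = p k" "k < n" "case2_color n p (k + 1) \<notin> ones"
proof -
  show "case2_color n p k = p k" using case2_color_ones[OF k(2)] base_color_ones k(2) by metis
  obtain q r where qr: "n = 4 * q + r" "r < 4" by (metis mod_less_divisor mult_div_mod_eq zero_less_numeral)
  have d: "n div 4 = q" "n mod 4 = r" using qr by simp_all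
  have pk: "p k \<in> ones" using p k(1) by auto
  have 1: "odd k \<or> 4 * q < k" and kn: "k \<noteq> n \<or> r = 0" and k2: "k \<noteq> n - 2 \<or> r \<noteq> 3"
    using k(2) base_color_iff(4)[of p k n, OF pk] d qr(2) by (auto simp: case2_color_def split: if_splits)
  have "k \<noteq> n" using 1 kn qr by auto
  thus "k < n" using k(1) by simp
  hence pk1: "p (k + 1) \<in> ones" using p k(1) by auto
  show "case2_color n p (k + 1) \<notin> ones"
  proof
    assume "case2_color n p (k + 1) \<in> ones"
    hence 2: "odd (k + 1) \<or> 4 * q < k + 1" and "k + 1 \<noteq> n \<or> r = 0" "k + 1 \<noteq> n - 2 \<or> r \<noteq> 3"
      using base_color_iff(4)[of p "k + 1" n, OF pk1] d qr(2) by (auto simp: case2_color_def split: if_splits)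
    moreover have "4 * q + 1 \<le> k"
    proof (rule ccontr)
      assume "\<not> 4 * q + 1 \<le> k"
      hence "odd k" "k \<noteq> 4 * q" using 1 by auto
      thus False using 2 \<open>\<not> 4 * q + 1 \<le> k\<close> by auto
    qed
    ultimately show False using k2 qr \<open>k < n\<close> by auto
  qed
qed

lemma swap_ones: "swap_ii n b (swap_i n b c) k \<in> ones \<Longrightarrow> swap_ii n b (swap_i n b c) k = c k"
  by (auto simp: swap_ii_def swap_i_def split: if_splits)

section \<open>RECOLORING as a function of the position\<close>

locale two_colored_tree = plane_tree T rot C for T :: "'v pair_pre_digraph" and rot C +
  fixes \<phi>\<^sub>0 :: "'v \<Rightarrow> color"
  assumes proper: "(u, v) \<in> parcs T \<Longrightarrow> \<phi>\<^sub>0 u \<noteq> \<phi>\<^sub>0 v"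
    and range: "\<phi>\<^sub>0 v \<in> ones"
begin

abbreviation "n \<equiv> length C"
abbreviation "b \<equiv> nbr T C"
abbreviation "p \<equiv> \<lambda>k. \<phi>\<^sub>0 (vtx C k)"

text \<open>The initial coloring is proper with two colors, so \<open>1\<^sub>k\<close> is the color that \<open>a\<^sub>k\<close> has from the start.\<close>

lemma one_at_eq: "one_at T C \<phi>\<^sub>0 k = \<phi>\<^sub>0 (vtx C k)"
  using proper[OF nbr_arcs(1)[of k]] range[of "vtx C k"] range[of "nbr T C k"] by (auto simp: one_at_def)

lemma upd_vtx:
  "\<lbrakk>k \<in> {1..n}; i \<in> {1..n}\<rbrakk> \<Longrightarrow> (\<phi>(vtx C i := x)) (vtx C k) = (if k = i then x else \<phi> (vtx C k))"
  using vtx_inj by simp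

lemma fold_upd_vtx:
  assumes "t \<le> n" "k \<in> {1..n}"
  shows "fold (\<lambda>k \<phi>. \<phi>(vtx C k := g k)) [1..<t + 1] \<phi> (vtx C k) = (if k \<le> t then g k else \<phi> (vtx C k))"
  using assms(1)
proof (induction t)
  case 0 thus ?case using assms(2) by simp
next
  case (Suc t)
  have "fold (\<lambda>k \<phi>. \<phi>(vtx C k := g k)) [1..<Suc t + 1] \<phi> (vtx C k) =
    (if k = Suc t then g (Suc t) else fold (\<lambda>k \<phi>. \<phi>(vtx C k := g k)) [1..<t + 1] \<phi> (vtx C k))"
  proof -
    have eq: "fold (\<lambda>k \<phi>. \<phi>(vtx C k := g k)) [1..<Suc t + 1] \<phi> =
      (fold (\<lambda>k \<phi>. \<phi>(vtx C k := g k)) [1..<t + 1] \<phi>)(vtx C (Suc t) := g (Suc t))" by simp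
    show ?thesis unfolding eq by (rule upd_vtx[OF assms(2)]) (use Suc.prems in simp)
  qed
  also have "\<dots> = (if k = Suc t then g (Suc t) else if k \<le> t then g k else \<phi> (vtx C k))"
    using Suc.prems by (subst Suc.IH) simp_all
  also have "\<dots> = (if k \<le> Suc t then g k else \<phi> (vtx C k))" by auto
  finally show ?case .
qed

lemma recolor_main_vtx:
  assumes "k \<in> {1..n}" shows "recolor_main T C \<phi>\<^sub>0 \<phi>\<^sub>0 (vtx C k) = base_color n p k"
proof -
  have "recolor_main T C \<phi>\<^sub>0 \<phi>\<^sub>0 (vtx C k) =
    (if k \<le> 4 * (n div 4) then if odd k then p k else if k mod 4 = 2 then TwoA else TwoB else p k)"
    unfolding recolor_main_def one_at_eq by (rule fold_upd_vtx[OF _ assms]) simp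
  thus ?thesis by (auto simp: base_color_def)
qed

lemma n_split: "n - 4 * (n div 4) = n mod 4"
  by (simp add: minus_mult_div_eq_mod)

lemma recolor_rest1_vtx:
  assumes k: "k \<in> {1..n}"
  shows "recolor_rest1 T C \<phi>\<^sub>0 (recolor_main T C \<phi>\<^sub>0 \<phi>\<^sub>0) (vtx C k) = case1_color n p k"
proof -
  let ?\<phi> = "recolor_main T C \<phi>\<^sub>0 \<phi>\<^sub>0"
  have i: "n \<in> {1..n}" "n - 1 \<in> {1..n}" "n - 2 \<in> {1..n}" "n - 1 \<noteq> n" "n - 2 \<noteq> n" "n - 2 \<noteq> n - 1"
    using length_C by auto
  note u = fun_upd_apply vtx_inj[OF k i(1)] vtx_inj[OF k i(2)] vtx_inj[OF k i(3)] recolor_main_vtx[OF k] one_at_eq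
  have m: "4 * (n div 4) + n mod 4 = n" by simp
  have base: "p j = base_color n p j" if "odd j \<or> 4 * (n div 4) < j" for j using that by (auto simp: base_color_def)
  have "n mod 4 < 4" by simp
  then consider "n mod 4 = 0" | "n mod 4 = 1" | "n mod 4 = 2" | "n mod 4 = 3" by linarith
  thus ?thesis
  proof cases
    case 1
    have r: "recolor_rest1 T C \<phi>\<^sub>0 ?\<phi> = ?\<phi>"
      unfolding recolor_rest1_def Let_def n_split 1 by simp
    have c: "case1_color n p = base_color n p" using 1 by (simp add: case1_color_def)
    show ?thesis 
      unfolding r c u using i(4-6) by (cases "k = n"; cases "k = n - 1"; cases "k = n - 2"; simp)
  next
    case 2
    have r: "recolor_rest1 T C \<phi>\<^sub>0 ?\<phi> = ?\<phi>(vtx C n := one_at T C \<phi>\<^sub>0 n)"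
      unfolding recolor_rest1_def Let_def n_split 2 by simp
    have c: "case1_color n p = base_color n p" using 2 by (simp add: case1_color_def)
    have "p (n) = base_color n p (n)" using m 2 by (intro base) linarith
    thus ?thesis 
      unfolding r c u using i(4-6) by (cases "k = n"; cases "k = n - 1"; cases "k = n - 2"; simp)
  next
    case 3
    have r: "recolor_rest1 T C \<phi>\<^sub>0 ?\<phi> = ?\<phi>(vtx C (n - 1) := TwoA, vtx C n := one_at T C \<phi>\<^sub>0 n)"
      unfolding recolor_rest1_def Let_def n_split 3 by simp
    have c: "case1_color n p = (base_color n p)(n - 1 := TwoA)" using 3 by (simp add: case1_color_def)
    have "p (n) = base_color n p (n)" using m 3 by (intro base) linarith
    thus ?thesis 
      unfolding r c u using i(4-6) by (cases "k = n"; cases "k = n - 1"; cases "k = n - 2"; simp)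
  next
    case 4
    have r: "recolor_rest1 T C \<phi>\<^sub>0 ?\<phi> = ?\<phi>(vtx C (n - 2) := one_at T C \<phi>\<^sub>0 (n - 2), vtx C (n - 1) := TwoA, vtx C n := one_at T C \<phi>\<^sub>0 n)"
      unfolding recolor_rest1_def Let_def n_split 4 by simp
    have c: "case1_color n p = (base_color n p)(n - 1 := TwoA)" using 4 by (simp add: case1_color_def)
    have "p (n) = base_color n p (n)" using m 4 by (intro base) linarith
    have "p (n - 2) = base_color n p (n - 2)" using m 4 by (intro base) linarith
    with \<open>p (n) = base_color n p (n)\<close> show ?thesis
      unfolding r c u using i(4-6) by (cases "k = n"; cases "k = n - 1"; cases "k = n - 2"; simp)
  qed
qed

lemma recolor_rest2_vtx:
  assumes k: "k \<in> {1..n}"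
  shows "recolor_rest2 T C \<phi>\<^sub>0 (recolor_main T C \<phi>\<^sub>0 \<phi>\<^sub>0) (vtx C k) = case2_color n p k"
proof -
  let ?\<phi> = "recolor_main T C \<phi>\<^sub>0 \<phi>\<^sub>0"
  have i: "n \<in> {1..n}" "n - 1 \<in> {1..n}" "n - 2 \<in> {1..n}" "n - 1 \<noteq> n" "n - 2 \<noteq> n" "n - 2 \<noteq> n - 1"
    using length_C by auto
  note u = fun_upd_apply vtx_inj[OF k i(1)] vtx_inj[OF k i(2)] vtx_inj[OF k i(3)] recolor_main_vtx[OF k] one_at_eq
  have m: "4 * (n div 4) + n mod 4 = n" by simp
  have base: "p j = base_color n p j" if "odd j \<or> 4 * (n div 4) < j" for j using that by (auto simp: base_color_def)
  have "n mod 4 < 4" by simp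
  then consider "n mod 4 = 0" | "n mod 4 = 1" | "n mod 4 = 2" | "n mod 4 = 3" by linarith
  thus ?thesis
  proof cases
    case 1
    have r: "recolor_rest2 T C \<phi>\<^sub>0 ?\<phi> = ?\<phi>"
      unfolding recolor_rest2_def Let_def n_split 1 by simp
    have c: "case2_color n p = base_color n p" using 1 by (simp add: case2_color_def)
    show ?thesis 
      unfolding r c u using i(4-6) by (cases "k = n"; cases "k = n - 1"; cases "k = n - 2"; simp)
  next
    case 2
    have r: "recolor_rest2 T C \<phi>\<^sub>0 ?\<phi> = ?\<phi>(vtx C n := TwoC)"
      unfolding recolor_rest2_def Let_def n_split 2 by simp
    have c: "case2_color n p = (base_color n p)(n := TwoC)" using 2 by (simp add: case2_color_def)
    show ?thesis 
      unfolding r c u using i(4-6) by (cases "k = n"; cases "k = n - 1"; cases "k = n - 2"; simp)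
  next
    case 3
    have r: "recolor_rest2 T C \<phi>\<^sub>0 ?\<phi> = ?\<phi>(vtx C (n - 1) := one_at T C \<phi>\<^sub>0 (n - 1), vtx C n := TwoC)"
      unfolding recolor_rest2_def Let_def n_split 3 by simp
    have c: "case2_color n p = (base_color n p)(n := TwoC)" using 3 by (simp add: case2_color_def)
    have "p (n - 1) = base_color n p (n - 1)" using m 3 by (intro base) linarith
    thus ?thesis unfolding r c u
      by (cases "k = n - 1") (simp_all only: if_True if_False refl i(4-6) i(4-6)[symmetric])
  next
    case 4
    have r: "recolor_rest2 T C \<phi>\<^sub>0 ?\<phi> = ?\<phi>(vtx C (n - 2) := TwoA, vtx C (n - 1) := one_at T C \<phi>\<^sub>0 (n - 1), vtx C n := TwoB)"
      unfolding recolor_rest2_def Let_def n_split 4 by simp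
    have c: "case2_color n p = (base_color n p)(n - 2 := TwoA, n := TwoB)" using 4 by (simp add: case2_color_def)
    have "p (n - 1) = base_color n p (n - 1)" using m 4 by (intro base) linarith
    thus ?thesis unfolding r c u
      by (cases "k = n - 1") (simp_all only: if_True if_False refl i(4-6) i(4-6)[symmetric])
  qed
qed

lemma modification_i_vtx:
  assumes c: "\<And>k. k \<in> {1..n} \<Longrightarrow> \<phi> (vtx C k) = c k" and k: "k \<in> {1..n}"
  shows "modification_i T C \<phi> (vtx C k) = swap_i n b c k"
proof -
  have i: "n \<in> {1..n}" "n - 1 \<in> {1..n}" "2 \<in> {1..n}" using length_C by auto
  note u = vtx_inj[OF k i(1)] vtx_inj[OF k i(2)] vtx_inj[OF k i(3)]
  have cj: "\<phi> (vtx C j) = c j" if "j \<in> {1..n - 2}" for j by (rule c) (use that in auto)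
  have "(\<exists>i \<in> {1..n - 2}. \<phi> (vtx C (n - 1)) = TwoB \<and> \<phi> (vtx C i) = TwoB \<and> b n = b (n - 1) \<and> b (n - 1) = b i) \<longleftrightarrow>
    (\<exists>i \<in> {1..n - 2}. c (n - 1) = TwoB \<and> c i = TwoB \<and> b n = b (n - 1) \<and> b (n - 1) = b i)"
    by (rule bex_cong[OF refl]) (simp only: cj c[OF i(2)])
  hence eq: "(\<phi> (vtx C n) = TwoC \<and> (\<exists>i \<in> {1..n - 2}. \<phi> (vtx C (n - 1)) = TwoB \<and> \<phi> (vtx C i) = TwoB \<and> b n = b (n - 1) \<and> b (n - 1) = b i)) =
    (c n = TwoC \<and> (\<exists>i \<in> {1..n - 2}. c (n - 1) = TwoB \<and> c i = TwoB \<and> b n = b (n - 1) \<and> b (n - 1) = b i))"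
    (is "_ = ?P") unfolding c[OF i(1)] by simp
  show ?thesis
  proof (cases ?P)
    case True
    show ?thesis unfolding modification_i_def swap_i_def Let_def eq if_P[OF True] fun_upd_apply u c[OF k] ..
  next
    case False
    show ?thesis unfolding modification_i_def swap_i_def Let_def eq if_not_P[OF False] by (rule c[OF k])
  qed
qed

lemma modification_ii_vtx:
  assumes c: "\<And>k. k \<in> {1..n} \<Longrightarrow> \<phi> (vtx C k) = c k" and k: "k \<in> {1..n}"
  shows "modification_ii T C \<phi> (vtx C k) = swap_ii n b c k"
proof -
  have i: "n \<in> {1..n}" "2 \<in> {1..n}" using length_C by auto
  note u = vtx_inj[OF k i(1)] vtx_inj[OF k i(2)]
  have cj: "\<phi> (vtx C j) = c j" if "j \<in> {1..n - 1} \<or> j \<in> {4..n - 1}" for j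
    by (rule c) (use that in auto)
  have "(\<exists>i \<in> {1..n - 1}. \<phi> (vtx C i) \<in> {TwoA, TwoB} \<and> b i = b n) \<longleftrightarrow>
        (\<exists>i \<in> {1..n - 1}. c i \<in> {TwoA, TwoB} \<and> b i = b n)"
      "(\<exists>i \<in> {4..n - 1}. \<phi> (vtx C i) = TwoA \<and> b i = b 2) \<longleftrightarrow> (\<exists>i \<in> {4..n - 1}. c i = TwoA \<and> b i = b 2)"
    by (rule bex_cong[OF refl], simp only: cj Un_iff simp_thms)+
  hence eq: "(\<phi> (vtx C n) = TwoC \<and> \<not> (\<exists>i \<in> {1..n - 1}. \<phi> (vtx C i) \<in> {TwoA, TwoB} \<and> b i = b n) \<and>
      (\<exists>i \<in> {4..n - 1}. \<phi> (vtx C i) = TwoA \<and> b i = b 2)) =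
    (c n = TwoC \<and> \<not> (\<exists>i \<in> {1..n - 1}. c i \<in> {TwoA, TwoB} \<and> b i = b n) \<and>
      (\<exists>i \<in> {4..n - 1}. c i = TwoA \<and> b i = b 2))"
    (is "_ = ?P") unfolding c[OF i(1)] by simp
  show ?thesis
  proof (cases ?P)
    case True
    show ?thesis unfolding modification_ii_def swap_ii_def Let_def eq if_P[OF True] fun_upd_apply u c[OF k] ..
  next
    case False
    show ?thesis unfolding modification_ii_def swap_ii_def Let_def eq if_not_P[OF False] by (rule c[OF k])
  qed
qed

lemma recoloring_vtx:
  assumes "k \<in> {1..n}"
  shows "recoloring T C \<phi>\<^sub>0 (vtx C k) =
    (if monochromatic C \<phi>\<^sub>0 then swap_ii n b (swap_i n b (case2_color n p)) else case1_color n p) k"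
proof -
  let ?\<phi> = "recolor_rest2 T C \<phi>\<^sub>0 (recolor_main T C \<phi>\<^sub>0 \<phi>\<^sub>0)"
  have "modification_i T C ?\<phi> (vtx C j) = swap_i n b (case2_color n p) j" if "j \<in> {1..n}" for j
    by (rule modification_i_vtx[OF _ that]) (rule recolor_rest2_vtx)
  hence "modification_ii T C (modification_i T C ?\<phi>) (vtx C k) = swap_ii n b (swap_i n b (case2_color n p)) k"
    by (intro modification_ii_vtx assms)
  thus ?thesis unfolding recoloring_def Let_def using recolor_rest1_vtx[OF assms] by simp
qed

lemma recoloring_inner:
  assumes "v \<notin> leaves T" shows "recoloring T C \<phi>\<^sub>0 v = \<phi>\<^sub>0 v"
proof -
  have v: "v \<noteq> vtx C k" for k using vtx_leaf assms by blast
  have f: "fold (\<lambda>k \<phi>. \<phi>(vtx C k := g k)) is \<phi> v = \<phi> v" for g \<phi> "is"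
    by (induction "is" arbitrary: \<phi>) (simp_all add: v)
  have "recolor_main T C \<phi>\<^sub>0 \<phi> v = \<phi> v" for \<phi> unfolding recolor_main_def by (rule f)
  moreover have "recolor_rest1 T C \<phi>\<^sub>0 \<phi> v = \<phi> v" "recolor_rest2 T C \<phi>\<^sub>0 \<phi> v = \<phi> v"
    "modification_i T C \<phi> v = \<phi> v" "modification_ii T C \<phi> v = \<phi> v" for \<phi>
    unfolding recolor_rest1_def recolor_rest2_def modification_i_def modification_ii_def Let_def by (simp_all add: v)
  ultimately show ?thesis unfolding recoloring_def Let_def by simp
qed

definition result :: "'v \<Rightarrow> color" where
  "result = resolve_conflicts T C (recoloring T C \<phi>\<^sub>0)"

end

locale bounded_tree = two_colored_tree +
  assumes degree: "v \<in> pverts T \<Longrightarrow> out_degree (with_proj T) v \<le> 5"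
    and ends: "\<not> monochromatic C \<phi>\<^sub>0 \<Longrightarrow> \<phi>\<^sub>0 (vtx C 1) \<noteq> \<phi>\<^sub>0 (vtx C (length C))"
begin

lemma leaf_blocks: "leaf_blocks n b"
proof
  show "b i = b j" if "1 \<le> i" "i < j" "j < k" "k < l" "l \<le> n" "b i = b k" "b j = b l" for i j k l
    using blocks_noncrossing that .
  show False if "1 \<le> x" "x + 1 < y" "y + 1 < z" "z \<le> n" "\<not> (x = 1 \<and> z = n)" "b y = b x" "b z = b x" for x y z
    by (rule no_three_apart_in_block[of x y z]) (use that degree tree_arc_verts(2)[OF tree nbr_arcs(1)] in auto)
qed

lemma resolvable: "resolvable n b (\<lambda>k. recoloring T C \<phi>\<^sub>0 (vtx C k))"
proof -
  interpret leaf_blocks n b by (rule leaf_blocks)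
  let ?c = "if monochromatic C \<phi>\<^sub>0 then swap_ii n b (swap_i n b (case2_color n p)) else case1_color n p"
  have "resolvable n b ?c"
    using case1_resolvable[of p] case2_resolvable[of p] range length_C by simp
  thus ?thesis by (rule resolvable_cong) (rule recoloring_vtx)
qed

sublocale recolored_tree T rot C "recoloring T C \<phi>\<^sub>0"
  by (intro recolored_tree.intro resolvable) unfold_locales

lemma result_vtx: "k \<in> {1..n} \<Longrightarrow> result (vtx C k) = final k"
  unfolding result_def by (rule resolve_conflicts_final)

lemma result_inner: "v \<notin> leaves T \<Longrightarrow> result v = \<phi>\<^sub>0 v"
  unfolding result_def using resolve_conflicts_inner recoloring_inner by simp

lemma result_ones_vtx:
  assumes k: "k \<in> {1..n}" and one: "result (vtx C k) \<in> ones"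
  shows "recoloring T C \<phi>\<^sub>0 (vtx C k) = result (vtx C k)"
  using one unfolding result_vtx[OF k] by (auto simp: final_def split: if_splits)

lemma recoloring_ones:
  assumes k: "k \<in> {1..n}" and one: "recoloring T C \<phi>\<^sub>0 (vtx C k) \<in> ones"
  shows "recoloring T C \<phi>\<^sub>0 (vtx C k) = p k"
proof (cases "monochromatic C \<phi>\<^sub>0")
  case True
  hence eq: "recoloring T C \<phi>\<^sub>0 (vtx C k) = swap_ii n b (swap_i n b (case2_color n p)) k"
    using recoloring_vtx[OF k] by simp
  have c: "swap_ii n b (swap_i n b (case2_color n p)) k = case2_color n p k"
    using one unfolding eq by (rule swap_ones)
  have "case2_color n p k \<in> ones" using one unfolding eq c .
  thus ?thesis unfolding eq c using case2_ones(1)[where p = p, OF range length_C k] by simp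
next
  case False
  hence eq: "recoloring T C \<phi>\<^sub>0 (vtx C k) = case1_color n p k" using recoloring_vtx[OF k] by simp
  have "case1_color n p k \<in> ones" using one unfolding eq .
  thus ?thesis unfolding eq using case1_ones(1)[where p = p, OF range length_C k] by simp
qed

lemma recoloring_adjacent_ones:
  assumes k: "k \<in> {1..n}" and one: "recoloring T C \<phi>\<^sub>0 (vtx C k) \<in> ones"
    and one': "recoloring T C \<phi>\<^sub>0 (vtx C (k mod n + 1)) \<in> ones"
  shows "p k \<noteq> p (k mod n + 1)"
proof (cases "monochromatic C \<phi>\<^sub>0")
  case True
  have *: "case2_color n p j \<in> ones" if "j \<in> {1..n}" "recoloring T C \<phi>\<^sub>0 (vtx C j) \<in> ones" for j
  proof -
    have eq: "recoloring T C \<phi>\<^sub>0 (vtx C j) = swap_ii n b (swap_i n b (case2_color n p)) j"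
      using recoloring_vtx[OF that(1)] True by simp
    show ?thesis using that(2) swap_ones[of n b "case2_color n p" j] unfolding eq by metis
  qed
  have "k < n" "case2_color n p (k + 1) \<notin> ones"
    using case2_ones(2,3)[where p = p, OF range length_C k *[OF k one]] by blast+
  moreover have "case2_color n p (k mod n + 1) \<in> ones" using *[OF next_index one'] .
  ultimately show ?thesis by simp
next
  case False
  have eq: "recoloring T C \<phi>\<^sub>0 (vtx C j) = case1_color n p j" if "j \<in> {1..n}" for j
    using recoloring_vtx[OF that] False by simp
  have "case1_color n p k \<in> ones" "case1_color n p (k mod n + 1) \<in> ones"
    using one one' eq[OF k] eq[OF next_index] by metis+
  hence "\<not> k < n" using case1_ones(2)[where p = p, OF range length_C k] by auto
  hence "k = n" using k by simp
  thus ?thesis using ends[OF False] by simp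
qed

definition halin :: "'a pair_pre_digraph" where
  "halin = \<lparr>pverts = pverts T, parcs = parcs T \<union> cycle_edges C \<union> (cycle_edges C)\<inverse>\<rparr>"

lemma cycle_edgesE:
  assumes "(u, v) \<in> cycle_edges C"
  obtains k where "k \<in> {1..n}" "u = vtx C k" "v = vtx C (k mod n + 1)"
proof -
  obtain i where i: "i < n" "u = C ! i" "v = C ! (Suc i mod n)" using assms by (auto simp: cycle_edges_def)
  have 1: "i + 1 \<in> {1..n}" using i(1) by simp
  have "u = vtx C (i + 1)" "v = vtx C ((i + 1) mod n + 1)"
    using vtx_nth[OF 1] vtx_nth[OF next_index, of "i + 1"] i by simp_all
  thus ?thesis using that 1 by blast
qed

lemma halin_wf: "pair_wf_digraph halin"
proof
  have l: "vtx C k \<in> pverts T" for k using vtx_leaf by (simp add: leaves_def)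
  fix e assume "e \<in> parcs halin"
  then consider "(fst e, snd e) \<in> parcs T" | "(fst e, snd e) \<in> cycle_edges C" | "(snd e, fst e) \<in> cycle_edges C"
    by (cases e) (auto simp: halin_def)
  hence "fst e \<in> pverts T \<and> snd e \<in> pverts T"
    by cases (use tree_arc_verts[OF tree] l in \<open>blast | (elim cycle_edgesE, simp)\<close>)+
  thus "fst e \<in> pverts halin" "snd e \<in> pverts halin" by (simp_all add: halin_def)
qed

lemma halin_arc_inner:
  assumes "(u, v) \<in> parcs halin" "u \<notin> leaves T \<or> v \<notin> leaves T" shows "(u, v) \<in> parcs T"
  using assms vtx_leaf by (auto simp: halin_def elim!: cycle_edgesE)

lemma halin_arc_leaves:
  assumes kl: "k \<in> {1..n}" "l \<in> {1..n}" and "(vtx C k, vtx C l) \<in> parcs halin"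
  shows "l = k mod n + 1 \<or> k = l mod n + 1"
proof -
  consider "(vtx C k, vtx C l) \<in> parcs T" | "(vtx C k, vtx C l) \<in> cycle_edges C" | "(vtx C l, vtx C k) \<in> cycle_edges C"
    using assms(3) by (auto simp: halin_def)
  thus ?thesis
  proof cases
    case 1 thus ?thesis using leaf_neighbour_inner[OF vtx_leaf] vtx_leaf by blast
  next
    case 2
    then obtain j where "j \<in> {1..n}" "vtx C k = vtx C j" "vtx C l = vtx C (j mod n + 1)" by (rule cycle_edgesE)
    thus ?thesis using vtx_inj kl next_index by metis
  next
    case 3
    then obtain j where "j \<in> {1..n}" "vtx C l = vtx C j" "vtx C k = vtx C (j mod n + 1)" by (rule cycle_edgesE)
    thus ?thesis using vtx_inj kl next_index by metis
  qed
qed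

lemma result_ones: "result v \<in> ones \<Longrightarrow> result v = \<phi>\<^sub>0 v"
proof (cases "v \<in> leaves T")
  case True
  then obtain k where k: "k \<in> {1..n}" "v = vtx C k" by (rule leaf_in_vtx)
  assume "result v \<in> ones"
  thus ?thesis using result_ones_vtx[OF k(1)] recoloring_ones[OF k(1)] k(2) by metis
qed (simp add: result_inner)

lemma result_ones_adjacent:
  assumes "result u \<in> ones" "result v \<in> ones" "(u, v) \<in> parcs halin"
  shows "result u \<noteq> result v"
proof -
  have c: "\<phi>\<^sub>0 u \<noteq> \<phi>\<^sub>0 v" if uv: "(u, v) \<in> cycle_edges C" "result u \<in> ones" "result v \<in> ones" for u v
  proof -
    obtain k where k: "k \<in> {1..n}" "u = vtx C k" "v = vtx C (k mod n + 1)" using uv(1) by (rule cycle_edgesE)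
    have "recoloring T C \<phi>\<^sub>0 (vtx C k) \<in> ones" using result_ones_vtx[OF k(1)] uv(2) k(2) by simp
    moreover have "recoloring T C \<phi>\<^sub>0 (vtx C (k mod n + 1)) \<in> ones"
      using result_ones_vtx[OF next_index] uv(3) k(3) by simp
    ultimately show ?thesis using recoloring_adjacent_ones[OF k(1)] k by simp
  qed
  have "\<phi>\<^sub>0 u \<noteq> \<phi>\<^sub>0 v"
    using assms(3) proper[of u v] c[of u v] c[of v u] assms(1,2) by (auto simp: halin_def)
  thus ?thesis using result_ones assms by simp
qed

text \<open>Both vertices are leaves.  A common neighbour is a leaf, and then they are two steps apart on the cycle, or an
  inner vertex, and then they are in one block.\<close>

lemma result_twos:
  assumes "result u = result v" "result u \<notin> ones" "u \<noteq> v"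
  shows "(u, v) \<notin> parcs halin" "\<not> ((u, w) \<in> parcs halin \<and> (w, v) \<in> parcs halin)"
proof -
  have "u \<in> leaves T" "v \<in> leaves T" using result_inner range assms by metis+
  then obtain k l where k: "k \<in> {1..n}" "u = vtx C k" and l: "l \<in> {1..n}" "v = vtx C l" by (metis leaf_in_vtx)
  have kl: "\<not> close n k l" "b k \<noteq> b l"
    using final_separated[OF k(1) l(1)] assms result_vtx k l by auto
  have adj: "i \<in> {1..n} \<Longrightarrow> i mod n + 1 = (if i = n then 1 else i + 1)" for i by auto
  show "(u, v) \<notin> parcs halin"
  proof
    assume "(u, v) \<in> parcs halin"
    hence "l = k mod n + 1 \<or> k = l mod n + 1" using halin_arc_leaves[OF k(1) l(1)] k l by simp
    hence "close n k l" using adj[OF k(1)] adj[OF l(1)] k l assms(3) by (auto simp: close_def split: if_splits)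
    thus False using kl(1) by simp
  qed
  show "\<not> ((u, w) \<in> parcs halin \<and> (w, v) \<in> parcs halin)"
  proof
    assume *: "(u, w) \<in> parcs halin \<and> (w, v) \<in> parcs halin"
    show False
    proof (cases "w \<in> leaves T")
      case True
      then obtain m where m: "m \<in> {1..n}" "w = vtx C m" by (rule leaf_in_vtx)
      have "m = k mod n + 1 \<or> k = m mod n + 1" using halin_arc_leaves[OF k(1) m(1)] k m * by simp
      moreover have "l = m mod n + 1 \<or> m = l mod n + 1" using halin_arc_leaves[OF m(1) l(1)] l m * by simp
      moreover have "k \<noteq> l" using assms(3) k l by auto
      ultimately have "close n k l"
        using adj[OF k(1)] adj[OF l(1)] adj[OF m(1)] k(1) l(1) m(1) by (auto simp: close_def split: if_splits)
      thus False using kl(1) by simp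
    next
      case False
      hence "(u, w) \<in> parcs T" "(v, w) \<in> parcs T" using * halin_arc_inner tree_sym[OF tree] by blast+
      hence "w = b k" "w = b l" using nbr_iff k l by simp_all
      thus False using kl(2) by simp
    qed
  qed
qed

end

section \<open>Distances\<close>

lemma gdist_ge:
  assumes wf: "pair_wf_digraph G" and "\<And>p. pre_digraph.awalk (with_proj G) u p v \<Longrightarrow> d \<le> length p"
  shows "ereal (real d) \<le> gdist G u v"
proof -
  interpret pair_wf_digraph G by (rule wf)
  have cost: "awalk_cost (\<lambda>_. 1) p = real (length p)" for p :: "('a \<times> 'a) list"
    by (induction p) simp_all
  show ?thesis
    unfolding gdist_def \<mu>_def by (rule INF_greatest) (use assms(2) in \<open>simp add: cost\<close>)
qed

lemma gdist_ge_2: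
  assumes wf: "pair_wf_digraph G" and "u \<noteq> v" "(u, v) \<notin> parcs G"
  shows "ereal (real 2) \<le> gdist G u v"
proof (rule gdist_ge[OF wf])
  interpret pair_wf_digraph G by (rule wf)
  fix p assume p: "awalk u p v"
  show "2 \<le> length p"
  proof (rule ccontr)
    assume "\<not> 2 \<le> length p"
    then consider "p = []" | e where "p = [e]" by (cases p; cases "tl p") auto
    thus False using p assms(2,3) by cases (auto simp: awalk_simps)
  qed
qed

lemma gdist_ge_3:
  assumes wf: "pair_wf_digraph G" and "u \<noteq> v" "(u, v) \<notin> parcs G"
    and "\<And>w. \<not> ((u, w) \<in> parcs G \<and> (w, v) \<in> parcs G)"
  shows "ereal (real 3) \<le> gdist G u v"
proof (rule gdist_ge[OF wf])
  interpret pair_wf_digraph G by (rule wf)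
  fix p assume p: "awalk u p v"
  show "3 \<le> length p"
  proof (rule ccontr)
    assume "\<not> 3 \<le> length p"
    then consider "p = []" | e where "p = [e]" | e f where "p = [e, f]"
      by (cases p; cases "tl p"; cases "tl (tl p)") auto
    thus False using p assms(2-4) by cases (auto simp: awalk_simps)
  qed
qed

lemma (in bounded_tree) result_packing: "packing_coloring halin radius result"
  unfolding packing_coloring_def
proof (intro ballI impI, elim conjE)
  fix u v assume "u \<noteq> v" and eq: "result u = result v"
  show "ereal (real (radius (result u) + 1)) \<le> gdist halin u v"
  proof (cases "result u \<in> ones")
    case True
    hence "(u, v) \<notin> parcs halin" using result_ones_adjacent eq by metis
    moreover have "radius (result u) + 1 = 2" using True by auto
    ultimately show ?thesis using gdist_ge_2[OF halin_wf \<open>u \<noteq> v\<close>] by simp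
  next
    case False
    have "radius (result u) + 1 = 3" using False by (cases "result u") auto
    moreover have "ereal (real 3) \<le> gdist halin u v"
      by (rule gdist_ge_3[OF halin_wf \<open>u \<noteq> v\<close>]) (use result_twos[OF eq False \<open>u \<noteq> v\<close>] in blast)+
    ultimately show ?thesis by simp
  qed
qed

section \<open>Relabelling the cycle and conclusion\<close>

lemma monochromatic_rotate: "monochromatic (rotate m C) \<phi> = monochromatic C \<phi>"
  by (simp add: monochromatic_def)

lemma cycle_edges_rotate: "cycle_edges (rotate m C) = cycle_edges C"
proof -
  have sub: "cycle_edges (rotate m C) \<subseteq> cycle_edges C" for m and C :: "'a list"
  proof
    fix e assume "e \<in> cycle_edges (rotate m C)"
    then obtain i where i: "i < length C" "e = (rotate m C ! i, rotate m C ! (Suc i mod length C))"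
      by (auto simp: cycle_edges_def)
    have "0 < length C" using i(1) by linarith
    let ?j = "(m + i) mod length C"
    have "e = (C ! ?j, C ! (Suc ?j mod length C))"
      using i \<open>0 < length C\<close> by (simp add: nth_rotate mod_simps)
    moreover have "?j < length C" using \<open>0 < length C\<close> by simp
    ultimately show "e \<in> cycle_edges C" unfolding cycle_edges_def by blast
  qed
  have "rotate (m * (length C - 1)) (rotate m C) = C"
  proof (cases "length C")
    case (Suc l)
    have "m * (length C - 1) + m = m * length C" using Suc by simp
    thus ?thesis unfolding rotate_rotate by (subst rotate_conv_mod) simp
  qed simp
  hence "cycle_edges C \<subseteq> cycle_edges (rotate m C)" using sub by metis
  thus ?thesis using sub by blast
qed

lemma (in plane_tree) rotate: "plane_tree T rot (rotate m C)"
proof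
  fix i assume i: "i < length (rotate m C)"
  have "0 < length C" using length_C by linarith
  let ?j = "(m + i) mod length C"
  have "rotate m C ! i = C ! ?j" "rotate m C ! (Suc i mod length (rotate m C)) = C ! (Suc ?j mod length C)"
    using i \<open>0 < length C\<close> by (simp_all add: nth_rotate mod_simps)
  thus "Defs.next_leaf T rot (rotate m C ! i) (rotate m C ! (Suc i mod length (rotate m C)))"
    using next_leaf[of ?j] \<open>0 < length C\<close> by simp
qed (use tree rotation distinct_C set_C length_C in simp_all)

lemma relabel_is_rotation: "\<exists>m. relabel C \<phi> = rotate m C"
  unfolding relabel_def by (metis rotate0 id_apply)

text \<open>The rotated cycle starts at the first leaf whose color differs from that of its predecessor, and this
  predecessor becomes the last leaf.\<close>

lemma (in plane_tree) relabel_ends: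
  assumes "\<not> monochromatic C \<phi>"
  shows "\<phi> (vtx (relabel C \<phi>) 1) \<noteq> \<phi> (vtx (relabel C \<phi>) (length C))"
proof (cases "\<phi> (vtx C 1) \<noteq> \<phi> (vtx C (length C))")
  case True thus ?thesis by (simp add: relabel_def)
next
  case False
  let ?n = "length C"
  let ?P = "\<lambda>i. 2 \<le> i \<and> i \<le> ?n \<and> \<phi> (vtx C i) \<noteq> \<phi> (vtx C (i - 1))"
  define i where "i = (LEAST i. ?P i)"
  have "\<exists>i. ?P i"
  proof (rule ccontr)
    assume no: "\<not> (\<exists>i. ?P i)"
    have "\<phi> (vtx C j) = \<phi> (vtx C 1)" if "1 \<le> j" "j \<le> ?n" for j using that
    proof (induction j rule: dec_induct)
      case (step j)
      have "\<phi> (vtx C (Suc j)) = \<phi> (vtx C j)" using no step.hyps step.prems by fastforce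
      thus ?case using step by simp
    qed simp
    hence "\<phi> u = \<phi> (vtx C 1)" if "u \<in> set C" for u
      using that set_C leaf_in_vtx by (metis atLeastAtMost_iff)
    thus False using assms by (simp add: monochromatic_def)
  qed
  hence i: "?P i" unfolding i_def by (rule LeastI_ex)
  have r: "relabel C \<phi> = rotate (i - 1) C" using False assms by (simp add: relabel_def i_def)
  interpret r: plane_tree T rot "rotate (i - 1) C" by (rule rotate)
  have "vtx (rotate (i - 1) C) 1 = rotate (i - 1) C ! 0" using r.vtx_nth[of 1] length_C by simp
  also have "\<dots> = C ! (i - 1)" using i by (subst nth_rotate) auto
  also have "\<dots> = vtx C i" using i by (subst vtx_nth) auto
  finally have 1: "vtx (rotate (i - 1) C) 1 = vtx C i" .
  have "vtx (rotate (i - 1) C) ?n = rotate (i - 1) C ! (?n - 1)" using r.vtx_nth[of ?n] length_C by simp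
  also have "\<dots> = C ! ((i - 1 + (?n - 1)) mod ?n)" using length_C by (subst nth_rotate) auto
  also have "i - 1 + (?n - 1) = ?n + (i - 2)" using i length_C by simp
  also have "(?n + (i - 2)) mod ?n = i - 2" unfolding mod_add_self1 using i length_C by (intro mod_less) linarith
  also have "C ! (i - 2) = vtx C (i - 1)" using i by (subst vtx_nth) (auto simp: numeral_2_eq_2)
  finally show ?thesis unfolding r using 1 i by simp
qed

theorem theorem3p5:
  fixes G T :: "'v pair_pre_digraph" and rot :: "'v \<Rightarrow> 'v \<Rightarrow> 'v" and C :: "'v list" and r :: 'v
  assumes "halin_graph G T rot C"
    and "max_degree G \<le> 5"
    and "r \<in> pverts T"
  shows "packing_coloring G radius (packing_coloring_algorithm T C r)"
proof -
  define \<phi> where "\<phi> = bfs_coloring T r"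
  define C' where "C' = relabel C \<phi>"
  have T: "is_tree T" using assms(1) by (simp add: halin_graph_def)
  interpret C: plane_tree T rot C
    using assms(1) by unfold_locales (auto simp: halin_graph_def)
  obtain m where m: "C' = rotate m C" using relabel_is_rotation C'_def by metis
  interpret C': plane_tree T rot C' unfolding m by (rule C.rotate)
  have G: "G = \<lparr>pverts = pverts T, parcs = parcs T \<union> cycle_edges C' \<union> (cycle_edges C')\<inverse>\<rparr>"
    using assms(1) unfolding m cycle_edges_rotate by (simp add: halin_graph_def)
  interpret pair_graph T using T by (simp add: is_tree_def)
  interpret B: bounded_tree T rot C' \<phi>
  proof
    show "\<phi> u \<noteq> \<phi> v" if "(u, v) \<in> parcs T" for u v
      unfolding \<phi>_def by (rule bfs_coloring_proper[OF T assms(3) that])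
    show "\<phi> v \<in> ones" for v unfolding \<phi>_def by (rule bfs_coloring_range)
    show "\<phi> (vtx C' 1) \<noteq> \<phi> (vtx C' (length C'))" if "\<not> monochromatic C' \<phi>"
    proof -
      have "\<not> monochromatic C \<phi>" using that unfolding m monochromatic_rotate .
      hence "\<phi> (vtx C' 1) \<noteq> \<phi> (vtx C' (length C))" unfolding C'_def by (rule C.relabel_ends)
      thus ?thesis by (simp add: m)
    qed
    show "out_degree (with_proj T) v \<le> 5" if v: "v \<in> pverts T" for v
    proof -
      have "finite (cycle_edges C')" by (simp add: cycle_edges_def)
      hence fin: "finite (parcs G)" using pair_finite_arcs by (simp add: G)
      have "out_degree (with_proj T) v \<le> out_degree (with_proj G) v"
        unfolding out_degree_def
        by (rule card_mono) (auto simp: out_arcs_def G intro: finite_subset[OF _ fin])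
      also have "\<dots> \<le> max_degree G"
        unfolding max_degree_def by (rule Max_ge) (use v pair_finite_verts in \<open>simp_all add: G\<close>)
      finally show ?thesis using assms(2) by simp
    qed
  qed
  have "G = B.halin" unfolding G B.halin_def ..
  moreover have "packing_coloring_algorithm T C r = B.result"
    unfolding packing_coloring_algorithm_def Let_def B.result_def \<phi>_def[symmetric] C'_def[symmetric] ..
  ultimately show ?thesis using B.result_packing by simp
qed

end
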